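(* For every $r\in(2,3)$ there exists a constant $c_r>0$, depending only on $r$, such that the following holds with the determining wavenumber $\Lambda_{u,r}(t)$ defined using this $c_r$. Let $L>0$, $\nu>0$, let $f$ be a zero-mean force, and let $u(t)$ and $v(t)$ be two Leray-Hopf solutions of the 3D Navier-Stokes equations on $\mathbb{T}^3=[0,L]^3$ (with the same $\nu$ and $f$) on the weak global attractor $\mathcal{A}$, i.e. complete bounded Leray-Hopf solutions, defined for all $t\in\mathbb{R}$. Let $\Lambda(t):=\max\{\Lambda_{u,r}(t),\Lambda_{v,r}(t)\}$ and let $Q(t)$ be such that $\Lambda(t)=\lambda_{Q(t)}$. If $$u(t)_{\le Q(t)}=v(t)_{\le Q(t)}\qquad\text{for all } t<0,$$ then $$u(t)=v(t)\qquad\text{for all } t\le 0 .$$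
   Context: Equations: on the torus $\mathbb{T}^3=[0,L]^3$ (periodic), $u_t+(u\cdot\nabla)u-\nu\Delta u+\nabla p=f$, $\nabla\cdot u=0$, with $\nu>0$, $f\in H^{-1}(\mathbb{T}^3)$ a time-independent force of zero mean; all solutions are of zero mean. Leray-Hopf solution on $[0,T]$: a function $u\in C_{\mathrm w}([0,T];L^2(\mathbb{T}^3))\cap L^2_{\rm loc}([0,T];H^1(\mathbb{T}^3))$ (weakly continuous in time with values in $L^2$), with $\nabla\cdot u=0$ in the sense of distributions, such that $$(u(t),\varphi(t))+\int_0^t\big[-(u,\partial_t\varphi)+\nu(\nabla u,\nabla\varphi)+(u\cdot\nabla u,\varphi)-(f,\varphi)\big]\,ds=(u(0),\varphi(0))$$ for all $t\in[0,T]$ and all $\varphi\in C^\infty([0,T]\times\mathbb{T}^3)$ with $\nabla\cdot\varphi=0$, and satisfying the energy inequality $$\tfrac12\|u(t)\|_{L^2}^2\le\tfrac12\|u(t_0)\|_{L^2}^2+\int_{t_0}^t\big[-\nu\|\nabla u(s)\|_{L^2}^2+(f,u)\big]\,ds$$ for almost all $t_0\in(0,T)$ and all $t\in[t_0,T]$. The same definition applies on any interval $[T_1,T_2]$ by time translation. A complete bounded Leray-Hopf solution is a function $u:\mathbb{R}\to L^2(\mathbb{T}^3)$ that is a Leray-Hopf solution on every interval $[T_1,T_2]$ and satisfies $\sup_{t\in\mathbb{R}}\|u(t)\|_{L^2}<\infty$. The weak global attractor is $\mathcal{A}=\{u(0): u(\cdot)\text{ is a complete bounded Leray-Hopf solution}\}$.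 Littlewood-Paley projections: $\lambda_q:=2^q/L$ for integers $q$. Fix once and for all a nonnegative radial $\chi\in C_0^\infty(\mathbb{R}^3)$ with $\chi(\xi)=1$ for $|\xi|\le 3/4$ and $\chi(\xi)=0$ for $|\xi|\ge1$ (constants may depend on this fixed $\chi$). Let $\varphi(\xi)=\chi(\xi/2)-\chi(\xi)$, $\varphi_q(\xi)=\varphi(2^{-q}\xi)$ for $q\ge0$, $\varphi_{-1}=\chi$. For $q\ge-1$, $u_q:=\Delta_q u:=\sum_{k\in\mathbb{Z}^3}\widehat u(k)\varphi_q(k)e^{i\frac{2\pi}{L}k\cdot x}$, where $\widehat u(k)$ is the $k$th Fourier coefficient, and $u_{\le q}:=\sum_{p=-1}^q u_p$. Determining wavenumber: for $r\in(2,3)$ and a constant $c_r>0$, $$\Lambda_{u,r}(t):=\min\{\lambda_q:\ q\in\mathbb{N},\ \lambda_p^{-1+\frac3r}\|u_p(t)\|_{L^r}<c_r\nu\ \ \forall p>q,\ \text{ and }\ \lambda_q^{-1}\|u_{\le q}(t)\|_{L^\infty}<c_r\nu\},$$ where $\mathbb{N}=\{0,1,2,\dots\}$ and $\min\emptyset=\infty$. If $\Lambda(t)=\infty$ then $Q(t)=\infty$ and $u_{\le\infty}:=u$. *)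

theory Defs
  imports "HOL-Analysis.Analysis" "HOL-Probability.Essential_Supremum"
    "HOL-Library.Extended_Nat"
begin

section \<open>Functions on the torus\<close>

text \<open>
  A function on the torus is an \<open>L\<close>-periodic function on \<open>\<real>\<^sup>3\<close>; an element of a Lebesgue space
  is given by a representative, and equality of such elements is equality almost everywhere
  with respect to the measure below. Lebesgue measure (rather than its Borel restriction) is
  used throughout, so that changing a function on a null set never affects measurability.
\<close>

type_synonym vfield = "real^3 \<Rightarrow> real^3"

abbreviation torus :: "real \<Rightarrow> (real^3) measure" where
  "torus L \<equiv> lebesgue_on (cbox 0 (vec L))"

definition periodic :: "real \<Rightarrow> (real^3 \<Rightarrow> 'a) \<Rightarrow> bool" where
  "periodic L g \<longleftrightarrow> (\<forall>x i. g (x + L *\<^sub>R axis i 1) = g x)"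

definition L2_field :: "real \<Rightarrow> vfield \<Rightarrow> bool" where
  "L2_field L g \<longleftrightarrow> periodic L g \<and> g \<in> borel_measurable (torus L) \<and>
     integrable (torus L) (\<lambda>x. (norm (g x))\<^sup>2)"

definition L2_inner :: "real \<Rightarrow> vfield \<Rightarrow> vfield \<Rightarrow> real" where
  "L2_inner L g h = (LINT x|torus L. g x \<bullet> h x)"

definition L2_norm :: "real \<Rightarrow> vfield \<Rightarrow> real" where
  "L2_norm L g = sqrt (L2_inner L g g)"

definition Lr_norm :: "real \<Rightarrow> real \<Rightarrow> vfield \<Rightarrow> real" where
  "Lr_norm L r g = (LINT x|torus L. norm (g x) powr r) powr (1 / r)"

definition Linf_norm :: "real \<Rightarrow> vfield \<Rightarrow> ereal" where
  "Linf_norm L g = esssup (torus L) (\<lambda>x. ereal (norm (g x)))"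


section \<open>Smooth functions and derivatives\<close>

text \<open>
  Derivatives are taken within \<open>S\<close>; for convex \<open>S\<close> with nonempty interior, such as
  \<open>[T\<^sub>1,T\<^sub>2] \<times> \<real>\<^sup>3\<close>, they are unique and this is smoothness up to the boundary.
\<close>

primrec Ck_on :: "nat \<Rightarrow> 'a::real_normed_vector set \<Rightarrow> ('a \<Rightarrow> 'b::real_normed_vector) \<Rightarrow> bool"
where
  "Ck_on 0 S g \<longleftrightarrow> continuous_on S g"
| "Ck_on (Suc k) S g \<longleftrightarrow>
     (\<exists>g'. (\<forall>x\<in>S. (g has_derivative g' x) (at x within S)) \<and> (\<forall>v. Ck_on k S (\<lambda>x. g' x v)))"

definition smooth_on :: "'a::real_normed_vector set \<Rightarrow> ('a \<Rightarrow> 'b::real_normed_vector) \<Rightarrow> bool" where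
  "smooth_on S g \<longleftrightarrow> (\<forall>k. Ck_on k S g)"

definition pderiv_x :: "3 \<Rightarrow> (real^3 \<Rightarrow> 'a::real_normed_vector) \<Rightarrow> real^3 \<Rightarrow> 'a" where
  "pderiv_x i g x = vector_derivative (\<lambda>h. g (x + h *\<^sub>R axis i 1)) (at 0)"

definition is_weak_pderiv :: "real \<Rightarrow> 3 \<Rightarrow> vfield \<Rightarrow> vfield \<Rightarrow> bool" where
  "is_weak_pderiv L i g h \<longleftrightarrow>
     (\<forall>\<psi> :: real^3 \<Rightarrow> real. smooth_on UNIV \<psi> \<and> periodic L \<psi> \<longrightarrow>
        (LINT x|torus L. pderiv_x i \<psi> x *\<^sub>R g x) = - (LINT x|torus L. \<psi> x *\<^sub>R h x))"

definition H1_field :: "real \<Rightarrow> vfield \<Rightarrow> bool" where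
  "H1_field L g \<longleftrightarrow> L2_field L g \<and> (\<forall>i. \<exists>h. L2_field L h \<and> is_weak_pderiv L i g h)"

definition weak_pderiv :: "real \<Rightarrow> 3 \<Rightarrow> vfield \<Rightarrow> vfield" where
  "weak_pderiv L i g = (SOME h. L2_field L h \<and> is_weak_pderiv L i g h)"

definition grad_norm_sq :: "real \<Rightarrow> vfield \<Rightarrow> real" where
  "grad_norm_sq L g = (\<Sum>i\<in>UNIV. (L2_norm L (weak_pderiv L i g))\<^sup>2)"

definition H1_norm :: "real \<Rightarrow> vfield \<Rightarrow> real" where
  "H1_norm L g = sqrt ((L2_norm L g)\<^sup>2 + grad_norm_sq L g)"

definition div_free_distr :: "real \<Rightarrow> vfield \<Rightarrow> bool" where
  "div_free_distr L g \<longleftrightarrow>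
     (\<forall>\<psi> :: real^3 \<Rightarrow> real. smooth_on UNIV \<psi> \<and> periodic L \<psi> \<longrightarrow>
        (LINT x|torus L. (\<Sum>i\<in>UNIV. g x $ i * pderiv_x i \<psi> x)) = 0)"

definition advection :: "real \<Rightarrow> vfield \<Rightarrow> vfield" where
  "advection L g x = (\<Sum>j\<in>UNIV. (g x $ j) *\<^sub>R weak_pderiv L j g x)"

text \<open>
  \<open>H\<^sup>-\<^sup>1\<close> is the dual of \<open>H\<^sup>1\<close>: a force is a functional \<open>F\<close>, with \<open>F g\<close> standing for
  the pairing \<open>(f, g)\<close>. Only its values on \<open>H\<^sup>1\<close> fields matter.
\<close>

definition Hminus1 :: "real \<Rightarrow> (vfield \<Rightarrow> real) \<Rightarrow> bool" where
  "Hminus1 L F \<longleftrightarrow>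
     (\<forall>g h. H1_field L g \<and> H1_field L h \<longrightarrow> F (\<lambda>x. g x + h x) = F g + F h) \<and>
     (\<forall>a g. H1_field L g \<longrightarrow> F (\<lambda>x. a *\<^sub>R g x) = a * F g) \<and>
     (\<exists>C. \<forall>g. H1_field L g \<longrightarrow> \<bar>F g\<bar> \<le> C * H1_norm L g)"

definition zero_mean_force :: "(vfield \<Rightarrow> real) \<Rightarrow> bool" where
  "zero_mean_force F \<longleftrightarrow> (\<forall>a. F (\<lambda>x. a) = 0)"


section \<open>Leray-Hopf solutions\<close>

definition test_field :: "real \<Rightarrow> real \<Rightarrow> real \<Rightarrow> (real \<Rightarrow> vfield) \<Rightarrow> bool" where
  "test_field L T1 T2 \<phi> \<longleftrightarrow>
     smooth_on ({T1..T2} \<times> UNIV) (\<lambda>(s, x). \<phi> s x) \<and>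
     (\<forall>s\<in>{T1..T2}. periodic L (\<phi> s)) \<and>
     (\<forall>s\<in>{T1..T2}. \<forall>x. (\<Sum>i\<in>UNIV. pderiv_x i (\<lambda>y. \<phi> s y $ i) x) = 0)"

text \<open>
  Strong measurability of \<open>u\<close> as an \<open>H\<^sup>1\<close>-valued map is not listed separately: by Pettis'
  theorem it follows from weak continuity in \<open>L\<^sup>2\<close>. All integrands in time below are then
  integrable, so none of the integrals takes its default value.
\<close>

definition leray_hopf ::
  "real \<Rightarrow> real \<Rightarrow> (vfield \<Rightarrow> real) \<Rightarrow> real \<Rightarrow> real \<Rightarrow> (real \<Rightarrow> vfield) \<Rightarrow> bool"
where
  "leray_hopf L \<nu> F T1 T2 u \<longleftrightarrow>
     (\<forall>t\<in>{T1..T2}. L2_field L (u t)) \<and>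
     (\<forall>w. L2_field L w \<longrightarrow> continuous_on {T1..T2} (\<lambda>t. L2_inner L (u t) w)) \<and>
     (AE t in lebesgue_on {T1..T2}. H1_field L (u t)) \<and>
     integrable (lebesgue_on {T1..T2}) (\<lambda>t. (H1_norm L (u t))\<^sup>2) \<and>
     (\<forall>t\<in>{T1..T2}. (LINT x|torus L. u t x) = 0) \<and>
     (\<forall>t\<in>{T1..T2}. div_free_distr L (u t)) \<and>
     (\<forall>\<phi>. test_field L T1 T2 \<phi> \<longrightarrow>
        (\<forall>t\<in>{T1..T2}.
           L2_inner L (u t) (\<phi> t) +
           (LINT s|lebesgue_on {T1..t}.
              - L2_inner L (u s) (\<lambda>x. vector_derivative (\<lambda>s'. \<phi> s' x) (at s within {T1..T2}))
              + \<nu> * (\<Sum>i\<in>UNIV. L2_inner L (weak_pderiv L i (u s)) (pderiv_x i (\<phi> s)))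
              + L2_inner L (advection L (u s)) (\<phi> s)
              - F (\<phi> s))
           = L2_inner L (u T1) (\<phi> T1))) \<and>
     (AE t0 in lebesgue_on {T1<..<T2}. \<forall>t\<in>{t0..T2}.
        (L2_norm L (u t))\<^sup>2 / 2 \<le> (L2_norm L (u t0))\<^sup>2 / 2 +
          (LINT s|lebesgue_on {t0..t}. - \<nu> * grad_norm_sq L (u s) + F (u s)))"

definition complete_bounded_leray_hopf ::
  "real \<Rightarrow> real \<Rightarrow> (vfield \<Rightarrow> real) \<Rightarrow> (real \<Rightarrow> vfield) \<Rightarrow> bool"
where
  "complete_bounded_leray_hopf L \<nu> F u \<longleftrightarrow>
     (\<forall>T1 T2. T1 < T2 \<longrightarrow> leray_hopf L \<nu> F T1 T2 u) \<and>
     bdd_above (range (\<lambda>t. L2_norm L (u t)))"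


section \<open>Littlewood-Paley projections\<close>

text \<open>Compactness of the support is contained in the vanishing for \<open>\<bar>\<xi>\<bar> \<ge> 1\<close>.\<close>

definition lp_cutoff :: "(real^3 \<Rightarrow> real) \<Rightarrow> bool" where
  "lp_cutoff chi \<longleftrightarrow> smooth_on UNIV chi \<and> (\<forall>\<xi>. 0 \<le> chi \<xi>) \<and>
     (\<forall>\<xi> \<eta>. norm \<xi> = norm \<eta> \<longrightarrow> chi \<xi> = chi \<eta>) \<and>
     (\<forall>\<xi>. norm \<xi> \<le> 3/4 \<longrightarrow> chi \<xi> = 1) \<and> (\<forall>\<xi>. 1 \<le> norm \<xi> \<longrightarrow> chi \<xi> = 0)"

text \<open>Meaningful for \<open>q \<ge> -1\<close>.\<close>

definition lp_symbol :: "(real^3 \<Rightarrow> real) \<Rightarrow> int \<Rightarrow> real^3 \<Rightarrow> real" where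
  "lp_symbol chi q \<xi> =
     (if q = -1 then chi \<xi>
      else let \<eta> = (2 powi (- q)) *\<^sub>R \<xi> in chi (\<eta> /\<^sub>R 2) - chi \<eta>)"

definition freq :: "int^3 \<Rightarrow> real^3" where
  "freq k = (\<chi> i. of_int (k $ i))"

definition fourier_coeff :: "real \<Rightarrow> vfield \<Rightarrow> int^3 \<Rightarrow> complex^3" where
  "fourier_coeff L g k =
     (\<chi> j. (LINT x|torus L. complex_of_real (g x $ j) * cis (- (2 * pi / L) * (freq k \<bullet> x)))
           / complex_of_real (L ^ 3))"

text \<open>
  The sum over frequencies has finitely many nonzero terms. It is real because \<open>g\<close> is real
  and the symbol is even, so taking the real part only changes the type.
\<close>

definition lp_proj :: "real \<Rightarrow> (real^3 \<Rightarrow> real) \<Rightarrow> int \<Rightarrow> vfield \<Rightarrow> vfield" where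
  "lp_proj L chi q g x =
     (\<chi> j. Re (\<Sum>\<^sub>\<infinity>k\<in>UNIV. fourier_coeff L g k $ j * complex_of_real (lp_symbol chi q (freq k))
                            * cis ((2 * pi / L) * (freq k \<bullet> x))))"

definition lp_low :: "real \<Rightarrow> (real^3 \<Rightarrow> real) \<Rightarrow> int \<Rightarrow> vfield \<Rightarrow> vfield" where
  "lp_low L chi q g x = (\<Sum>p\<in>{-1..q}. lp_proj L chi p g x)"

definition wavenum :: "real \<Rightarrow> int \<Rightarrow> real" where
  "wavenum L q = 2 powi q / L"

fun wavenum_ext :: "real \<Rightarrow> enat \<Rightarrow> ereal" where
  "wavenum_ext L (enat q) = ereal (wavenum L (int q))"
| "wavenum_ext L \<infinity> = \<infinity>"

fun lp_low_ext :: "real \<Rightarrow> (real^3 \<Rightarrow> real) \<Rightarrow> enat \<Rightarrow> vfield \<Rightarrow> vfield" where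
  "lp_low_ext L chi (enat q) g = lp_low L chi (int q) g"
| "lp_low_ext L chi \<infinity> g = g"


section \<open>The determining wavenumber\<close>

text \<open>
  The infimum is a minimum whenever the set is nonempty, since \<open>\<lambda>\<^sub>q\<close> increases in
  \<open>q \<in> \<nat>\<close>, and it is \<open>\<infinity>\<close> for the empty set.
\<close>

definition det_wavenum ::
  "real \<Rightarrow> (real^3 \<Rightarrow> real) \<Rightarrow> real \<Rightarrow> real \<Rightarrow> real \<Rightarrow> vfield \<Rightarrow> ereal"
where
  "det_wavenum L chi r c \<nu> g = Inf {ereal (wavenum L (int q)) | q :: nat.
     (\<forall>p>int q. wavenum L p powr (-1 + 3 / r) * Lr_norm L r (lp_proj L chi p g) < c * \<nu>) \<and>
     ereal (1 / wavenum L (int q)) * Linf_norm L (lp_low L chi (int q) g) < ereal (c * \<nu>)}"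

end

theory Submission
  imports Defs
begin

text \<open>
  Let \<open>w\<close> be the difference of the two solutions. Its Fourier coefficients of frequency at most
  \<open>3/2 * 2 ^ Q\<close> vanish at every negative time, and the truncated energy of \<open>w\<close> changes by the
  dissipation and by trilinear terms \<open>\<integral> u\<^sub>j w\<^sub>i \<partial>\<^sub>j (P w)\<^sub>i\<close> and \<open>\<integral> w\<^sub>j v\<^sub>i \<partial>\<^sub>j (P w)\<^sub>i\<close>. The low part of
  \<open>u\<close> is bounded by \<open>c \<nu> \<lambda>\<^sub>Q\<close>, and the \<open>L\<^sup>r\<close> bounds on the high pieces of \<open>u\<close> make multiplication by \<open>u\<close>
  a bounded operator from \<open>H\<^sup>1\<close> (restricted to high frequencies) to \<open>L\<^sup>2\<close> of norm \<open>O(c \<nu>)\<close>; the same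
  holds for \<open>v\<close>. For small \<open>c\<close> the dissipation absorbs the trilinear terms, so the energy of \<open>w\<close> decays at a
  uniform exponential rate, and being bounded for all negative times it vanishes.
\<close>


section \<open>Fourier modes on the torus\<close>

text \<open>The difference \<open>w\<close> is only weakly continuous in time, so it cannot be
  inserted as a test function. A single Fourier coefficient of \<open>w\<close>, however, is
  Lipschitz in time and satisfies an exact energy identity in which the force has cancelled, so the
  energy is followed through finite sums of modes. The price is that the transport term, tested with
  a truncation of \<open>w\<close>, does not cancel. Both trilinear terms have to be estimated, and
  therefore both \<open>u\<close> and \<open>v\<close> must be controlled at the same level
  \<open>Q\<close>. Moreover these terms contain the whole of \<open>w\<close>: they are absorbed by
  the full dissipation, and the truncation is removed by dominated convergence in time, with the
  \<open>H^1\<close> norms as majorant. The high pieces of \<open>u\<close> have suprema of order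
  \<open>c \<nu> \<lambda>_p\<close>, which is not summable over \<open>p\<close>. The sum converges
  because of the decay of their \<open>L^r\<close> norms for \<open>r < 3\<close>: the interaction
  of piece \<open>p\<close> of \<open>u\<close> with shell \<open>q\<close> of \<open>w\<close>
  decays geometrically in \<open>|p - q|\<close>.\<close>

definition expw :: "real \<Rightarrow> int^3 \<Rightarrow> real^3 \<Rightarrow> complex" where
  "expw L k x = cis ((2 * pi / L) * (freq k \<bullet> x))"

lemma freq_zero [simp]: "freq 0 = 0"
  and freq_add: "freq (k + l) = freq k + freq l"
  and freq_minus: "freq (- k) = - freq k"
  and freq_nth [simp]: "freq k $ i = of_int (k $ i)"
  by (simp_all add: freq_def vec_eq_iff)

lemma norm_expw [simp]: "norm (expw L k x) = 1"
  by (simp add: expw_def)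

lemma expw_zero [simp]: "expw L 0 x = 1"
  by (simp add: expw_def)

lemma expw_add: "expw L (k + l) x = expw L k x * expw L l x"
  by (simp add: expw_def freq_add inner_add_left distrib_left cis_mult)

lemma expw_minus: "expw L (- k) x = cnj (expw L k x)"
  by (simp add: expw_def freq_minus cis_cnj)

lemma continuous_expw [continuous_intros]: "continuous_on S (expw L k)"
  unfolding expw_def by (intro continuous_intros)

lemma expw_borel [measurable]: "expw L k \<in> borel_measurable borel"
  by (intro borel_measurable_continuous_onI continuous_expw)

lemma periodic_expw: "L \<noteq> 0 \<Longrightarrow> periodic L (expw L k)"
  unfolding periodic_def expw_def
proof (intro allI)
  fix x :: "real^3" and i :: 3
  assume "L \<noteq> 0"
  then have "(2 * pi / L) * (freq k \<bullet> (x + L *\<^sub>R axis i 1)) = (2 * pi / L) * (freq k \<bullet> x) + 2 * pi * of_int (k $ i)"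
    by (simp add: inner_add_right distrib_left inner_axis)
  then show "cis (2 * pi / L * (freq k \<bullet> (x + L *\<^sub>R axis i 1))) = cis (2 * pi / L * (freq k \<bullet> x))"
    by (simp add: cis_mult[symmetric] cis_multiple_2pi)
qed

section \<open>Integration of the modes over the box\<close>

lemma integral_cis_interval:
  assumes "a \<noteq> 0" "cis (a * L) = 1" "0 \<le> L"
  shows "(LINT t|lborel. indicator {0..L} t *\<^sub>R cis (a * t)) = 0"
proof -
  have "(LINT t|lborel. indicator {0..L} t *\<^sub>R cis (a * t)) = cis (a * L) / (\<i> * a) - cis (a * 0) / (\<i> * a)"
  proof (rule integral_FTC_Icc)
    fix x
    have "((\<lambda>z. exp (\<i> * (complex_of_real a * z)) / (\<i> * complex_of_real a)) has_field_derivative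
        exp (\<i> * (complex_of_real a * complex_of_real x))) (at (complex_of_real x))"
      by (rule derivative_eq_intros refl | simp add: assms(1) algebra_simps)+
    from has_vector_derivative_real_field[OF this]
    show "((\<lambda>t. cis (a * t) / (\<i> * complex_of_real a)) has_vector_derivative cis (a * x)) (at x within {0..L})"
      by (simp add: cis_conv_exp)
  qed (use assms in \<open>auto intro!: continuous_intros\<close>)
  then show ?thesis using assms(2) by simp
qed

text \<open>By \<open>lborel_eq\<close>, \<open>lborel\<close> is the image of the product of
  one-dimensional Lebesgue measures over \<open>Basis\<close>, so the product formula for integrals
  applies coordinate by coordinate.\<close>

lemma lborel_integral_prod_Basis:
  fixes h :: "'a::euclidean_space \<Rightarrow> real \<Rightarrow> complex"
  assumes "\<And>b. b \<in> Basis \<Longrightarrow> integrable lborel (h b)"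
  shows "(LINT x|lborel. (\<Prod>b\<in>Basis. h b (x \<bullet> b))) = (\<Prod>b\<in>Basis. LINT t|lborel. h b t)"
proof -
  have m: "h b \<in> borel_measurable borel" if "b \<in> Basis" for b
    using borel_measurable_integrable[OF assms[OF that]] by simp
  interpret product_sigma_finite "\<lambda>b::'a. lborel :: real measure" ..
  have "(LINT x|lborel. (\<Prod>b\<in>Basis. h b (x \<bullet> b)))
      = (LINT f|(\<Pi>\<^sub>M b\<in>Basis. lborel). (\<Prod>b\<in>Basis. h b ((\<Sum>c\<in>Basis. f c *\<^sub>R c) \<bullet> b)))"
    unfolding lborel_eq[where 'a='a]
  proof (subst integral_distr)
    show "(\<lambda>x::'a. \<Prod>b\<in>Basis. h b (x \<bullet> b)) \<in> borel_measurable borel"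
      by (intro borel_measurable_prod measurable_compose[OF _ m]) auto
  qed auto
  also have "\<dots> = (LINT f|(\<Pi>\<^sub>M b\<in>Basis. lborel). (\<Prod>b\<in>Basis. h b (f b)))"
    by (intro Bochner_Integration.integral_cong prod.cong refl arg_cong2[where f=h])
       (simp_all add: inner_sum_left inner_Basis if_distrib cong: if_cong)
  also have "\<dots> = (\<Prod>b\<in>Basis. LINT t|lborel. h b t)"
    using assms by (intro product_integral_prod) auto
  finally show ?thesis .
qed

lemma integral_torus_borel:
  fixes f :: "real^3 \<Rightarrow> 'b::{banach, second_countable_topology}"
  assumes "f \<in> borel_measurable borel"
  shows "integral\<^sup>L (torus L) f = (LINT x|lborel. indicator (cbox 0 (vec L)) x *\<^sub>R f x)"
  using assms by (subst integral_restrict_space) (auto intro!: integral_completion)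

text \<open>All orthogonality relations come from this formula, because \<open>expw_add\<close> and
  \<open>expw_minus\<close> turn the product of one mode with the conjugate of another into a single
  mode.\<close>

lemma expw_integral:
  assumes "0 < L"
  shows "(LINT x|torus L. expw L k x) = (if k = 0 then complex_of_real (L ^ 3) else 0)"
proof -
  define h where "h b t = indicator {0..L} t *\<^sub>R cis ((2 * pi / L) * (freq k \<bullet> b) * t)" for b :: "real^3" and t
  have "indicator (cbox 0 (vec L)) x *\<^sub>R expw L k x = (\<Prod>b\<in>Basis. h b (x \<bullet> b))" for x :: "real^3"
  proof -
    have 1: "indicator (cbox 0 (vec L)) x = (\<Prod>b\<in>Basis. indicator {0..L} (x \<bullet> b) :: real)"
    proof (cases "x \<in> cbox 0 (vec L)")
      case True
      then have "indicator {0..L} (x \<bullet> b) = (1::real)" if "b \<in> Basis" for b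
        using that by (auto simp: mem_box Basis_vec_def inner_axis)
      then show ?thesis using True by simp
    next
      case False
      then obtain i where "x $ i \<notin> {0..L}"
        by (auto simp: mem_box Basis_vec_def inner_axis)
      then have b: "axis i 1 \<in> (Basis :: (real^3) set)" "x \<bullet> axis i 1 \<notin> {0..L}"
        by (auto simp: axis_in_Basis_iff inner_axis)
      then have "indicator {0..L} (x \<bullet> axis i 1) = (0::real)" by simp
      then have "(\<Prod>b\<in>Basis. indicator {0..L} (x \<bullet> b) :: real) = 0"
        using b(1) by (intro prod_zero) auto
      then show ?thesis using False by simp
    qed
    have 2: "expw L k x = (\<Prod>b\<in>Basis. cis ((2 * pi / L) * (freq k \<bullet> b) * (x \<bullet> b)))"
    proof -
      have cs: "cis (sum g S) = (\<Prod>b\<in>S. cis (g b))" if "finite S" for g and S :: "(real^3) set"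
        using that by (induction S rule: finite_induct) (auto simp: cis_mult[symmetric])
      have "(\<Prod>b\<in>Basis. cis ((2 * pi / L) * (freq k \<bullet> b) * (x \<bullet> b)))
         = cis (\<Sum>b\<in>Basis. (2 * pi / L) * (freq k \<bullet> b) * (x \<bullet> b))"
        by (rule cs[OF finite_Basis, symmetric])
      also have "(\<Sum>b\<in>Basis. (2 * pi / L) * (freq k \<bullet> b) * (x \<bullet> b)) = (2 * pi / L) * (freq k \<bullet> x)"
        by (subst euclidean_inner) (simp add: sum_distrib_left mult.assoc)
      finally show ?thesis by (simp add: expw_def)
    qed
    show ?thesis
      unfolding 1 2 h_def by (simp add: prod.distrib scaleR_conv_of_real)
  qed
  then have "(LINT x|torus L. expw L k x) = (LINT x|lborel. (\<Prod>b\<in>Basis. h b (x \<bullet> b)))"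
    by (simp add: integral_torus_borel)
  also have "\<dots> = (\<Prod>b\<in>Basis. LINT t|lborel. h b t)"
    unfolding h_def
    by (intro lborel_integral_prod_Basis borel_integrable_compact) (use assms in \<open>auto intro!: continuous_intros\<close>)
  also have "\<dots> = (if k = 0 then complex_of_real (L ^ 3) else 0)"
  proof (cases "k = 0")
    case True
    then have "(LINT t|lborel. h b t) = complex_of_real L" if "b \<in> Basis" for b
      using assms by (simp add: h_def scaleR_conv_of_real del: of_real_indicator)
    then show ?thesis using True by simp
  next
    case False
    then obtain i where i: "k $ i \<noteq> 0" by (auto simp: vec_eq_iff)
    have b: "axis i 1 \<in> (Basis :: (real^3) set)" by (simp add: axis_in_Basis_iff)
    have "(LINT t|lborel. h (axis i 1) t) = 0"
      unfolding h_def
    proof (rule integral_cis_interval)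
      have "2 * pi / L * (freq k \<bullet> axis i 1) * L = 2 * pi * of_int (k $ i)"
        using assms by (simp add: inner_axis)
      then show "cis (2 * pi / L * (freq k \<bullet> axis i 1) * L) = 1"
        by (simp add: cis_multiple_2pi)
    qed (use assms i in \<open>auto simp: inner_axis\<close>)
    with b False show ?thesis by (auto intro!: prod_zero)
  qed
  finally show ?thesis .
qed

section \<open>Square-integrable functions\<close>

text \<open>Square integrability of a representative, without the periodicity contained in
  \<open>L2_field\<close>, so that indicators, components and products with modes are treated alike
  for real, complex and vector values.\<close>

definition sqint :: "'a measure \<Rightarrow> ('a \<Rightarrow> 'b::{real_normed_vector, second_countable_topology}) \<Rightarrow> bool" where
  "sqint M f \<longleftrightarrow> f \<in> borel_measurable M \<and> integrable M (\<lambda>x. (norm (f x))\<^sup>2)"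

definition l2 :: "'a measure \<Rightarrow> ('a \<Rightarrow> 'b::{real_normed_vector, second_countable_topology}) \<Rightarrow> real" where
  "l2 M f = sqrt (LINT x|M. (norm (f x))\<^sup>2)"

lemma sqint_borel: "sqint M f \<Longrightarrow> f \<in> borel_measurable M"
  and sqint_integrable: "sqint M f \<Longrightarrow> integrable M (\<lambda>x. (norm (f x))\<^sup>2)"
  by (auto simp: sqint_def)

lemma l2_nonneg [simp]: "0 \<le> l2 M f"
  by (simp add: l2_def)

lemma l2_squared: "(l2 M f)\<^sup>2 = (LINT x|M. (norm (f x))\<^sup>2)"
  by (simp add: l2_def)

lemma sqint_norm: "sqint M f \<Longrightarrow> sqint M (\<lambda>x. norm (f x))"
  by (auto simp: sqint_def)

lemma l2_norm: "l2 M (\<lambda>x. norm (f x)) = l2 M f"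
  by (simp add: l2_def)

lemma sqint_add:
  assumes "sqint M f" "sqint M g" shows "sqint M (\<lambda>x. f x + g x)"
  unfolding sqint_def
proof
  show m: "(\<lambda>x. f x + g x) \<in> borel_measurable M"
    using assms by (auto simp: sqint_def)
  show "integrable M (\<lambda>x. (norm (f x + g x))\<^sup>2)"
  proof (rule Bochner_Integration.integrable_bound)
    show "integrable M (\<lambda>x. 2 * (norm (f x))\<^sup>2 + 2 * (norm (g x))\<^sup>2)"
      using assms by (auto simp: sqint_def)
    have "(norm (f x + g x))\<^sup>2 \<le> 2 * (norm (f x))\<^sup>2 + 2 * (norm (g x))\<^sup>2" for x
    proof -
      have "(norm (f x + g x))\<^sup>2 \<le> (norm (f x) + norm (g x))\<^sup>2"
        by (intro power_mono norm_triangle_ineq) simp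
      also have "\<dots> \<le> 2 * (norm (f x))\<^sup>2 + 2 * (norm (g x))\<^sup>2"
        using sum_squares_bound[of "norm (f x)" "norm (g x)"] by (simp add: power2_sum)
      finally show ?thesis .
    qed
    then show "AE x in M. norm ((norm (f x + g x))\<^sup>2) \<le> norm (2 * (norm (f x))\<^sup>2 + 2 * (norm (g x))\<^sup>2)"
      by (auto intro!: AE_I2 order_trans[OF _ abs_ge_self])
  qed (use m in measurable)
qed

lemma sqint_minus: "sqint M f \<Longrightarrow> sqint M (\<lambda>x. - f x)"
  by (auto simp: sqint_def)

lemma sqint_diff:
  assumes "sqint M f" "sqint M g" shows "sqint M (\<lambda>x. f x - g x)"
  using sqint_add[OF assms(1) sqint_minus[OF assms(2)]] by simp

lemma sqint_zero [simp]: "sqint M (\<lambda>x. 0)"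
  by (simp add: sqint_def)

lemma sqint_mult_bounded:
  fixes f g :: "'a \<Rightarrow> 'b::{real_normed_algebra, second_countable_topology}"
  assumes "sqint M f" "g \<in> borel_measurable M" "\<And>x. norm (g x) \<le> C"
  shows "sqint M (\<lambda>x. f x * g x)"
  unfolding sqint_def
proof
  show m: "(\<lambda>x. f x * g x) \<in> borel_measurable M"
    using assms by (auto simp: sqint_def)
  show "integrable M (\<lambda>x. (norm (f x * g x))\<^sup>2)"
  proof (rule Bochner_Integration.integrable_bound)
    show "integrable M (\<lambda>x. C\<^sup>2 * (norm (f x))\<^sup>2)"
      using assms by (auto simp: sqint_def)
    have "norm (f x * g x) \<le> C * norm (f x)" for x
      using order_trans[OF norm_mult_ineq mult_left_mono[OF assms(3) norm_ge_zero]]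
      by (simp add: mult.commute)
    then have "(norm (f x * g x))\<^sup>2 \<le> C\<^sup>2 * (norm (f x))\<^sup>2" for x
      unfolding power_mult_distrib[symmetric] by (intro power_mono) auto
    then show "AE x in M. norm ((norm (f x * g x))\<^sup>2) \<le> norm (C\<^sup>2 * (norm (f x))\<^sup>2)"
      by (auto intro!: AE_I2)
  qed (use m in measurable)
qed

lemma (in finite_measure) sqint_bounded:
  assumes "f \<in> borel_measurable M" "\<And>x. norm (f x) \<le> C"
  shows "sqint M f"
  unfolding sqint_def
proof
  show "integrable M (\<lambda>x. (norm (f x))\<^sup>2)"
    by (rule integrable_const_bound[where B="C\<^sup>2"])
       (use assms in \<open>auto intro!: AE_I2 power_mono\<close>)
qed fact

lemma integrable_mult_sqint:
  fixes f g :: "'a \<Rightarrow> 'b::{real_normed_algebra, banach, second_countable_topology}"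
  assumes "sqint M f" "sqint M g"
  shows "integrable M (\<lambda>x. f x * g x)"
proof (rule Bochner_Integration.integrable_bound)
  show "integrable M (\<lambda>x. (norm (f x))\<^sup>2 + (norm (g x))\<^sup>2)"
    using assms by (auto simp: sqint_def)
  show "(\<lambda>x. f x * g x) \<in> borel_measurable M"
    using assms by (auto simp: sqint_def)
  have "norm (f x * g x) \<le> (norm (f x))\<^sup>2 + (norm (g x))\<^sup>2" for x
  proof -
    have "norm (f x * g x) \<le> norm (f x) * norm (g x)" by (rule norm_mult_ineq)
    also have "\<dots> \<le> (norm (f x))\<^sup>2 + (norm (g x))\<^sup>2"
      using sum_squares_bound[of "norm (f x)" "norm (g x)"]
        mult_nonneg_nonneg[OF norm_ge_zero[of "f x"] norm_ge_zero[of "g x"]]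
      by linarith
    finally show ?thesis .
  qed
  then show "AE x in M. norm (f x * g x) \<le> norm ((norm (f x))\<^sup>2 + (norm (g x))\<^sup>2)"
    by (auto intro!: AE_I2)
qed

lemma (in finite_measure) integrable_sqint:
  fixes f :: "'a \<Rightarrow> 'b::{banach, second_countable_topology}"
  assumes "sqint M f" shows "integrable M f"
proof (rule Bochner_Integration.integrable_bound)
  show "integrable M (\<lambda>x. norm (f x) * 1)"
    by (rule integrable_mult_sqint) (auto intro: sqint_norm assms sqint_bounded[where C=1])
qed (use assms in \<open>auto simp: sqint_def\<close>)

lemma Cauchy_Schwarz_integral:
  fixes f g :: "'a \<Rightarrow> real"
  assumes "sqint M f" "sqint M g"
  shows "(LINT x|M. f x * g x) \<le> l2 M f * l2 M g"
proof -
  define A B I where "A = (LINT x|M. (f x)\<^sup>2)" and "B = (LINT x|M. (g x)\<^sup>2)" and "I = (LINT x|M. f x * g x)"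
  have int: "integrable M (\<lambda>x. (f x)\<^sup>2)" "integrable M (\<lambda>x. (g x)\<^sup>2)" "integrable M (\<lambda>x. f x * g x)"
    using assms integrable_mult_sqint[OF assms] by (auto simp: sqint_def)
  \<comment> \<open>The discriminant argument: this quadratic in \<open>t\<close> is nonnegative,
    and \<open>t = I / A\<close> below minimises it.\<close>
  have q: "0 \<le> t\<^sup>2 * A - 2 * t * I + B" for t
  proof -
    have "0 \<le> (LINT x|M. (t * f x - g x)\<^sup>2)" by simp
    also have "(LINT x|M. (t * f x - g x)\<^sup>2) = (LINT x|M. t\<^sup>2 * (f x)\<^sup>2 - 2 * t * (f x * g x) + (g x)\<^sup>2)"
      by (intro Bochner_Integration.integral_cong) (auto simp: power2_diff power_mult_distrib mult_ac)
    also have "\<dots> = t\<^sup>2 * A - 2 * t * I + B"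
      using int by (simp add: A_def B_def I_def)
    finally show ?thesis .
  qed
  have nn: "A \<ge> 0" "B \<ge> 0" by (auto simp: A_def B_def)
  have "I\<^sup>2 \<le> A * B"
  proof (cases "A = 0")
    case True
    have "I = 0"
    proof (rule ccontr)
      assume "I \<noteq> 0"
      \<comment> \<open>For \<open>A = 0\<close> this value of \<open>t\<close> makes the quadratic
        equal to \<open>-1\<close>.\<close>
      then show False using q[of "(B + 1) / (2 * I)"] True by (simp add: field_simps)
    qed
    then show ?thesis using nn by simp
  next
    case False
    then have "A > 0" using nn by simp
    have "0 \<le> A * ((I / A)\<^sup>2 * A - 2 * (I / A) * I + B)"
      using q[of "I / A"] nn by (intro mult_nonneg_nonneg)
    also have "\<dots> = A * B - I\<^sup>2"
      using False by (simp add: field_simps power2_eq_square)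
    finally show ?thesis by simp
  qed
  then have "I \<le> sqrt (A * B)" by (rule real_le_rsqrt)
  then show ?thesis by (simp add: l2_def real_sqrt_mult A_def B_def I_def)
qed

lemma norm_integral_mult_le:
  fixes f g :: "'a \<Rightarrow> 'b::{real_normed_algebra, banach, second_countable_topology}"
  assumes "sqint M f" "sqint M g"
  shows "norm (LINT x|M. f x * g x) \<le> l2 M f * l2 M g"
proof -
  have "norm (LINT x|M. f x * g x) \<le> (LINT x|M. norm (f x * g x))"
    by (rule integral_norm_bound)
  also have "\<dots> \<le> (LINT x|M. norm (f x) * norm (g x))"
    by (intro integral_mono integrable_norm integrable_mult_sqint assms sqint_norm norm_mult_ineq)
  also have "\<dots> \<le> l2 M f * l2 M g"
    using Cauchy_Schwarz_integral[OF sqint_norm[OF assms(1)] sqint_norm[OF assms(2)]]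
    by (simp add: l2_norm)
  finally show ?thesis .
qed

lemma l2_mono:
  assumes "sqint M g" "AE x in M. norm (f x) \<le> norm (g x)"
  shows "l2 M f \<le> l2 M g"
proof -
  have "(LINT x|M. (norm (f x))\<^sup>2) \<le> (LINT x|M. (norm (g x))\<^sup>2)"
    by (rule integral_mono_AE') (use assms in \<open>auto simp: sqint_def elim!: eventually_mono\<close>)
  then show ?thesis by (simp add: l2_def)
qed

lemma l2_triangle:
  assumes "sqint M f" "sqint M g"
  shows "l2 M (\<lambda>x. f x + g x) \<le> l2 M f + l2 M g"
proof (rule power2_le_imp_le)
  let ?f = "\<lambda>x. norm (f x)" and ?g = "\<lambda>x. norm (g x)"
  have s: "sqint M ?f" "sqint M ?g" using assms by (auto intro: sqint_norm)
  have i: "integrable M (\<lambda>x. (?f x)\<^sup>2)" "integrable M (\<lambda>x. (?g x)\<^sup>2)" "integrable M (\<lambda>x. ?f x * ?g x)"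
    using s integrable_mult_sqint[OF s] by (auto simp: sqint_def)
  have "(l2 M (\<lambda>x. f x + g x))\<^sup>2 \<le> (LINT x|M. (?f x + ?g x)\<^sup>2)"
    unfolding l2_squared
    by (intro integral_mono sqint_integrable sqint_add assms power_mono norm_triangle_ineq)
       (use sqint_add[OF s] in \<open>auto simp: sqint_def\<close>)
  also have "\<dots> = (LINT x|M. (?f x)\<^sup>2 + (?g x)\<^sup>2 + 2 * (?f x * ?g x))"
    by (simp add: power2_sum mult_ac)
  also have "\<dots> = (l2 M f)\<^sup>2 + (l2 M g)\<^sup>2 + 2 * (LINT x|M. ?f x * ?g x)"
    using i by (simp add: l2_squared)
  also have "\<dots> \<le> (l2 M f)\<^sup>2 + (l2 M g)\<^sup>2 + 2 * (l2 M f * l2 M g)"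
    using Cauchy_Schwarz_integral[OF s] by (simp add: l2_norm)
  also have "\<dots> = (l2 M f + l2 M g)\<^sup>2" by (simp add: power2_sum)
  finally show "(l2 M (\<lambda>x. f x + g x))\<^sup>2 \<le> (l2 M f + l2 M g)\<^sup>2" .
qed simp

lemma l2_minus: "l2 M (\<lambda>x. - f x) = l2 M f"
  by (simp add: l2_def)

lemma l2_triangle_diff:
  assumes "sqint M f" "sqint M g"
  shows "l2 M (\<lambda>x. f x - g x) \<le> l2 M f + l2 M g"
  using l2_triangle[OF assms(1) sqint_minus[OF assms(2)]] by (simp add: l2_minus)

lemma l2_mult_bounded:
  fixes f g :: "'a \<Rightarrow> 'b::{real_normed_algebra, second_countable_topology}"
  assumes "sqint M f" "g \<in> borel_measurable M" "\<And>x. norm (g x) \<le> C" "0 \<le> C"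
  shows "l2 M (\<lambda>x. f x * g x) \<le> C * l2 M f"
proof -
  have "norm (f x * g x) \<le> C * norm (f x)" for x
    using order_trans[OF norm_mult_ineq mult_left_mono[OF assms(3) norm_ge_zero]]
    by (simp add: mult.commute)
  then have "(norm (f x * g x))\<^sup>2 \<le> C\<^sup>2 * (norm (f x))\<^sup>2" for x
    unfolding power_mult_distrib[symmetric] by (intro power_mono) auto
  then have "(LINT x|M. (norm (f x * g x))\<^sup>2) \<le> (LINT x|M. C\<^sup>2 * (norm (f x))\<^sup>2)"
    using sqint_mult_bounded[OF assms(1-3)] assms(1)
    by (intro integral_mono) (auto simp: sqint_def)
  also have "\<dots> = C\<^sup>2 * (LINT x|M. (norm (f x))\<^sup>2)" by simp
  finally have "l2 M (\<lambda>x. f x * g x) \<le> sqrt (C\<^sup>2 * (LINT x|M. (norm (f x))\<^sup>2))"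
    by (simp add: l2_def)
  then show ?thesis using assms(4) by (simp add: l2_def real_sqrt_mult)
qed

text \<open>The difference of the products is \<open>(F n - f) G n + f (G n - g)\<close>, and the
  norms of \<open>G n\<close> stay bounded because \<open>G n\<close> converges. The passages to the
  limit in the trilinear integrals rest on this.\<close>

lemma tendsto_integral_mult_l2:
  fixes f g :: "'a \<Rightarrow> 'b::{real_normed_algebra, banach, second_countable_topology}"
  assumes F: "\<And>n. sqint M (F n)" and f: "sqint M f" and Ff: "(\<lambda>n. l2 M (\<lambda>x. F n x - f x)) \<longlonglongrightarrow> 0"
    and G: "\<And>n. sqint M (G n)" and g: "sqint M g" and Gg: "(\<lambda>n. l2 M (\<lambda>x. G n x - g x)) \<longlonglongrightarrow> 0"
  shows "(\<lambda>n. LINT x|M. F n x * G n x) \<longlonglongrightarrow> (LINT x|M. f x * g x)"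
proof (rule LIM_zero_cancel)
  let ?d = "\<lambda>n. l2 M (\<lambda>x. F n x - f x)" and ?e = "\<lambda>n. l2 M (\<lambda>x. G n x - g x)"
  have "norm ((LINT x|M. F n x * G n x) - (LINT x|M. f x * g x)) \<le> ?d n * (?e n + l2 M g) + l2 M f * ?e n" for n
  proof -
    have "(LINT x|M. F n x * G n x) - (LINT x|M. f x * g x)
        = (LINT x|M. F n x * G n x - f x * g x)"
      by (intro Bochner_Integration.integral_diff[symmetric] integrable_mult_sqint assms)
    also have "\<dots> = (LINT x|M. (F n x - f x) * G n x + f x * (G n x - g x))"
      by (simp add: algebra_simps)
    also have "\<dots> = (LINT x|M. (F n x - f x) * G n x) + (LINT x|M. f x * (G n x - g x))"
      by (intro Bochner_Integration.integral_add integrable_mult_sqint sqint_diff assms)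
    also have "norm \<dots> \<le> ?d n * l2 M (G n) + l2 M f * ?e n"
      by (intro order_trans[OF norm_triangle_ineq] add_mono norm_integral_mult_le sqint_diff assms)
    also have "\<dots> \<le> ?d n * (?e n + l2 M g) + l2 M f * ?e n"
      using l2_triangle[OF sqint_diff[OF G g] g, of n] by (intro add_right_mono mult_left_mono) auto
    finally show ?thesis .
  qed
  then have le: "\<forall>n. norm ((LINT x|M. F n x * G n x) - (LINT x|M. f x * g x)) \<le> ?d n * (?e n + l2 M g) + l2 M f * ?e n"
    by blast
  have "(\<lambda>n. ?d n * (?e n + l2 M g) + l2 M f * ?e n) \<longlonglongrightarrow> 0 * (0 + l2 M g) + l2 M f * 0"
    by (intro tendsto_intros Ff Gg)
  then have lim: "(\<lambda>n. ?d n * (?e n + l2 M g) + l2 M f * ?e n) \<longlonglongrightarrow> 0"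
    by simp
  show "(\<lambda>n. (LINT x|M. F n x * G n x) - (LINT x|M. f x * g x)) \<longlonglongrightarrow> 0"
    by (rule Lim_null_comparison[OF always_eventually[OF le] lim])
qed

section \<open>Fourier coefficients and trigonometric polynomials\<close>

lemma measure_torus: "0 < L \<Longrightarrow> measure (torus L) (space (torus L)) = L ^ 3"
  by (simp add: measure_restrict_space content_cbox_if_cart interval_eq_empty_cart)

lemma finite_measure_torus: "finite_measure (torus L)"
  by (rule finite_measure_lebesgue_on) auto

lemma borel_measurable_torus: "f \<in> borel_measurable borel \<Longrightarrow> f \<in> borel_measurable (torus L)"
  by (intro measurable_restrict_space1 borel_measurable_if_D measurable_completion) simp

definition fc :: "real \<Rightarrow> (real^3 \<Rightarrow> complex) \<Rightarrow> int^3 \<Rightarrow> complex" where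
  "fc L f k = (LINT x|torus L. f x * expw L (- k) x) / complex_of_real (L ^ 3)"

definition tp :: "real \<Rightarrow> (int^3 \<Rightarrow> complex) \<Rightarrow> (int^3) set \<Rightarrow> real^3 \<Rightarrow> complex" where
  "tp L c S x = (\<Sum>k\<in>S. c k * expw L k x)"

lemma fourier_coeff_eq_fc: "fourier_coeff L g k $ j = fc L (\<lambda>x. complex_of_real (g x $ j)) k"
  by (simp add: fourier_coeff_def fc_def expw_def freq_minus)

lemma continuous_tp [continuous_intros]: "continuous_on A (tp L c S)"
  unfolding tp_def[abs_def] by (intro continuous_intros)

lemma tp_borel [measurable]: "tp L c S \<in> borel_measurable borel"
  by (intro borel_measurable_continuous_onI continuous_tp)

lemma norm_tp_le: "norm (tp L c S x) \<le> (\<Sum>k\<in>S. norm (c k))"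
  unfolding tp_def by (rule order_trans[OF norm_sum]) (simp add: norm_mult)

lemma sqint_tp: "sqint (torus L) (tp L c S)"
  by (rule finite_measure.sqint_bounded[OF finite_measure_torus borel_measurable_torus[OF tp_borel] norm_tp_le])

lemma sqint_expw: "sqint (torus L) (expw L k)"
  by (intro finite_measure.sqint_bounded[OF finite_measure_torus, where C=1] borel_measurable_torus expw_borel) simp

lemma integrable_mult_expw: "sqint (torus L) f \<Longrightarrow> integrable (torus L) (\<lambda>x. f x * expw L k x)"
  by (intro integrable_mult_sqint sqint_expw)

lemma fc_diff: "sqint (torus L) f \<Longrightarrow> sqint (torus L) g \<Longrightarrow> fc L (\<lambda>x. f x - g x) k = fc L f k - fc L g k"
  by (simp add: fc_def left_diff_distrib integrable_mult_expw diff_divide_distrib)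

lemma sqint_cnj:
  assumes "sqint M f" shows "sqint M (\<lambda>x. cnj (f x))"
proof -
  have "cnj \<in> borel_measurable borel"
    by (intro borel_measurable_continuous_onI continuous_intros)
  then show ?thesis
    using assms measurable_compose[of f M borel cnj borel] by (auto simp: sqint_def)
qed

lemma fc_cnj: "cnj (fc L f k) = fc L (\<lambda>x. cnj (f x)) (- k)"
proof -
  have "(LINT x|torus L. cnj (f x) * expw L (- (- k)) x) = (LINT x|torus L. cnj (f x * expw L (- k) x))"
    by (simp add: expw_minus)
  then show ?thesis by (simp only: fc_def Bochner_Integration.integral_cnj complex_cnj_divide complex_cnj_complex_of_real)
qed

lemma fc_of_real_minus: "fc L (\<lambda>x. complex_of_real (g x)) (- k) = cnj (fc L (\<lambda>x. complex_of_real (g x)) k)"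
  by (simp add: fc_cnj)

lemma fc_tp:
  assumes "0 < L" "finite S"
  shows "fc L (tp L c S) k = (if k \<in> S then c k else 0)"
proof -
  have "(LINT x|torus L. tp L c S x * expw L (- k) x) = (LINT x|torus L. (\<Sum>l\<in>S. c l * expw L (l - k) x))"
    by (simp add: tp_def sum_distrib_right mult.assoc flip: expw_add)
  also have "\<dots> = (\<Sum>l\<in>S. LINT x|torus L. c l * expw L (l - k) x)"
    by (intro Bochner_Integration.integral_sum integrable_mult_right
        finite_measure.integrable_sqint[OF finite_measure_torus] sqint_expw)
  also have "\<dots> = (\<Sum>l\<in>S. if l = k then c l * complex_of_real (L ^ 3) else 0)"
    using assms(1) by (intro sum.cong) (auto simp: expw_integral)
  also have "\<dots> = (if k \<in> S then c k * complex_of_real (L ^ 3) else 0)"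
    using assms(2) by simp
  finally show ?thesis using assms(1) by (simp add: fc_def)
qed

lemma l2_tp:
  assumes "0 < L" "finite S"
  shows "(l2 (torus L) (tp L c S))\<^sup>2 = L ^ 3 * (\<Sum>k\<in>S. (norm (c k))\<^sup>2)"
proof -
  have "complex_of_real ((l2 (torus L) (tp L c S))\<^sup>2) = (LINT x|torus L. tp L c S x * cnj (tp L c S x))"
    by (simp only: l2_squared complex_norm_square integral_complex_of_real[symmetric])
  also have "\<dots> = (LINT x|torus L. (\<Sum>k\<in>S. cnj (c k) * (tp L c S x * expw L (- k) x)))"
    by (subst (2) tp_def) (simp add: cnj_sum sum_distrib_left expw_minus mult_ac)
  also have "\<dots> = (\<Sum>k\<in>S. cnj (c k) * (complex_of_real (L ^ 3) * fc L (tp L c S) k))"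
    using assms(1)
    by (subst Bochner_Integration.integral_sum) (auto intro!: integrable_mult_expw sqint_tp simp: fc_def)
  also have "\<dots> = (\<Sum>k\<in>S. complex_of_real (L ^ 3 * (norm (c k))\<^sup>2))"
    unfolding of_real_mult complex_norm_square
    using assms by (intro sum.cong) (auto simp: fc_tp mult_ac)
  finally show ?thesis
    unfolding of_real_sum[symmetric] of_real_eq_iff by (simp add: sum_distrib_left)
qed

lemma integral_mult_cnj_tp:
  assumes "0 < L" "sqint (torus L) f"
  shows "(LINT x|torus L. f x * cnj (tp L c S x)) = complex_of_real (L ^ 3) * (\<Sum>k\<in>S. cnj (c k) * fc L f k)"
proof -
  have "(LINT x|torus L. f x * cnj (tp L c S x)) = (LINT x|torus L. (\<Sum>k\<in>S. cnj (c k) * (f x * expw L (- k) x)))"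
    by (simp add: tp_def cnj_sum sum_distrib_left expw_minus mult_ac)
  also have "\<dots> = (\<Sum>k\<in>S. cnj (c k) * (complex_of_real (L ^ 3) * fc L f k))"
    using assms
    by (subst Bochner_Integration.integral_sum) (auto intro!: integrable_mult_expw simp: fc_def)
  finally show ?thesis by (simp add: sum_distrib_left mult_ac)
qed

text \<open>In \<open>L^2\<close> the partial sum \<open>P\<close> satisfies
  \<open><f, P> = <P, P>\<close>, so Cauchy-Schwarz bounds its norm by that of \<open>f\<close>
  directly.\<close>

lemma bessel:
  assumes L: "0 < L" and S: "finite S" and f: "sqint (torus L) f"
  shows "L ^ 3 * (\<Sum>k\<in>S. (norm (fc L f k))\<^sup>2) \<le> (l2 (torus L) f)\<^sup>2"
proof -
  define P where "P = tp L (fc L f) S"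
  let ?X = "l2 (torus L) P"
  have "complex_of_real (?X\<^sup>2) = (LINT x|torus L. f x * cnj (P x))"
    unfolding P_def l2_tp[OF L S] integral_mult_cnj_tp[OF L f] by (simp only: of_real_mult of_real_sum complex_norm_square mult.commute)
  then have "?X\<^sup>2 = norm (LINT x|torus L. f x * cnj (P x))"
    by (metis norm_of_real abs_of_nonneg zero_le_power2)
  also have "\<dots> \<le> l2 (torus L) f * l2 (torus L) (\<lambda>x. cnj (P x))"
    by (intro norm_integral_mult_le f) (auto intro!: sqint_cnj sqint_tp simp: P_def)
  also have "l2 (torus L) (\<lambda>x. cnj (P x)) = ?X"
    by (simp add: l2_def)
  finally have "?X * ?X \<le> l2 (torus L) f * ?X" by (simp add: power2_eq_square)
  then have "?X \<le> l2 (torus L) f"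
    by (cases "?X = 0") (auto simp: mult_le_cancel_right less_le)
  then have "?X\<^sup>2 \<le> (l2 (torus L) f)\<^sup>2" by (intro power_mono) auto
  then show ?thesis by (simp add: P_def l2_tp L S)
qed

text \<open>A Fourier multiplier restricted to finitely many frequencies. The symbol
  \<open>1\<close> gives partial sums, symbols built from \<open>chi\<close> give Littlewood-Paley
  pieces and low-pass sums, and \<open>fmult_tendsto\<close> serves all of these
  approximations.\<close>

definition fmult :: "real \<Rightarrow> (int^3 \<Rightarrow> real) \<Rightarrow> (int^3) set \<Rightarrow> (real^3 \<Rightarrow> complex) \<Rightarrow> real^3 \<Rightarrow> complex" where
  "fmult L m S f = tp L (\<lambda>k. complex_of_real (m k) * fc L f k) S"

lemma sqint_fmult: "sqint (torus L) (fmult L m S f)"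
  by (simp add: fmult_def sqint_tp)

lemma fc_fmult:
  "0 < L \<Longrightarrow> finite S \<Longrightarrow> fc L (fmult L m S f) k = (if k \<in> S then m k * fc L f k else 0)"
  by (simp add: fmult_def fc_tp)

lemma l2_fmult_le:
  assumes L: "0 < L" and S: "finite S" and f: "sqint (torus L) f" and B: "\<And>k. \<bar>m k\<bar> \<le> B"
  shows "l2 (torus L) (fmult L m S f) \<le> B * l2 (torus L) f"
proof (rule power2_le_imp_le)
  have B0: "0 \<le> B" using B[of 0] by linarith
  have "(l2 (torus L) (fmult L m S f))\<^sup>2 = L ^ 3 * (\<Sum>k\<in>S. (m k)\<^sup>2 * (norm (fc L f k))\<^sup>2)"
    by (simp add: fmult_def l2_tp L S norm_mult power_mult_distrib)
  also have "\<dots> \<le> L ^ 3 * (\<Sum>k\<in>S. B\<^sup>2 * (norm (fc L f k))\<^sup>2)"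
    using L B by (intro mult_left_mono sum_mono mult_right_mono) (auto intro: power2_le_iff_abs_le[THEN iffD2, OF B0])
  also have "\<dots> = B\<^sup>2 * (L ^ 3 * (\<Sum>k\<in>S. (norm (fc L f k))\<^sup>2))"
    by (simp add: sum_distrib_left mult_ac)
  also have "\<dots> \<le> B\<^sup>2 * (l2 (torus L) f)\<^sup>2"
    by (intro mult_left_mono bessel L S f) auto
  finally show "(l2 (torus L) (fmult L m S f))\<^sup>2 \<le> (B * l2 (torus L) f)\<^sup>2"
    by (simp add: power_mult_distrib)
  show "0 \<le> B * l2 (torus L) f" using B0 by simp
qed

lemma fmult_diff:
  assumes "sqint (torus L) f" "sqint (torus L) g"
  shows "fmult L m S (\<lambda>x. f x - g x) x = fmult L m S f x - fmult L m S g x"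
  using assms by (simp add: fmult_def tp_def fc_diff ring_distribs sum_subtractf)

text \<open>Cubes in place of balls: the number of points is explicit and sums of frequencies stay
  in a cube of known size, which is what the proof of \<open>nikolskii\<close> counts.\<close>

definition fbox :: "nat \<Rightarrow> (int^3) set" where
  "fbox n = {k. \<forall>i. \<bar>k $ i\<bar> \<le> int n}"

lemma fbox_bij: "bij_betw (\<lambda>f. \<chi> i. f i) (UNIV \<rightarrow>\<^sub>E {- int n..int n}) (fbox n)"
  by (rule bij_betwI[where g="\<lambda>k i. k $ i"]) (auto simp: fbox_def PiE_iff abs_le_iff minus_le_iff)

lemma finite_fbox [simp]: "finite (fbox n)"
  using bij_betw_finite[OF fbox_bij, of n] by (simp add: finite_PiE)

lemma card_fbox: "card (fbox n) = (2 * n + 1) ^ 3"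
proof -
  have "card (fbox n) = card (UNIV \<rightarrow>\<^sub>E {- int n..int n} :: (3 \<Rightarrow> int) set)"
    using bij_betw_same_card[OF fbox_bij] by simp
  also have "\<dots> = (nat (2 * int n + 1)) ^ 3" by (simp add: card_PiE)
  also have "nat (2 * int n + 1) = 2 * n + 1" by simp
  finally show ?thesis .
qed

lemma fbox_mono: "m \<le> n \<Longrightarrow> fbox m \<subseteq> fbox n"
  unfolding fbox_def by (auto intro: order_trans[of _ "int m"])

lemma zero_in_fbox [simp]: "0 \<in> fbox n"
  by (simp add: fbox_def)

lemma minus_in_fbox [simp]: "- k \<in> fbox n \<longleftrightarrow> k \<in> fbox n"
  by (simp add: fbox_def)

lemma fbox_add: "k \<in> fbox m \<Longrightarrow> l \<in> fbox n \<Longrightarrow> k + l \<in> fbox (m + n)"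
  by (auto simp: fbox_def intro: order_trans[OF abs_triangle_ineq add_mono])

lemma in_some_fbox: "\<exists>n. k \<in> fbox n"
proof -
  have "\<bar>k $ i\<bar> \<le> int (nat (Max (range (\<lambda>i. \<bar>k $ i\<bar>))))" for i
  proof -
    have "\<bar>k $ i\<bar> \<le> Max (range (\<lambda>i. \<bar>k $ i\<bar>))" by (rule Max_ge) auto
    then show ?thesis by linarith
  qed
  then show ?thesis unfolding fbox_def mem_Collect_eq by (intro exI allI)
qed

lemma finite_subset_fbox:
  assumes "finite S" shows "\<exists>n. S \<subseteq> fbox n"
  using assms
proof (induction S rule: finite_induct)
  case (insert k S)
  then obtain m where "S \<subseteq> fbox m" by blast
  moreover obtain n where "k \<in> fbox n" using in_some_fbox by blast
  ultimately have "insert k S \<subseteq> fbox (max m n)"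
    using fbox_mono[of m "max m n"] fbox_mono[of n "max m n"] by auto
  then show ?case ..
qed simp

lemma norm_freq_in_fbox: "norm (freq k) \<le> real n \<Longrightarrow> k \<in> fbox n"
proof -
  assume a: "norm (freq k) \<le> real n"
  have "\<bar>k $ i\<bar> \<le> int n" for i
    using order_trans[OF component_le_norm_cart[of "freq k" i] a] by simp
  then show ?thesis by (simp add: fbox_def)
qed

section \<open>Density of trigonometric polynomials\<close>

definition istp :: "real \<Rightarrow> (real^3 \<Rightarrow> complex) \<Rightarrow> bool" where
  "istp L f \<longleftrightarrow> (\<exists>n c. f = tp L c (fbox n))"

lemma tp_mono_neutral:
  assumes "finite T" "S \<subseteq> T" "\<And>k. k \<in> T - S \<Longrightarrow> c k = 0"
  shows "tp L c S = tp L c T"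
  by (rule ext, unfold tp_def, intro sum.mono_neutral_left) (use assms in auto)

lemma tp_extend:
  assumes "finite T" "S \<subseteq> T"
  shows "tp L c S = tp L (\<lambda>k. if k \<in> S then c k else 0) T"
proof -
  have "tp L c S = tp L (\<lambda>k. if k \<in> S then c k else 0) S"
    by (simp add: tp_def[abs_def])
  also have "\<dots> = tp L (\<lambda>k. if k \<in> S then c k else 0) T"
    by (intro tp_mono_neutral assms) auto
  finally show ?thesis .
qed

lemma istp_finite:
  assumes "finite S" shows "istp L (tp L c S)"
proof -
  obtain n where "S \<subseteq> fbox n" using finite_subset_fbox[OF assms] by blast
  from tp_extend[OF finite_fbox this] show ?thesis unfolding istp_def by blast
qed

lemma istp_expw: "istp L (\<lambda>x. a * expw L k x)"
  using istp_finite[of "{k}" L "\<lambda>_. a"] by (simp add: tp_def[abs_def])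

lemma istp_const: "istp L (\<lambda>x. a)"
  using istp_expw[of L a 0] by simp

lemma istp_add:
  assumes "istp L f" "istp L g" shows "istp L (\<lambda>x. f x + g x)"
proof -
  obtain m c n d where fg: "f = tp L c (fbox m)" "g = tp L d (fbox n)"
    using assms by (auto simp: istp_def)
  define c' d' where "c' k = (if k \<in> fbox m then c k else 0)" and "d' k = (if k \<in> fbox n then d k else 0)" for k
  have "f = tp L c' (fbox (max m n))" "g = tp L d' (fbox (max m n))"
    unfolding fg c'_def d'_def by (intro tp_extend finite_fbox fbox_mono; simp)+
  then have "(\<lambda>x. f x + g x) = tp L (\<lambda>k. c' k + d' k) (fbox (max m n))"
    by (simp add: tp_def[abs_def] distrib_right sum.distrib)
  then show ?thesis by (auto simp: istp_def)
qed

lemma istp_sum: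
  "(\<And>i. i \<in> I \<Longrightarrow> istp L (f i)) \<Longrightarrow> istp L (\<lambda>x. \<Sum>i\<in>I. f i x)"
  by (induction I rule: infinite_finite_induct) (auto intro: istp_add istp_const)

lemma istp_mult:
  assumes "istp L f" "istp L g" shows "istp L (\<lambda>x. f x * g x)"
proof -
  obtain m c n d where fg: "f = tp L c (fbox m)" "g = tp L d (fbox n)"
    using assms by (auto simp: istp_def)
  have "(\<lambda>x. f x * g x) = (\<lambda>x. \<Sum>k\<in>fbox m. \<Sum>l\<in>fbox n. c k * d l * expw L (k + l) x)"
    unfolding fg tp_def by (simp add: sum_product expw_add mult_ac)
  moreover have "istp L \<dots>"
    by (intro istp_sum istp_expw)
  ultimately show ?thesis by simp
qed

lemma istp_sqint: "istp L f \<Longrightarrow> sqint (torus L) f"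
  by (auto simp: istp_def sqint_tp)

text \<open>Embeds the torus into \<open>complex^3\<close> as a product of circles, so that
  Stone-Weierstrass for polynomials in the coordinates applies to functions on it.\<close>

definition circ :: "real \<Rightarrow> real^3 \<Rightarrow> complex^3" where
  "circ L x = (\<chi> i. cis ((2 * pi / L) * x $ i))"

lemma circ_nth: "circ L x $ i = expw L (axis i 1) x"
proof -
  have "freq (axis i 1) = axis i 1" by (simp add: freq_def vec_eq_iff axis_def)
  then show ?thesis by (simp add: circ_def expw_def inner_axis' del: times_divide_eq_left)
qed

lemma istp_polynomial_circ:
  assumes "real_polynomial_function p"
  shows "istp L (\<lambda>x. complex_of_real (p (circ L x)))"
  using assms
proof (induction p rule: real_polynomial_function.induct)
  case (linear f)
  then interpret bounded_linear f .
  have dec: "y = (\<Sum>i\<in>UNIV. Re (y $ i) *\<^sub>R axis i 1 + Im (y $ i) *\<^sub>R axis i \<i>)" for y :: "complex^3"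
    by (auto simp: vec_eq_iff axis_def if_distrib[of "\<lambda>z. _ *\<^sub>R z"] sum.distrib complex_eq_iff cong: if_cong)
  have fy: "f y = (\<Sum>i\<in>UNIV. Re (y $ i) * f (axis i 1) + Im (y $ i) * f (axis i \<i>))" for y
  proof -
    have "f y = f (\<Sum>i\<in>UNIV. Re (y $ i) *\<^sub>R axis i 1 + Im (y $ i) *\<^sub>R axis i \<i>)"
      using dec[of y] by (rule arg_cong)
    then show ?thesis by (simp only: sum add scaleR real_scaleR_def)
  qed
  \<comment> \<open>A real linear functional of \<open>z\<close> is a combination of
    \<open>z\<close> and \<open>cnj z\<close>, hence of two opposite modes.\<close>
  have split: "complex_of_real (Re z * a + Im z * b)
      = (a / 2 - b / 2 * \<i>) * z + (a / 2 + b / 2 * \<i>) * cnj z" for z a b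
    by (auto simp: complex_eq_iff field_simps)
  have "complex_of_real (f (circ L x)) =
      (\<Sum>i\<in>UNIV. (complex_of_real (f (axis i 1)) / 2 - complex_of_real (f (axis i \<i>)) / 2 * \<i>) * expw L (axis i 1) x
            + (complex_of_real (f (axis i 1)) / 2 + complex_of_real (f (axis i \<i>)) / 2 * \<i>) * expw L (- axis i 1) x)" for x
    unfolding fy[of "circ L x"] of_real_sum split circ_nth expw_minus ..
  then show ?case by (simp only:) (intro istp_sum istp_add istp_expw)
qed (auto intro: istp_const istp_add istp_mult)

section \<open>The closure of the trigonometric polynomials in the square norm\<close>

definition tapx :: "real \<Rightarrow> (real^3 \<Rightarrow> complex) \<Rightarrow> bool" where
  "tapx L f \<longleftrightarrow> sqint (torus L) f \<and> (\<forall>\<epsilon>>0. \<exists>p. istp L p \<and> l2 (torus L) (\<lambda>x. f x - p x) < \<epsilon>)"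

lemma tapxD: "tapx L f \<Longrightarrow> 0 < \<epsilon> \<Longrightarrow> \<exists>p. istp L p \<and> l2 (torus L) (\<lambda>x. f x - p x) < \<epsilon>"
  by (simp add: tapx_def)

lemma tapx_sqint: "tapx L f \<Longrightarrow> sqint (torus L) f"
  by (simp add: tapx_def)

lemma tapx_limit:
  assumes f: "sqint (torus L) f"
    and ex: "\<And>\<epsilon>. 0 < \<epsilon> \<Longrightarrow> \<exists>g. tapx L g \<and> l2 (torus L) (\<lambda>x. f x - g x) < \<epsilon>"
  shows "tapx L f"
  unfolding tapx_def
proof (intro conjI f allI impI)
  fix \<epsilon> :: real assume "0 < \<epsilon>"
  then obtain g where g: "tapx L g" "l2 (torus L) (\<lambda>x. f x - g x) < \<epsilon> / 2"
    using ex[of "\<epsilon> / 2"] by auto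
  obtain p where p: "istp L p" "l2 (torus L) (\<lambda>x. g x - p x) < \<epsilon> / 2"
    using tapxD[OF g(1), of "\<epsilon> / 2"] \<open>0 < \<epsilon>\<close> by auto
  have "l2 (torus L) (\<lambda>x. (f x - g x) + (g x - p x)) \<le> l2 (torus L) (\<lambda>x. f x - g x) + l2 (torus L) (\<lambda>x. g x - p x)"
    by (intro l2_triangle sqint_diff f tapx_sqint g(1) istp_sqint p(1))
  then show "\<exists>p. istp L p \<and> l2 (torus L) (\<lambda>x. f x - p x) < \<epsilon>"
    using g p by (intro exI[of _ p]) auto
qed

lemma tapx_sequence:
  assumes "\<And>n. tapx L (F n)" "sqint (torus L) f" "(\<lambda>n. l2 (torus L) (\<lambda>x. f x - F n x)) \<longlonglongrightarrow> 0"
  shows "tapx L f"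
proof (rule tapx_limit[OF assms(2)])
  fix \<epsilon> :: real assume "0 < \<epsilon>"
  then obtain n where "l2 (torus L) (\<lambda>x. f x - F n x) < \<epsilon>"
    using eventually_happens[OF order_tendstoD(2)[OF assms(3)]] by auto
  then show "\<exists>g. tapx L g \<and> l2 (torus L) (\<lambda>x. f x - g x) < \<epsilon>" using assms(1) by blast
qed

lemma tapx_istp: "istp L p \<Longrightarrow> tapx L p"
  unfolding tapx_def by (auto intro!: istp_sqint exI[of _ p] simp: l2_def)

lemma tapx_add:
  assumes "tapx L f" "tapx L g" shows "tapx L (\<lambda>x. f x + g x)"
  unfolding tapx_def
proof (intro conjI allI impI sqint_add tapx_sqint assms)
  fix \<epsilon> :: real assume "0 < \<epsilon>"
  then obtain p q where p: "istp L p" "l2 (torus L) (\<lambda>x. f x - p x) < \<epsilon> / 2"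
    and q: "istp L q" "l2 (torus L) (\<lambda>x. g x - q x) < \<epsilon> / 2"
    using tapxD[OF assms(1), of "\<epsilon> / 2"] tapxD[OF assms(2), of "\<epsilon> / 2"] by auto
  have "l2 (torus L) (\<lambda>x. (f x - p x) + (g x - q x)) \<le> l2 (torus L) (\<lambda>x. f x - p x) + l2 (torus L) (\<lambda>x. g x - q x)"
    by (intro l2_triangle sqint_diff tapx_sqint assms istp_sqint p(1) q(1))
  then show "\<exists>p. istp L p \<and> l2 (torus L) (\<lambda>x. f x + g x - p x) < \<epsilon>"
    using p q by (intro exI[of _ "\<lambda>x. p x + q x"]) (auto intro: istp_add simp: algebra_simps)
qed

lemma tapx_sum:
  "(\<And>i. i \<in> I \<Longrightarrow> tapx L (f i)) \<Longrightarrow> tapx L (\<lambda>x. \<Sum>i\<in>I. f i x)"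
  by (induction I rule: infinite_finite_induct) (auto intro: tapx_add tapx_istp istp_const)

lemma tapx_cmult:
  assumes "tapx L f" shows "tapx L (\<lambda>x. f x * a)"
  unfolding tapx_def
proof (intro conjI allI impI)
  show "sqint (torus L) (\<lambda>x. f x * a)"
    by (rule sqint_mult_bounded[OF tapx_sqint[OF assms]]) auto
  fix \<epsilon> :: real assume "0 < \<epsilon>"
  then obtain p where p: "istp L p" "l2 (torus L) (\<lambda>x. f x - p x) < \<epsilon> / (norm a + 1)"
    using tapxD[OF assms, of "\<epsilon> / (norm a + 1)"] by (auto simp: add_nonneg_pos)
  have "l2 (torus L) (\<lambda>x. (f x - p x) * a) \<le> norm a * l2 (torus L) (\<lambda>x. f x - p x)"
    by (intro l2_mult_bounded sqint_diff tapx_sqint assms istp_sqint p) auto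
  also have "\<dots> \<le> (norm a + 1) * l2 (torus L) (\<lambda>x. f x - p x)"
    by (intro mult_right_mono) auto
  also have "\<dots> < \<epsilon>"
    using p(2) by (simp add: pos_less_divide_eq add_nonneg_pos mult.commute)
  finally show "\<exists>p. istp L p \<and> l2 (torus L) (\<lambda>x. f x * a - p x) < \<epsilon>"
    using p by (intro exI[of _ "\<lambda>x. p x * a"]) (auto intro: istp_mult istp_const simp: left_diff_distrib)
qed

lemma sqint_bound:
  assumes g: "sqint M g" and f: "f \<in> borel_measurable M"
    and le: "\<And>x. x \<in> space M \<Longrightarrow> norm (f x) \<le> norm (g x)"
  shows "sqint M f"
  unfolding sqint_def
proof (intro conjI f Bochner_Integration.integrable_bound[OF sqint_integrable[OF g]])
  show "(\<lambda>x. (norm (f x))\<^sup>2) \<in> borel_measurable M" using f by measurable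
  show "AE x in M. norm ((norm (f x))\<^sup>2) \<le> norm ((norm (g x))\<^sup>2)"
    using le by (intro AE_I2) (simp add: power_mono)
qed

text \<open>Stone-Weierstrass on a ball containing the image of \<open>circ\<close>: a uniform error
  \<open>\<delta>\<close> costs at most \<open>\<delta> * sqrt (L ^ 3)\<close> in
  \<open>L^2\<close>, and polynomials in \<open>circ\<close> are trigonometric.\<close>

lemma tapx_continuous_circ:
  fixes g :: "complex^3 \<Rightarrow> real"
  assumes g: "continuous_on UNIV g" and L: "0 < L"
  shows "tapx L (\<lambda>x. complex_of_real (g (circ L x)))"
proof (rule tapx_limit)
  have cont: "continuous_on UNIV (circ L)"
    unfolding circ_def[abs_def] by (intro continuous_intros)
  have cont2: "continuous_on UNIV (\<lambda>x. complex_of_real (h (circ L x)))" if "continuous_on UNIV h" for h :: "complex^3 \<Rightarrow> real"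
    by (intro continuous_intros continuous_on_compose2[OF that cont]) auto
  \<comment> \<open>Each of the three coordinates of \<open>circ L x\<close> has modulus 1, so the
    radius 3 suffices.\<close>
  define S where "S = cball (0 :: complex^3) 3"
  have S: "circ L x \<in> S" for x
  proof -
    have "norm (circ L x) \<le> (\<Sum>i\<in>UNIV. norm (circ L x $ i))" unfolding norm_vec_def by (rule L2_set_le_sum) simp
    then show ?thesis by (simp add: S_def circ_nth sum_constant)
  qed
  have bdd: "\<exists>B. \<forall>x. norm (complex_of_real (h (circ L x))) \<le> B" if "continuous_on UNIV h" for h :: "complex^3 \<Rightarrow> real"
  proof -
    have "compact (h ` S)"
      by (intro compact_continuous_image continuous_on_subset[OF that]) (auto simp: S_def)
    then obtain B where "\<forall>y\<in>h ` S. norm y \<le> B"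
      using compact_imp_bounded bounded_iff by blast
    then show ?thesis using S by auto
  qed
  have sq: "sqint (torus L) (\<lambda>x. complex_of_real (h (circ L x)))" if h: "continuous_on UNIV h" for h :: "complex^3 \<Rightarrow> real"
  proof -
    obtain B where "\<And>x. norm (complex_of_real (h (circ L x))) \<le> B"
      using bdd[OF h] by blast
    then show ?thesis
      by (intro finite_measure.sqint_bounded[OF finite_measure_torus] borel_measurable_torus
          borel_measurable_continuous_onI cont2 h)
  qed
  show "sqint (torus L) (\<lambda>x. complex_of_real (g (circ L x)))" by (rule sq[OF g])
  fix \<epsilon> :: real assume "0 < \<epsilon>"
  define \<delta> where "\<delta> = \<epsilon> / (2 * sqrt (L ^ 3))"
  have \<delta>: "0 < \<delta>" using \<open>0 < \<epsilon>\<close> L by (simp add: \<delta>_def)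
  obtain p where p: "real_polynomial_function p" "\<And>y. y \<in> S \<Longrightarrow> \<bar>g y - p y\<bar> < \<delta>"
    using Stone_Weierstrass_real_polynomial_function[of S g \<delta>] continuous_on_subset[OF g, of S] \<delta>
    by (auto simp: S_def)
  have pc: "continuous_on UNIV p"
    using p(1) by (simp add: continuous_on_polymonial_function real_polynomial_function_eq)
  let ?d = "\<lambda>x. complex_of_real (g (circ L x)) - complex_of_real (p (circ L x))"
  have "(LINT x|torus L. (norm (?d x))\<^sup>2) \<le> (LINT x|torus L. \<delta>\<^sup>2)"
  proof (rule integral_mono)
    show "integrable (torus L) (\<lambda>x. (norm (?d x))\<^sup>2)"
      using sqint_diff[OF sq[OF g] sq[OF pc]] by (simp add: sqint_def)
    show "integrable (torus L) (\<lambda>x. \<delta>\<^sup>2)"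
      using finite_measure.integrable_const[OF finite_measure_torus] .
    fix x
    have "norm (?d x) = \<bar>g (circ L x) - p (circ L x)\<bar>"
      by (simp flip: of_real_diff del: of_real_diff)
    then show "(norm (?d x))\<^sup>2 \<le> \<delta>\<^sup>2"
      using p(2)[OF S[of x]] \<delta> by (intro power_mono) auto
  qed
  also have "\<dots> = \<delta>\<^sup>2 * L ^ 3"
    using measure_torus[OF L] by simp
  finally have "l2 (torus L) ?d \<le> sqrt (\<delta>\<^sup>2 * L ^ 3)"
    by (simp add: l2_def)
  also have "\<dots> = \<epsilon> / 2"
    using \<open>0 < \<epsilon>\<close> L by (simp add: real_sqrt_mult \<delta>_def)
  finally have "l2 (torus L) ?d < \<epsilon>" using \<open>0 < \<epsilon>\<close> by simp
  then show "\<exists>h. tapx L h \<and> l2 (torus L) (\<lambda>x. complex_of_real (g (circ L x)) - h x) < \<epsilon>"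
    using tapx_istp[OF istp_polynomial_circ[OF p(1)]] by blast
qed

text \<open>Opposite faces of the closed box have the same image, so one of the points has to be
  interior. The coordinates agree up to a multiple of \<open>L\<close>, and with \<open>y\<close> in
  the open box their difference is smaller than \<open>L\<close> in modulus.\<close>

lemma circ_inject:
  assumes L: "0 < L" and x: "x \<in> cbox 0 (vec L)" and y: "y \<in> box 0 (vec L)" and eq: "circ L x = circ L y"
  shows "x = y"
proof -
  have "x $ i = y $ i" for i
  proof -
    have "cis ((2 * pi / L) * x $ i) = cis ((2 * pi / L) * y $ i)"
      using eq by (simp add: circ_def vec_eq_iff)
    then have "exp (\<i> * of_real ((2 * pi / L) * x $ i)) = exp (\<i> * of_real ((2 * pi / L) * y $ i))"
      by (simp add: cis_conv_exp)
    then obtain n :: int where n: "\<i> * of_real ((2 * pi / L) * x $ i) = \<i> * of_real ((2 * pi / L) * y $ i) + of_int (2 * n) * of_real pi * \<i>"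
      unfolding exp_eq by auto
    then have "Im (\<i> * of_real ((2 * pi / L) * x $ i)) = Im (\<i> * of_real ((2 * pi / L) * y $ i) + of_int (2 * n) * of_real pi * \<i>)"
      by (rule arg_cong)
    then have "(2 * pi / L) * x $ i = (2 * pi / L) * y $ i + of_int (2 * n) * pi"
      by simp
    then have "pi * (2 * x $ i) = pi * (2 * (y $ i + of_int n * L))"
      using L by (simp add: field_simps)
    then have *: "x $ i - y $ i = of_int n * L" by simp
    have "0 \<le> x $ i" "x $ i \<le> L" "0 < y $ i" "y $ i < L"
      using x y by (auto simp: mem_box_cart)
    then have "\<bar>of_int n * L\<bar> < L" using * by (simp flip: *)
    then have "\<bar>of_int n :: real\<bar> < 1" using L by (simp add: abs_mult)
    then have "n = 0" by linarith
    then show ?thesis using * by simp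
  qed
  then show ?thesis by (simp add: vec_eq_iff)
qed

lemma tendsto_l2_dominated:
  fixes f :: "'a \<Rightarrow> 'b::{real_normed_vector, second_countable_topology}"
  assumes f: "f \<in> borel_measurable M" and F: "\<And>n. F n \<in> borel_measurable M" and g: "sqint M g"
    and lim: "\<And>x. x \<in> space M \<Longrightarrow> (\<lambda>n. F n x) \<longlonglongrightarrow> f x"
    and dom: "\<And>n x. x \<in> space M \<Longrightarrow> norm (f x - F n x) \<le> norm (g x)"
  shows "(\<lambda>n. l2 M (\<lambda>x. f x - F n x)) \<longlonglongrightarrow> 0"
proof -
  have "(\<lambda>n. LINT x|M. (norm (f x - F n x))\<^sup>2) \<longlonglongrightarrow> (LINT x|M. 0)"
  proof (rule integral_dominated_convergence[where w="\<lambda>x. (norm (g x))\<^sup>2"])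
    show "integrable M (\<lambda>x. (norm (g x))\<^sup>2)" using g by (simp add: sqint_def)
    show "AE x in M. (\<lambda>n. (norm (f x - F n x))\<^sup>2) \<longlonglongrightarrow> 0"
    proof (rule AE_I2)
      fix x assume "x \<in> space M"
      from tendsto_power[OF tendsto_norm[OF tendsto_diff[OF tendsto_const[of "f x"] lim[OF this]]], of 2]
      show "(\<lambda>n. (norm (f x - F n x))\<^sup>2) \<longlonglongrightarrow> 0" by simp
    qed
    show "AE x in M. norm ((norm (f x - F n x))\<^sup>2) \<le> (norm (g x))\<^sup>2" for n
      using dom by (auto intro!: AE_I2 power_mono)
  qed (use f F in auto)
  from tendsto_real_sqrt[OF this] show ?thesis by (simp add: l2_def)
qed

text \<open>
  By \<open>circ_inject\<close>, functions of \<open>circ L x\<close> separate a compact subset of the open box from its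
  complement in the closed box.
\<close>

lemma tapx_indicator_compact:
  assumes L: "0 < L" and K: "compact K" "K \<subseteq> box 0 (vec L)"
  shows "tapx L (\<lambda>x. complex_of_real (indicator K x))"
\<comment> \<open>\<open>infdist\<close> to the empty set is \<open>0\<close>, so the functions
  \<open>g n\<close> below would not converge to the indicator.\<close>
proof (cases "K = {}")
  case True
  then show ?thesis using tapx_istp[OF istp_const[of L 0]] by simp
next
  case False
  have cont: "continuous_on S (circ L)" for S
    unfolding circ_def[abs_def] by (intro continuous_intros)
  have cK: "compact (circ L ` K)" by (intro compact_continuous_image cont K)
  \<comment> \<open>Continuous tents that equal 1 on the image of \<open>K\<close> and vanish from
    distance \<open>1 / n\<close> on.\<close>
  define g where "g n y = max 0 (1 - real n * infdist y (circ L ` K))" for n y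
  have gc: "continuous_on S (g n)" for n S
    unfolding g_def by (intro continuous_intros)
  have g01: "0 \<le> g n y" "g n y \<le> 1" for n y
    by (auto simp: g_def infdist_nonneg)
  show ?thesis
  proof (rule tapx_sequence[where F="\<lambda>n x. complex_of_real (g n (circ L x))"])
    show t: "tapx L (\<lambda>x. complex_of_real (g n (circ L x)))" for n
      by (intro tapx_continuous_circ gc L)
    have mK: "(\<lambda>x. complex_of_real (indicator K x)) \<in> borel_measurable (torus L)"
      using K(1) by (intro borel_measurable_torus) (auto dest: compact_imp_closed)
    then show "sqint (torus L) (\<lambda>x. complex_of_real (indicator K x))"
      by (rule finite_measure.sqint_bounded[OF finite_measure_torus, where C=1]) (auto simp: indicator_def)
    show "(\<lambda>n. l2 (torus L) (\<lambda>x. complex_of_real (indicator K x) - complex_of_real (g n (circ L x)))) \<longlonglongrightarrow> 0"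
    proof (rule tendsto_l2_dominated[where g="\<lambda>x. 1::real"])
      show "sqint (torus L) (\<lambda>x. 1::real)"
        by (rule finite_measure.sqint_bounded[OF finite_measure_torus, where C=1]) auto
      show "norm (complex_of_real (indicator K x) - complex_of_real (g n (circ L x))) \<le> norm (1::real)" for n x
        unfolding of_real_diff[symmetric] norm_of_real using g01[of n "circ L x"] by (auto simp: indicator_def)
      fix x assume x: "x \<in> space (torus L)"
      have "(\<lambda>n. g n (circ L x)) \<longlonglongrightarrow> indicator K x"
      proof (cases "x \<in> K")
        case True
        then show ?thesis by (simp add: g_def)
      next
        case out: False
        have "circ L x \<notin> circ L ` K"
          using circ_inject[OF L, of x] x K(2) out by auto
        then have "0 < infdist (circ L x) (circ L ` K)"
          using infdist_pos_not_in_closed[OF compact_imp_closed[OF cK]] False by auto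
        then obtain N :: nat where N: "1 < real N * infdist (circ L x) (circ L ` K)"
          using reals_Archimedean3 by blast
        have "g n (circ L x) = 0" if "n \<ge> N" for n
        proof -
          have "real N * infdist (circ L x) (circ L ` K) \<le> real n * infdist (circ L x) (circ L ` K)"
            using that by (intro mult_right_mono infdist_nonneg) auto
          then show ?thesis using N by (simp add: g_def)
        qed
        then have "eventually (\<lambda>n. g n (circ L x) = 0) sequentially"
          unfolding eventually_sequentially by blast
        then show ?thesis using out by (simp add: tendsto_eventually)
      qed
      then show "(\<lambda>n. complex_of_real (g n (circ L x))) \<longlonglongrightarrow> complex_of_real (indicator K x)"
        by (rule tendsto_of_real)
    qed (use mK tapx_sqint[OF t] in \<open>auto dest: sqint_borel\<close>)
  qed
qed

text \<open>Inner regularity: apart from the boundary of the box, a null set, \<open>A\<close> is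
  exhausted up to small measure by a compact subset of the open box.\<close>

lemma tapx_indicator:
  assumes L: "0 < L" and A: "A \<in> sets (torus L)"
  shows "tapx L (\<lambda>x. complex_of_real (indicator A x))"
proof (rule tapx_limit)
  have Al: "A \<in> sets lebesgue" and Asub: "A \<subseteq> cbox 0 (vec L)"
    using A by (auto simp: sets_restrict_space)
  have ind: "sqint (torus L) (\<lambda>x. complex_of_real (indicator B x))" if "B \<in> sets lebesgue" for B
    by (rule finite_measure.sqint_bounded[OF finite_measure_torus, where C=1])
       (use that in \<open>auto intro!: measurable_restrict_space1 simp: indicator_def\<close>)
  show "sqint (torus L) (\<lambda>x. complex_of_real (indicator A x))" by (rule ind[OF Al])
  fix \<epsilon> :: real assume "0 < \<epsilon>"
  define A' where "A' = A \<inter> box 0 (vec L)"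
  have A': "A' \<in> sets lebesgue" using Al by (auto simp: A'_def)
  obtain T where T: "closed T" "T \<subseteq> A'" "A' - T \<in> lmeasurable" "emeasure lebesgue (A' - T) < ennreal ((\<epsilon>/2)\<^sup>2)"
    using sets_lebesgue_inner_closed[OF A', of "(\<epsilon>/2)\<^sup>2"] \<open>0 < \<epsilon>\<close> by auto
  have Tb: "T \<subseteq> box 0 (vec L)" using T(2) by (auto simp: A'_def)
  then have "compact T"
    using T(1) bounded_subset[OF bounded_box] compact_eq_bounded_closed by blast
  then have tT: "tapx L (\<lambda>x. complex_of_real (indicator T x))"
    by (intro tapx_indicator_compact L Tb)
  have neg: "negligible (cbox 0 (vec L) - box 0 (vec L :: real^3))"
    by (rule negligible_frontier_interval)
  have "(LINT x|torus L. (norm (complex_of_real (indicator A x) - complex_of_real (indicator T x)))\<^sup>2)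
     = (LINT x|torus L. indicator (A' - T) x)"
  proof (rule integral_cong_AE)
    show "(\<lambda>x. (norm (complex_of_real (indicator A x) - complex_of_real (indicator T x)))\<^sup>2) \<in> borel_measurable (torus L)"
    proof (intro measurable_restrict_space1)
      have [measurable]: "A \<in> sets lebesgue" "T \<in> sets lebesgue" using Al T(1) by auto
      show "(\<lambda>x. (norm (complex_of_real (indicator A x) - complex_of_real (indicator T x)))\<^sup>2) \<in> borel_measurable lebesgue"
        by measurable
    qed
    show "indicator (A' - T) \<in> borel_measurable (torus L)"
      using A' T(1) by (intro measurable_restrict_space1 borel_measurable_indicator) auto
    have "AE x in lebesgue. x \<notin> cbox 0 (vec L) - box 0 (vec L :: real^3)"
      using neg by (intro AE_not_in) (simp add: negligible_iff_null_sets)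
    then show "AE x in torus L. (norm (complex_of_real (indicator A x) - complex_of_real (indicator T x)))\<^sup>2 = indicator (A' - T) x"
      unfolding AE_restrict_space_iff[of "cbox 0 (vec L)" lebesgue, simplified]
      by (rule eventually_mono) (use T(2) Tb in \<open>auto simp: indicator_def A'_def\<close>)
  qed
  also have "\<dots> = measure lebesgue (A' - T)"
    using A' T(1) by (subst integral_restrict_space) (auto simp: indicator_inter_arith[symmetric] A'_def intro!: arg_cong2[where f=measure] dest: subsetD[OF Asub])
  also have "\<dots> < (\<epsilon>/2)\<^sup>2"
    using T(3,4) \<open>0 < \<epsilon>\<close> by (simp add: emeasure_eq_measure2 ennreal_less_iff)
  finally have "l2 (torus L) (\<lambda>x. complex_of_real (indicator A x) - complex_of_real (indicator T x)) < sqrt ((\<epsilon>/2)\<^sup>2)"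
    unfolding l2_def by (rule real_sqrt_less_mono)
  then have "l2 (torus L) (\<lambda>x. complex_of_real (indicator A x) - complex_of_real (indicator T x)) < \<epsilon>"
    using \<open>0 < \<epsilon>\<close> by simp
  with tT show "\<exists>g. tapx L g \<and> l2 (torus L) (\<lambda>x. complex_of_real (indicator A x) - g x) < \<epsilon>" by blast
qed

text \<open>Square-integrable functions are dominated limits of simple functions, and these are
  combinations of indicators of measurable sets.\<close>

lemma tapx_sqint_all:
  assumes L: "0 < L" and f: "sqint (torus L) f"
  shows "tapx L f"
proof -
  obtain F where F0: "(\<forall>i. simple_function (torus L) (F i)) \<and> (\<forall>x\<in>space (torus L). (\<lambda>i. F i x) \<longlonglongrightarrow> f x) \<and>
    (\<forall>i. \<forall>x\<in>space (torus L). dist (F i x) 0 \<le> 2 * dist (f x) 0)"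
    using borel_measurable_implies_sequence_metric[OF sqint_borel[OF f], of 0] by blast
  then have F: "\<And>i. simple_function (torus L) (F i)" "\<And>x. x \<in> space (torus L) \<Longrightarrow> (\<lambda>i. F i x) \<longlonglongrightarrow> f x"
    "\<And>i x. x \<in> space (torus L) \<Longrightarrow> norm (F i x) \<le> 2 * norm (f x)"
    by (auto simp: dist_norm)
  have tF: "tapx L (F i)" for i
  proof (rule tapx_limit)
    have rep: "F i x = (\<Sum>y\<in>F i ` space (torus L). complex_of_real (indicator (F i -` {y} \<inter> space (torus L)) x) * y)"
      if "x \<in> space (torus L)" for x
    proof -
      have "(\<Sum>y\<in>F i ` space (torus L). complex_of_real (indicator (F i -` {y} \<inter> space (torus L)) x) * y)
        = (\<Sum>y\<in>F i ` space (torus L). if y = F i x then y else 0)"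
        using that by (intro sum.cong) (auto simp: indicator_def)
      then show ?thesis using that F(1)[of i] by (simp add: simple_function_def)
    qed
    define g where "g x = (\<Sum>y\<in>F i ` space (torus L). complex_of_real (indicator (F i -` {y} \<inter> space (torus L)) x) * y)" for x
    have "tapx L g"
      unfolding g_def using F(1)[of i] by (intro tapx_sum tapx_cmult tapx_indicator L) (auto simp: simple_function_def)
    moreover have "l2 (torus L) (\<lambda>x. F i x - g x) = 0"
    proof -
      have "(norm (F i x - g x))\<^sup>2 = 0" if "x \<in> space (torus L)" for x
        using rep[OF that, folded g_def] by (simp del: space_restrict_space)
      then have "(LINT x|torus L. (norm (F i x - g x))\<^sup>2) = (LINT x|torus L. 0)"
        by (rule Bochner_Integration.integral_cong[OF refl])
      then show ?thesis by (simp only: l2_def) simp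
    qed
    ultimately show "\<exists>g. tapx L g \<and> l2 (torus L) (\<lambda>x. F i x - g x) < \<epsilon>" if "0 < \<epsilon>" for \<epsilon>
      using that by (metis (no_types))
    have "sqint (torus L) (\<lambda>x. 2 * norm (f x))"
      using f by (auto simp: sqint_def power_mult_distrib)
    then show "sqint (torus L) (F i)"
      by (rule sqint_bound[OF _ borel_measurable_simple_function[OF F(1)]]) (simp add: F(3))
  qed
  show ?thesis
  proof (rule tapx_sequence[OF tF f])
    show "(\<lambda>n. l2 (torus L) (\<lambda>x. f x - F n x)) \<longlonglongrightarrow> 0"
    proof (rule tendsto_l2_dominated[where g="\<lambda>x. 3 * norm (f x)"])
      show "sqint (torus L) (\<lambda>x. 3 * norm (f x))"
        using f by (auto simp: sqint_def power_mult_distrib)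
      show "norm (f x - F n x) \<le> norm (3 * norm (f x))" if "x \<in> space (torus L)" for n x
        using order_trans[OF norm_triangle_ineq4 add_left_mono[OF F(3)[OF that]], of "f x" n] by simp
    qed (use sqint_borel[OF f] F(2) borel_measurable_simple_function[OF F(1)] in auto)
  qed
qed

text \<open>Uniformly bounded operators that eventually fix each trigonometric polynomial converge
  strongly to the identity, by density.\<close>

theorem fmult_tendsto:
  assumes L: "0 < L" and f: "sqint (torus L) f" and S: "\<And>n. finite (S n)" and B: "\<And>n k. \<bar>m n k\<bar> \<le> B"
    and lim: "\<And>j. eventually (\<lambda>n. \<forall>k\<in>fbox j. k \<in> S n \<and> m n k = 1) sequentially"
  shows "(\<lambda>n. l2 (torus L) (\<lambda>x. fmult L (m n) (S n) f x - f x)) \<longlonglongrightarrow> 0"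
proof (rule LIMSEQ_I)
  fix \<epsilon> :: real assume "0 < \<epsilon>"
  have B0: "0 \<le> B" using B[of 0 0] by linarith
  obtain p where p: "istp L p" "l2 (torus L) (\<lambda>x. f x - p x) < \<epsilon> / (B + 1)"
    using tapxD[OF tapx_sqint_all[OF L f], of "\<epsilon> / (B + 1)"] \<open>0 < \<epsilon>\<close> B0 by auto
  then obtain j c where pj: "p = tp L c (fbox j)" by (auto simp: istp_def)
  have psq: "sqint (torus L) p" by (rule istp_sqint[OF p(1)])
  obtain N where N: "\<And>n k. n \<ge> N \<Longrightarrow> k \<in> fbox j \<Longrightarrow> k \<in> S n \<and> m n k = 1"
    using lim[of j] unfolding eventually_sequentially by blast
  have "norm (l2 (torus L) (\<lambda>x. fmult L (m n) (S n) f x - f x) - 0) < \<epsilon>" if "n \<ge> N" for n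
  proof -
    have pp: "fmult L (m n) (S n) p = p"
    proof -
      have "fmult L (m n) (S n) p = tp L (\<lambda>k. if k \<in> fbox j then c k else 0) (S n)"
        unfolding fmult_def pj fc_tp[OF L finite_fbox]
        using N[OF that] by (auto simp: tp_def[abs_def] fun_eq_iff intro!: sum.cong)
      also have "\<dots> = p"
        unfolding pj by (rule tp_extend[symmetric, OF S]) (use N[OF that] in auto)
      finally show ?thesis .
    qed
    have "l2 (torus L) (\<lambda>x. fmult L (m n) (S n) f x - f x)
      = l2 (torus L) (\<lambda>x. fmult L (m n) (S n) (\<lambda>x. f x - p x) x - (f x - p x))"
      unfolding fmult_diff[OF f psq] pp by (intro arg_cong[where f="l2 _"]) auto
    also have "\<dots> \<le> l2 (torus L) (fmult L (m n) (S n) (\<lambda>x. f x - p x)) + l2 (torus L) (\<lambda>x. f x - p x)"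
      by (intro l2_triangle_diff sqint_fmult sqint_diff f psq)
    also have "\<dots> \<le> B * l2 (torus L) (\<lambda>x. f x - p x) + l2 (torus L) (\<lambda>x. f x - p x)"
      by (intro add_right_mono l2_fmult_le L S sqint_diff f psq B)
    also have "\<dots> = (B + 1) * l2 (torus L) (\<lambda>x. f x - p x)" by (simp add: distrib_right)
    also have "\<dots> < \<epsilon>"
      using p(2) B0 by (simp add: pos_less_divide_eq mult.commute)
    finally show ?thesis by simp
  qed
  then show "\<exists>no. \<forall>n\<ge>no. norm (l2 (torus L) (\<lambda>x. fmult L (m n) (S n) f x - f x) - 0) < \<epsilon>" by blast
qed

section \<open>Interaction of dyadic pieces\<close>

definition ndist :: "nat \<Rightarrow> nat \<Rightarrow> nat" where
  "ndist j q = (j - q) + (q - j)"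

lemma ndist_commute: "ndist j q = ndist q j"
  by (simp add: ndist_def)

text \<open>Two geometric series, one on each side of \<open>q\<close>; the bound is uniform in
  \<open>q\<close> and \<open>J\<close>.\<close>

lemma sum_ndist_le:
  fixes b :: real
  assumes "0 \<le> b" "b < 1"
  shows "(\<Sum>j<J. b ^ ndist j q) \<le> 2 / (1 - b)"
proof -
  have geo: "(\<Sum>i<n. b ^ i) \<le> 1 / (1 - b)" for n
    using assms by (simp add: sum_gp_strict divide_right_mono)
  have split: "(\<Sum>j<m + J. f j) = (\<Sum>j<m. f j) + (\<Sum>i<J. f (m + i))" for f :: "nat \<Rightarrow> real" and m
    by (induction J) (simp_all add: add.assoc)
  have "(\<Sum>j<J. b ^ ndist j q) \<le> (\<Sum>j<Suc q + J. b ^ ndist j q)"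
    using assms by (intro sum_mono2) auto
  also have "\<dots> = (\<Sum>j<Suc q. b ^ ndist j q) + (\<Sum>i<J. b ^ ndist (Suc q + i) q)"
    by (rule split)
  also have "(\<Sum>j<Suc q. b ^ ndist j q) = (\<Sum>i<Suc q. b ^ i)"
    by (subst sum.nat_diff_reindex[symmetric]) (auto simp: ndist_def intro!: sum.cong)
  also have "(\<Sum>i<J. b ^ ndist (Suc q + i) q) \<le> (\<Sum>i<J. b ^ i)"
    using assms by (intro sum_mono power_decreasing) (auto simp: ndist_def)
  finally have "(\<Sum>j<J. b ^ ndist j q) \<le> (\<Sum>i<Suc q. b ^ i) + (\<Sum>i<J. b ^ i)" by simp
  then show ?thesis using geo[of "Suc q"] geo[of J] by simp
qed

text \<open>Cauchy-Schwarz with the weights \<open>b ^ ndist j q\<close>. The centre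
  \<open>q\<close> is free; it will be the index of the shell of \<open>w\<close> that multiplies
  the square.\<close>

lemma square_sum_weighted:
  fixes h :: "nat \<Rightarrow> real"
  assumes "0 < b" "b < 1"
  shows "(\<Sum>j<J. h j)\<^sup>2 \<le> 2 / (1 - b) * (\<Sum>j<J. (h j)\<^sup>2 / b ^ ndist j q)"
proof -
  let ?w = "\<lambda>j. sqrt (b ^ ndist j q)"
  have w: "?w j > 0" for j using assms by simp
  have "(\<Sum>j<J. h j)\<^sup>2 = (\<Sum>j<J. ?w j * (h j / ?w j))\<^sup>2"
  proof -
    have "?w j * (h j / ?w j) = h j" for j
      using w[of j] by (metis nonzero_mult_div_cancel_left times_divide_eq_right less_irrefl)
    then show ?thesis by presburger
  qed
  also have "\<dots> \<le> (\<Sum>j<J. (?w j)\<^sup>2) * (\<Sum>j<J. (h j / ?w j)\<^sup>2)"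
    by (rule Cauchy_Schwarz_ineq_sum)
  also have "\<dots> = (\<Sum>j<J. b ^ ndist j q) * (\<Sum>j<J. (h j)\<^sup>2 / b ^ ndist j q)"
    using assms by (simp add: power_divide)
  also have "\<dots> \<le> 2 / (1 - b) * (\<Sum>j<J. (h j)\<^sup>2 / b ^ ndist j q)"
    using assms by (intro mult_right_mono sum_ndist_le sum_nonneg) auto
  finally show ?thesis .
qed

text \<open>Every pair of indices is counted at its larger one. The larger index will be kept inside
  the integral, the smaller one replaced by a supremum.\<close>

lemma square_sum_triangular:
  fixes n :: "nat \<Rightarrow> real"
  assumes "\<And>q. 0 \<le> n q"
  shows "(\<Sum>q<K. n q)\<^sup>2 \<le> 2 * (\<Sum>q<K. (\<Sum>p\<le>q. n p) * n q)"
proof (induction K)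
  case (Suc K)
  have "(\<Sum>q<Suc K. n q)\<^sup>2 \<le> (\<Sum>q<K. n q)\<^sup>2 + 2 * ((\<Sum>p\<le>K. n p) * n K)"
    using assms[of K] by (simp add: lessThan_Suc_atMost[symmetric] power2_eq_square algebra_simps)
  with Suc show ?case by (simp add: distrib_left)
qed simp

text \<open>Schur test for the kernel \<open>g ^ |p - q|\<close>, after
  \<open>d p * d q \<le> ((d p)^2 + (d q)^2) / 2\<close>.\<close>

lemma schur_triangular:
  fixes d :: "nat \<Rightarrow> real"
  assumes g: "0 \<le> g" "g < 1" and d: "\<And>q. 0 \<le> d q"
  shows "(\<Sum>q<K. \<Sum>p\<le>q. g ^ (q - p) * (d p * d q)) \<le> 2 / (1 - g) * (\<Sum>q<K. (d q)\<^sup>2)"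
proof -
  have "(\<Sum>q<K. \<Sum>p\<le>q. g ^ (q - p) * (d p * d q)) \<le> (\<Sum>q<K. \<Sum>p<K. g ^ ndist p q * (((d p)\<^sup>2 + (d q)\<^sup>2) / 2))"
  proof (rule sum_mono)
    fix q assume "q \<in> {..<K}"
    have "(\<Sum>p\<le>q. g ^ (q - p) * (d p * d q)) \<le> (\<Sum>p\<le>q. g ^ ndist p q * (((d p)\<^sup>2 + (d q)\<^sup>2) / 2))"
    proof (rule sum_mono)
      fix p assume "p \<in> {..q}"
      then have e: "ndist p q = q - p" by (simp add: ndist_def)
      show "g ^ (q - p) * (d p * d q) \<le> g ^ ndist p q * (((d p)\<^sup>2 + (d q)\<^sup>2) / 2)"
        unfolding e using g sum_squares_bound[of "d p" "d q"] by (intro mult_left_mono) auto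
    qed
    also have "\<dots> \<le> (\<Sum>p<K. g ^ ndist p q * (((d p)\<^sup>2 + (d q)\<^sup>2) / 2))"
      using \<open>q \<in> {..<K}\<close> g by (intro sum_mono2) auto
    finally show "(\<Sum>p\<le>q. g ^ (q - p) * (d p * d q)) \<le> (\<Sum>p<K. g ^ ndist p q * (((d p)\<^sup>2 + (d q)\<^sup>2) / 2))" .
  qed
  also have "\<dots> = (\<Sum>q<K. \<Sum>p<K. g ^ ndist p q * (d p)\<^sup>2 / 2) + (\<Sum>q<K. \<Sum>p<K. g ^ ndist p q * (d q)\<^sup>2 / 2)"
    by (simp add: sum.distrib[symmetric] distrib_left add_divide_distrib)
  also have "(\<Sum>q<K. \<Sum>p<K. g ^ ndist p q * (d p)\<^sup>2 / 2) = (\<Sum>q<K. \<Sum>p<K. g ^ ndist p q * (d q)\<^sup>2 / 2)"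
    by (subst sum.swap) (simp add: ndist_commute)
  also have "(\<Sum>q<K. \<Sum>p<K. g ^ ndist p q * (d q)\<^sup>2 / 2) + (\<Sum>q<K. \<Sum>p<K. g ^ ndist p q * (d q)\<^sup>2 / 2)
     = (\<Sum>q<K. (\<Sum>p<K. g ^ ndist p q) * (d q)\<^sup>2)"
    by (simp add: sum.distrib[symmetric] sum_distrib_right)
  also have "\<dots> \<le> (\<Sum>q<K. 2 / (1 - g) * (d q)\<^sup>2)"
    using g by (intro sum_mono mult_right_mono sum_ndist_le) auto
  finally show ?thesis by (simp add: sum_distrib_left)
qed

text \<open>Write \<open>h^2\<close> as \<open>h^(2 - s)\<close> times \<open>h^s\<close>. The
  exponent \<open>2 - s\<close> is positive for \<open>s = r / 2\<close> and negative for
  \<open>s = r\<close>, which serves values below and above \<open>\<mu>\<close>. The power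
  \<open>r / 2\<close> is paired with the \<open>L^2\<close> norm of a shell, the power
  \<open>r\<close> with its supremum.\<close>

lemma square_le_powr:
  fixes h \<mu> r :: real
  assumes "0 \<le> h" "0 < \<mu>" "2 < r" "r < 3"
  shows "h \<le> \<mu> \<Longrightarrow> h\<^sup>2 \<le> \<mu> powr (2 - r / 2) * h powr (r / 2)"
    and "h\<^sup>2 \<le> \<mu> powr (2 - r) * h powr r + \<mu> powr (2 - r / 2) * h powr (r / 2)"
proof -
  have sq: "h\<^sup>2 = h powr a * h powr (2 - a)" if "0 < h" for a
    using that by (simp add: powr_add[symmetric])
  show 1: "h\<^sup>2 \<le> \<mu> powr (2 - r / 2) * h powr (r / 2)" if "h \<le> \<mu>"
  proof (cases "h = 0")
    case False
    then have "h\<^sup>2 = h powr (2 - r / 2) * h powr (r / 2)"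
      using sq[of "r / 2"] assms(1) by (simp add: mult.commute)
    also have "\<dots> \<le> \<mu> powr (2 - r / 2) * h powr (r / 2)"
      using assms that by (intro mult_right_mono powr_mono2) auto
    finally show ?thesis .
  qed (use assms in simp)
  show "h\<^sup>2 \<le> \<mu> powr (2 - r) * h powr r + \<mu> powr (2 - r / 2) * h powr (r / 2)"
  proof (cases "h \<le> \<mu>")
    case True
    then show ?thesis using 1 by (simp add: add_increasing)
  next
    case False
    then have "h\<^sup>2 = h powr (2 - r) * h powr r"
      using sq[of r] assms by (simp add: mult.commute)
    also have "\<dots> \<le> \<mu> powr (2 - r) * h powr r"
      using assms False by (intro mult_right_mono powr_mono2') auto
    finally show ?thesis by (simp add: add_increasing2)
  qed
qed

text \<open>The bound in \<open>integral_h2n\<close> decays like the square of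
  \<open>ratio ^ |j - q|\<close>: one factor pays for the weights of
  \<open>square_sum_weighted\<close>, the other makes the sum over \<open>j\<close> converge. This
  is why the natural exponent \<open>(3 - r) / 2\<close> is halved.\<close>

definition shell_ratio :: "real \<Rightarrow> real" where
  "shell_ratio r = 2 powr (- (3 - r) / 4)"

text \<open>The factors come, in this order, from \<open>square_sum_triangular\<close> and the
  supremum bound on the shells, from the two sums over \<open>j\<close>, from
  \<open>integral_h2n\<close>, and from the Schur test with ratio \<open>1 / sqrt 2\<close>.\<close>

definition shell_const :: "real \<Rightarrow> real \<Rightarrow> real" where
  "shell_const r C = 2 * C * (2 / (1 - shell_ratio r))\<^sup>2 * (2 * C\<^sup>2) * (2 / (1 - 1 / sqrt 2))"

lemma shell_ratio: "2 < r \<Longrightarrow> r < 3 \<Longrightarrow> 0 < shell_ratio r" "2 < r \<Longrightarrow> r < 3 \<Longrightarrow> shell_ratio r < 1"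
  by (auto simp: shell_ratio_def powr_less_one)

lemma shell_const_pos: "2 < r \<Longrightarrow> r < 3 \<Longrightarrow> 0 < C \<Longrightarrow> 0 < shell_const r C"
  using shell_ratio[of r] by (auto simp: shell_const_def intro!: mult_pos_pos divide_pos_pos)

text \<open>
  Here \<open>h j\<close> stands for the modulus of the \<open>j\<close>-th Littlewood-Paley piece of a solution, \<open>n q\<close> for
  that of the \<open>q\<close>-th dyadic shell of the difference \<open>w\<close> of the two solutions, and \<open>d q\<close> for the size
  of the gradient of that shell.
\<close>

locale shell_estimate = finite_measure M for M :: "'a measure" +
  fixes r A V C :: real and h n :: "nat \<Rightarrow> 'a \<Rightarrow> real" and d :: "nat \<Rightarrow> real"
  assumes r: "2 < r" "r < 3" and A: "0 < A" and V: "0 \<le> V" and C: "1 \<le> C"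
    and h_meas [measurable]: "\<And>j. h j \<in> borel_measurable M"
    and n_meas [measurable]: "\<And>q. n q \<in> borel_measurable M"
    and h_nonneg: "\<And>j x. 0 \<le> h j x" and n_nonneg: "\<And>q x. 0 \<le> n q x" and d_nonneg: "\<And>q. 0 \<le> d q"
    and h_sup: "\<And>j x. h j x \<le> C * A * 2 ^ j"
    and h_Lr: "\<And>j. (LINT x|M. h j x powr r) \<le> V * A powr r * 2 powr (real j * (r - 3))"
    and n_sup: "\<And>q x. n q x \<le> C * sqrt 2 ^ q * d q"
    and n_L2: "\<And>q. (LINT x|M. (n q x)\<^sup>2) \<le> V * (d q / 2 ^ q)\<^sup>2"
begin

abbreviation "ratio \<equiv> shell_ratio r"

lemmas ratio = shell_ratio[OF r]

lemma bounded_h: "norm (h j x powr s) \<le> (C * A * 2 ^ j) powr s" if "0 \<le> s"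
  using that h_nonneg[of j x] h_sup[of j x] by (simp add: powr_mono2)

lemma integrable_h_powr: "0 \<le> s \<Longrightarrow> integrable M (\<lambda>x. h j x powr s)"
  by (rule integrable_const_bound[OF AE_I2[OF bounded_h]]) auto

lemma sqint_n: "sqint M (n q)"
  by (rule sqint_bounded[where C="C * sqrt 2 ^ q * d q"]) (use n_sup n_nonneg in auto)

lemma sqint_h_half: "sqint M (\<lambda>x. h j x powr (r / 2))"
  by (rule sqint_bounded[OF _ bounded_h]) (use r in auto)

lemma integral_h_half_n:
  "(LINT x|M. h j x powr (r / 2) * n q x) \<le> V * (A powr (r / 2) * 2 powr (real j * (r - 3) / 2) * (d q / 2 ^ q))"
proof -
  have "(LINT x|M. h j x powr (r / 2) * n q x) \<le> l2 M (\<lambda>x. h j x powr (r / 2)) * l2 M (n q)"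
    by (rule Cauchy_Schwarz_integral[OF sqint_h_half sqint_n])
  also have "l2 M (\<lambda>x. h j x powr (r / 2)) \<le> sqrt (V * A powr r * 2 powr (real j * (r - 3)))"
  proof -
    have "(norm (h j x powr (r / 2)))\<^sup>2 = h j x powr r" for x
      by (simp add: power2_eq_square powr_add[symmetric])
    then show ?thesis using h_Lr[of j] by (simp add: l2_def)
  qed
  also have "sqrt (V * A powr r * 2 powr (real j * (r - 3))) = sqrt V * (A powr (r / 2) * 2 powr (real j * (r - 3) / 2))"
  proof -
    have "sqrt (x powr a) = x powr (a / 2)" for x a :: real
      using powr_half_sqrt[of "x powr a"] by (simp add: powr_powr)
    then show ?thesis by (simp add: real_sqrt_mult)
  qed
  also have "l2 M (n q) \<le> sqrt (V * (d q / 2 ^ q)\<^sup>2)"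
    using n_L2[of q] by (simp add: l2_def)
  also have "sqrt (V * (d q / 2 ^ q)\<^sup>2) = sqrt V * (d q / 2 ^ q)"
    using d_nonneg[of q] by (simp add: real_sqrt_mult)
  finally have "(LINT x|M. h j x powr (r / 2) * n q x)
     \<le> sqrt V * (A powr (r / 2) * 2 powr (real j * (r - 3) / 2)) * (sqrt V * (d q / 2 ^ q))"
    using V by (simp add: mult_left_mono mult_right_mono)
  also have "\<dots> = (sqrt V * sqrt V) * (A powr (r / 2) * 2 powr (real j * (r - 3) / 2) * (d q / 2 ^ q))"
    by (simp only: mult_ac)
  finally show ?thesis using V by simp
qed

lemma integrable_h2n: "integrable M (\<lambda>x. (h j x)\<^sup>2 * n q x)"
proof (rule integrable_const_bound)
  show "AE x in M. norm ((h j x)\<^sup>2 * n q x) \<le> (C * A * 2 ^ j)\<^sup>2 * (C * sqrt 2 ^ q * d q)"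
    using h_nonneg n_nonneg h_sup n_sup by (intro AE_I2) (simp add: mult_mono power_mono abs_mult)
qed measurable

lemma two_pow_powr: "(2::real) ^ q = 2 powr real q" "sqrt 2 ^ q = 2 powr (real q / 2)"
  by (simp_all add: powr_realpow powr_half_sqrt[symmetric] powr_powr flip: powr_realpow)

text \<open>
  For \<open>j \<le> q\<close> the supremum bound on \<open>h j\<close> suffices; for \<open>j > q\<close> the function is split at height
  \<open>A * 2 ^ q\<close>, and the large values are paired with the supremum of \<open>n q\<close>.
\<close>

lemma integral_h2n:
  "(LINT x|M. (h j x)\<^sup>2 * n q x) \<le> V * (2 * C\<^sup>2) * A\<^sup>2 * (d q / sqrt 2 ^ q) * (ratio ^ ndist j q)\<^sup>2"
proof -
  have half_int: "integrable M (\<lambda>x. h j x powr (r / 2) * n q x)"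
    by (rule integrable_mult_sqint[OF sqint_h_half sqint_n])
  have ratio_pow: "(ratio ^ k)\<^sup>2 = 2 powr (- (3 - r) / 2 * real k)" for k
  proof -
    have "(ratio ^ k)\<^sup>2 = ratio powr real (k * 2)"
      using ratio(1) by (simp only: power_mult[symmetric] powr_realpow)
    also have "\<dots> = 2 powr (- (3 - r) / 4 * real (k * 2))"
      by (simp only: shell_ratio_def powr_powr)
    also have "- (3 - r) / 4 * real (k * 2) = - (3 - r) / 2 * real k" by simp
    finally show ?thesis .
  qed
  have Asq: "A powr (2 - s) * A powr s = A\<^sup>2" for s
    using A by (simp add: powr_add[symmetric])
  have C2: "C powr s \<le> C\<^sup>2" "C \<le> C\<^sup>2" "1 \<le> C\<^sup>2" if "s \<le> 2" for s
    using C that powr_mono[of s 2 C] mult_mono[of 1 C 1 C] by (auto simp: power2_eq_square mult_le_cancel_left1 one_le_power)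
  let ?k = "ndist j q"
  show ?thesis
  proof (cases "j \<le> q")
    case True
    then have k: "real ?k = real q - real j" by (simp add: ndist_def)
    have "(LINT x|M. (h j x)\<^sup>2 * n q x) \<le> (LINT x|M. (C * A * 2 ^ j) powr (2 - r / 2) * (h j x powr (r / 2) * n q x))"
    proof (rule integral_mono[OF integrable_h2n])
      fix x
      show "(h j x)\<^sup>2 * n q x \<le> (C * A * 2 ^ j) powr (2 - r / 2) * (h j x powr (r / 2) * n q x)"
        unfolding mult.assoc[symmetric]
        using square_le_powr(1)[OF h_nonneg[of j x] _ r h_sup[of j x]] A C
        by (intro mult_right_mono n_nonneg) (simp add: mult_ac)
    qed (use half_int in simp)
    also have "\<dots> \<le> (C * A * 2 ^ j) powr (2 - r / 2) * (V * (A powr (r / 2) * 2 powr (real j * (r - 3) / 2) * (d q / 2 ^ q)))"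
      unfolding integral_mult_right_zero by (intro mult_left_mono integral_h_half_n powr_ge_zero)
    also have "\<dots> = C powr (2 - r / 2) * (V * (A powr (2 - r / 2) * A powr (r / 2)) * d q
        * (2 powr (real j * (2 - r / 2)) * 2 powr (real j * (r - 3) / 2) * 2 powr (- real q)))"
      using A C by (simp add: powr_mult two_pow_powr(1) powr_powr powr_minus_divide)
    also have "2 powr (real j * (2 - r / 2)) * 2 powr (real j * (r - 3) / 2) * 2 powr (- real q)
       = 2 powr (- real q / 2) * 2 powr (- (1/2) * real ?k)"
      unfolding powr_add[symmetric] k by (intro arg_cong[where f="\<lambda>x. 2 powr x"]) (simp add: field_simps)
    also have "C powr (2 - r / 2) * (V * (A powr (2 - r / 2) * A powr (r / 2)) * d q * (2 powr (- real q / 2) * 2 powr (- (1/2) * real ?k)))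
       \<le> (2 * C\<^sup>2) * (V * (A powr (2 - r / 2) * A powr (r / 2)) * d q * (2 powr (- real q / 2) * 2 powr (- (3 - r) / 2 * real ?k)))"
    proof (rule mult_mono)
      show "C powr (2 - r / 2) \<le> 2 * C\<^sup>2" using C2(1)[of "2 - r / 2"] C2(3)[of 0] r by simp
      \<comment> \<open>The case \<open>j \<le> q\<close> gives decay
        \<open>2 powr (- k / 2)\<close> with \<open>k = ndist j q\<close>. Since
        \<open>r > 2\<close>, this is stronger than the common rate.\<close>
      have "- (1/2) * real ?k \<le> - (3 - r) / 2 * real ?k" using r by (intro mult_right_mono) auto
      then show "V * (A powr (2 - r / 2) * A powr (r / 2)) * d q * (2 powr (- real q / 2) * 2 powr (- (1/2) * real ?k))
         \<le> V * (A powr (2 - r / 2) * A powr (r / 2)) * d q * (2 powr (- real q / 2) * 2 powr (- (3 - r) / 2 * real ?k))"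
        using V A d_nonneg[of q] by (intro mult_left_mono powr_mono) auto
    qed (use V A d_nonneg[of q] in auto)
    finally show ?thesis
      unfolding ratio_pow Asq two_pow_powr by (simp add: powr_minus_divide mult_ac)
  next
    case False
    then have k: "real ?k = real j - real q" by (simp add: ndist_def)
    let ?\<mu> = "A * 2 ^ q"
    have "(LINT x|M. (h j x)\<^sup>2 * n q x) \<le> (LINT x|M. ?\<mu> powr (2 - r) * (C * sqrt 2 ^ q * d q) * h j x powr r
         + ?\<mu> powr (2 - r / 2) * (h j x powr (r / 2) * n q x))"
    proof (rule integral_mono[OF integrable_h2n])
      fix x
      have "(h j x)\<^sup>2 * n q x \<le> (?\<mu> powr (2 - r) * h j x powr r + ?\<mu> powr (2 - r / 2) * h j x powr (r / 2)) * n q x"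
        using square_le_powr(2)[OF h_nonneg[of j x] _ r, of ?\<mu>] A by (intro mult_right_mono n_nonneg) auto
      also have "\<dots> = (?\<mu> powr (2 - r) * h j x powr r) * n q x + ?\<mu> powr (2 - r / 2) * (h j x powr (r / 2) * n q x)"
        by (simp add: distrib_right)
      also have "(?\<mu> powr (2 - r) * h j x powr r) * n q x \<le> (?\<mu> powr (2 - r) * h j x powr r) * (C * sqrt 2 ^ q * d q)"
        by (intro mult_left_mono n_sup) auto
      finally show "(h j x)\<^sup>2 * n q x \<le> ?\<mu> powr (2 - r) * (C * sqrt 2 ^ q * d q) * h j x powr r
         + ?\<mu> powr (2 - r / 2) * (h j x powr (r / 2) * n q x)" by (simp add: mult_ac)
    qed (use half_int integrable_h_powr[of r j] r in simp)
    also have "\<dots> = ?\<mu> powr (2 - r) * (C * sqrt 2 ^ q * d q) * (LINT x|M. h j x powr r)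
         + ?\<mu> powr (2 - r / 2) * (LINT x|M. h j x powr (r / 2) * n q x)"
      using half_int integrable_h_powr[of r j] r by simp
    also have "\<dots> \<le> ?\<mu> powr (2 - r) * (C * sqrt 2 ^ q * d q) * (V * A powr r * 2 powr (real j * (r - 3)))
         + ?\<mu> powr (2 - r / 2) * (V * (A powr (r / 2) * 2 powr (real j * (r - 3) / 2) * (d q / 2 ^ q)))"
      using C d_nonneg[of q] by (intro add_mono mult_left_mono h_Lr integral_h_half_n) auto
    also have "\<dots> = C * (V * (A powr (2 - r) * A powr r) * d q * (2 powr (real q * (2 - r)) * 2 powr (real q / 2) * 2 powr (real j * (r - 3))))
        + V * (A powr (2 - r / 2) * A powr (r / 2)) * d q
        * (2 powr (real q * (2 - r / 2)) * 2 powr (real j * (r - 3) / 2) * 2 powr (- real q))"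
      using A by (simp add: powr_mult two_pow_powr powr_powr powr_minus_divide)
    also have "2 powr (real q * (2 - r)) * 2 powr (real q / 2) * 2 powr (real j * (r - 3))
       = 2 powr (- real q / 2) * 2 powr (- (3 - r) * real ?k)"
      unfolding powr_add[symmetric] k by (intro arg_cong[where f="\<lambda>x. 2 powr x"]) (simp add: field_simps)
    also have "2 powr (real q * (2 - r / 2)) * 2 powr (real j * (r - 3) / 2) * 2 powr (- real q)
       = 2 powr (- real q / 2) * 2 powr (- (3 - r) / 2 * real ?k)"
      unfolding powr_add[symmetric] k by (intro arg_cong[where f="\<lambda>x. 2 powr x"]) (simp add: field_simps)
    also have "C * (V * (A powr (2 - r) * A powr r) * d q * (2 powr (- real q / 2) * 2 powr (- (3 - r) * real ?k)))
         + V * (A powr (2 - r / 2) * A powr (r / 2)) * d q * (2 powr (- real q / 2) * 2 powr (- (3 - r) / 2 * real ?k))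
      \<le> C\<^sup>2 * (V * A\<^sup>2 * d q * (2 powr (- real q / 2) * 2 powr (- (3 - r) / 2 * real ?k)))
         + C\<^sup>2 * (V * A\<^sup>2 * d q * (2 powr (- real q / 2) * 2 powr (- (3 - r) / 2 * real ?k)))"
      unfolding Asq
    proof (rule add_mono)
      \<comment> \<open>The contribution of the large values decays twice as fast as required; the
        other one sets the rate.\<close>
      have "- (3 - r) * real ?k \<le> - (3 - r) / 2 * real ?k" using r by (intro mult_right_mono) auto
      then show "C * (V * A\<^sup>2 * d q * (2 powr (- real q / 2) * 2 powr (- (3 - r) * real ?k)))
         \<le> C\<^sup>2 * (V * A\<^sup>2 * d q * (2 powr (- real q / 2) * 2 powr (- (3 - r) / 2 * real ?k)))"
        using V A C d_nonneg[of q] C2(2)[of 0] by (intro mult_mono[OF _ mult_left_mono[OF mult_left_mono[OF powr_mono]]]) auto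
      have "1 * (V * A\<^sup>2 * d q * (2 powr (- real q / 2) * 2 powr (- (3 - r) / 2 * real ?k)))
         \<le> C\<^sup>2 * (V * A\<^sup>2 * d q * (2 powr (- real q / 2) * 2 powr (- (3 - r) / 2 * real ?k)))"
        using V A d_nonneg[of q] C2(3)[of 0] by (intro mult_right_mono) auto
      then show "V * A\<^sup>2 * d q * (2 powr (- real q / 2) * 2 powr (- (3 - r) / 2 * real ?k))
         \<le> C\<^sup>2 * (V * A\<^sup>2 * d q * (2 powr (- real q / 2) * 2 powr (- (3 - r) / 2 * real ?k)))" by simp
    qed
    finally show ?thesis
      unfolding ratio_pow two_pow_powr by (simp add: powr_minus_divide mult_ac)
  qed
qed

lemma integrable_H2n: "integrable M (\<lambda>x. (\<Sum>j<J. h j x)\<^sup>2 * n q x)"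
proof (rule integrable_const_bound)
  have "(\<Sum>j<J. h j x)\<^sup>2 * n q x \<le> (\<Sum>j<J. C * A * 2 ^ j)\<^sup>2 * (C * sqrt 2 ^ q * d q)" for x
    using h_nonneg n_nonneg h_sup n_sup by (intro mult_mono power_mono sum_mono sum_nonneg) auto
  then show "AE x in M. norm ((\<Sum>j<J. h j x)\<^sup>2 * n q x) \<le> (\<Sum>j<J. C * A * 2 ^ j)\<^sup>2 * (C * sqrt 2 ^ q * d q)"
    using n_nonneg by (intro AE_I2) (simp add: abs_mult)
qed measurable

text \<open>All pieces are compared with the one shell \<open>q\<close>, so the weights are centred
  there, and the bound is uniform in the number of pieces.\<close>

lemma integral_H2n:
  "(LINT x|M. (\<Sum>j<J. h j x)\<^sup>2 * n q x) \<le> (2 / (1 - ratio))\<^sup>2 * (V * (2 * C\<^sup>2) * A\<^sup>2 * (d q / sqrt 2 ^ q))"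
proof -
  let ?B = "V * (2 * C\<^sup>2) * A\<^sup>2 * (d q / sqrt 2 ^ q)" and ?S = "2 / (1 - ratio)"
  have B0: "0 \<le> ?B" using V A d_nonneg[of q] by simp
  have S0: "0 \<le> ?S" using ratio by simp
  have "(LINT x|M. (\<Sum>j<J. h j x)\<^sup>2 * n q x) \<le> (LINT x|M. ?S * (\<Sum>j<J. (h j x)\<^sup>2 * n q x / ratio ^ ndist j q))"
  proof (rule integral_mono[OF integrable_H2n])
    fix x
    have "(\<Sum>j<J. h j x)\<^sup>2 * n q x \<le> ?S * (\<Sum>j<J. (h j x)\<^sup>2 / ratio ^ ndist j q) * n q x"
      by (intro mult_right_mono square_sum_weighted ratio n_nonneg)
    then show "(\<Sum>j<J. h j x)\<^sup>2 * n q x \<le> ?S * (\<Sum>j<J. (h j x)\<^sup>2 * n q x / ratio ^ ndist j q)"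
      by (simp add: sum_distrib_right mult.assoc)
  qed (intro Bochner_Integration.integrable_mult_right Bochner_Integration.integrable_sum
      Bochner_Integration.integrable_divide integrable_h2n impI)
  also have "\<dots> = ?S * (\<Sum>j<J. (LINT x|M. (h j x)\<^sup>2 * n q x) / ratio ^ ndist j q)"
    by (simp add: integrable_h2n Bochner_Integration.integral_sum)
  also have "\<dots> \<le> ?S * (\<Sum>j<J. ?B * ratio ^ ndist j q)"
  proof (intro mult_left_mono sum_mono S0)
    fix j
    have "(LINT x|M. (h j x)\<^sup>2 * n q x) / ratio ^ ndist j q \<le> ?B * (ratio ^ ndist j q)\<^sup>2 / ratio ^ ndist j q"
      using ratio by (intro divide_right_mono integral_h2n) auto
    then show "(LINT x|M. (h j x)\<^sup>2 * n q x) / ratio ^ ndist j q \<le> ?B * ratio ^ ndist j q"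
      using ratio by (simp add: power2_eq_square)
  qed
  also have "\<dots> = ?S * (?B * (\<Sum>j<J. ratio ^ ndist j q))"
    by (simp add: sum_distrib_left)
  also have "\<dots> \<le> ?S * (?B * ?S)"
    using ratio by (intro mult_left_mono sum_ndist_le S0 B0) auto
  finally show ?thesis by (simp add: power2_eq_square mult_ac)
qed

text \<open>In a product \<open>n p * n q\<close> with \<open>p \<le> q\<close>, the supremum of
  \<open>n p\<close> grows like \<open>sqrt 2 ^ p\<close>, whereas \<open>integral_H2n\<close> gains
  \<open>1 / sqrt 2 ^ q\<close>. The remaining kernel is geometric in \<open>q - p\<close>, and the
  Schur test sums it.\<close>

theorem integral_H2W2:
  "(LINT x|M. (\<Sum>j<J. h j x)\<^sup>2 * (\<Sum>q<K. n q x)\<^sup>2) \<le> V * shell_const r C * A\<^sup>2 * (\<Sum>q<K. (d q)\<^sup>2)"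
proof -
  let ?H = "\<lambda>x. (\<Sum>j<J. h j x)\<^sup>2"
  define E where "E = (2 / (1 - ratio))\<^sup>2 * (V * (2 * C\<^sup>2) * A\<^sup>2)"
  have E0: "0 \<le> E" using V by (simp add: E_def)
  have s2: "0 < 1 / sqrt (2::real)" "1 / sqrt (2::real) < 1" by auto
  let ?N = "\<lambda>q. \<Sum>p\<le>q. C * sqrt 2 ^ p * d p"
  have "(LINT x|M. ?H x * (\<Sum>q<K. n q x)\<^sup>2) \<le> (LINT x|M. 2 * (\<Sum>q<K. ?N q * (?H x * n q x)))"
  proof (rule integral_mono)
    show "integrable M (\<lambda>x. ?H x * (\<Sum>q<K. n q x)\<^sup>2)"
    proof (rule integrable_const_bound)
      have "?H x * (\<Sum>q<K. n q x)\<^sup>2 \<le> (\<Sum>j<J. C * A * 2 ^ j)\<^sup>2 * (\<Sum>q<K. C * sqrt 2 ^ q * d q)\<^sup>2" for x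
        using h_nonneg n_nonneg h_sup n_sup by (intro mult_mono power_mono sum_mono sum_nonneg) auto
      then show "AE x in M. norm (?H x * (\<Sum>q<K. n q x)\<^sup>2) \<le> (\<Sum>j<J. C * A * 2 ^ j)\<^sup>2 * (\<Sum>q<K. C * sqrt 2 ^ q * d q)\<^sup>2"
        by (intro AE_I2) simp
    qed measurable
    fix x
    have "(\<Sum>q<K. n q x)\<^sup>2 \<le> 2 * (\<Sum>q<K. (\<Sum>p\<le>q. n p x) * n q x)"
      by (rule square_sum_triangular[OF n_nonneg])
    also have "\<dots> \<le> 2 * (\<Sum>q<K. ?N q * n q x)"
      by (intro mult_left_mono sum_mono mult_right_mono n_sup n_nonneg) auto
    finally have "?H x * (\<Sum>q<K. n q x)\<^sup>2 \<le> ?H x * (2 * (\<Sum>q<K. ?N q * n q x))"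
      by (intro mult_left_mono) auto
    then show "?H x * (\<Sum>q<K. n q x)\<^sup>2 \<le> 2 * (\<Sum>q<K. ?N q * (?H x * n q x))"
      by (simp add: sum_distrib_left mult_ac)
  qed (intro Bochner_Integration.integrable_mult_right Bochner_Integration.integrable_sum integrable_H2n impI)
  also have "\<dots> = 2 * (\<Sum>q<K. ?N q * (LINT x|M. ?H x * n q x))"
    by (simp add: integrable_H2n Bochner_Integration.integral_sum)
  also have "\<dots> \<le> 2 * (\<Sum>q<K. ?N q * (E * (d q / sqrt 2 ^ q)))"
    unfolding E_def using integral_H2n C d_nonneg
    by (intro mult_left_mono sum_mono sum_nonneg) (auto simp: mult.assoc)
  also have "\<dots> = 2 * C * E * (\<Sum>q<K. \<Sum>p\<le>q. (1 / sqrt 2) ^ (q - p) * (d p * d q))"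
  proof -
    have "C * sqrt 2 ^ p * d p * (E * (d q / sqrt 2 ^ q)) = C * E * ((1 / sqrt 2) ^ (q - p) * (d p * d q))"
      if "p \<le> q" for p q
    proof -
      have "sqrt 2 ^ q = sqrt 2 ^ p * (sqrt 2 ^ (q - p) :: real)" using that by (simp flip: power_add)
      then show ?thesis by (simp add: power_one_over field_simps)
    qed
    then have "(\<Sum>q<K. ?N q * (E * (d q / sqrt 2 ^ q))) = (\<Sum>q<K. \<Sum>p\<le>q. C * E * ((1 / sqrt 2) ^ (q - p) * (d p * d q)))"
      unfolding sum_distrib_right by (intro sum.cong refl) auto
    then show ?thesis by (simp only: sum_distrib_left mult.assoc)
  qed
  also have "\<dots> \<le> 2 * C * E * (2 / (1 - 1 / sqrt 2) * (\<Sum>q<K. (d q)\<^sup>2))"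
    using schur_triangular[of "1 / sqrt 2" d K] s2 d_nonneg C E0 by (intro mult_left_mono) auto
  finally show ?thesis by (simp add: E_def shell_const_def mult_ac)
qed

end

section \<open>Littlewood-Paley projections\<close>

lemma fmult_sum_symbol:
  "fmult L (\<lambda>k. \<Sum>i\<in>I. m i k) S f x = (\<Sum>i\<in>I. fmult L (m i) S f x)"
proof -
  have "fmult L (\<lambda>k. \<Sum>i\<in>I. m i k) S f x = (\<Sum>k\<in>S. \<Sum>i\<in>I. of_real (m i k) * fc L f k * expw L k x)"
    by (simp add: fmult_def tp_def sum_distrib_right)
  also have "\<dots> = (\<Sum>i\<in>I. fmult L (m i) S f x)"
    unfolding fmult_def tp_def by (rule sum.swap)
  finally show ?thesis .
qed

text \<open>An even symbol preserves the symmetry \<open>fc_of_real_minus\<close> of the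
  coefficients of a real function, so the real part in \<open>lp_proj\<close> loses nothing.\<close>

lemma fmult_of_real:
  assumes even: "\<And>k. m (- k) = m k"
  shows "complex_of_real (Re (fmult L m (fbox n) (\<lambda>x. complex_of_real (g x)) x)) = fmult L m (fbox n) (\<lambda>x. complex_of_real (g x)) x"
proof -
  let ?c = "\<lambda>k. complex_of_real (m k) * fc L (\<lambda>x. complex_of_real (g x)) k * expw L k x"
  have "cnj (\<Sum>k\<in>fbox n. ?c k) = (\<Sum>k\<in>fbox n. ?c (- k))"
    by (simp add: even fc_of_real_minus expw_minus)
  also have "\<dots> = (\<Sum>k\<in>fbox n. ?c k)"
    by (rule sum.reindex_bij_witness[of _ uminus uminus]) auto
  finally have "(\<Sum>k\<in>fbox n. ?c k) \<in> \<real>" by (simp only: Reals_cnj_iff)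
  then show ?thesis unfolding fmult_def tp_def by (rule of_real_Re)
qed

context
  fixes chi :: "real^3 \<Rightarrow> real"
  assumes chi: "lp_cutoff chi"
begin

lemma chi_minus: "chi (- \<xi>) = chi \<xi>"
  using chi unfolding lp_cutoff_def by (metis norm_minus_cancel)

lemma chi_one: "norm \<xi> \<le> 3 / 4 \<Longrightarrow> chi \<xi> = 1"
  and chi_zero: "1 \<le> norm \<xi> \<Longrightarrow> chi \<xi> = 0"
  using chi unfolding lp_cutoff_def by blast+

lemma chi_bounded: "\<exists>B. \<forall>\<xi>. \<bar>chi \<xi>\<bar> \<le> B"
proof -
  have "smooth_on UNIV chi" using chi by (simp add: lp_cutoff_def)
  then have "Ck_on 0 UNIV chi" unfolding smooth_on_def by blast
  then have "continuous_on (cball 0 1) chi" by (auto intro: continuous_on_subset)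
  then have "bounded (chi ` cball 0 1)"
    by (intro compact_imp_bounded compact_continuous_image) auto
  then obtain B where B: "\<And>\<xi>. \<xi> \<in> cball 0 1 \<Longrightarrow> \<bar>chi \<xi>\<bar> \<le> B"
    unfolding bounded_iff real_norm_def by blast
  have "\<bar>chi \<xi>\<bar> \<le> max B 0" for \<xi>
    using B[of \<xi>] chi_zero[of \<xi>] by (cases "norm \<xi> \<le> 1") auto
  then show ?thesis by blast
qed

lemma lp_symbol_nonneg:
  assumes "0 \<le> p"
  shows "lp_symbol chi p \<xi> = chi (\<xi> /\<^sub>R 2 ^ nat (p + 1)) - chi (\<xi> /\<^sub>R 2 ^ nat p)"
proof -
  have 1: "(2::real) powi (- p) = inverse (2 ^ nat p)"
    using assms by (simp only: power_int_minus) (simp add: power_int_def)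
  have "nat (p + 1) = Suc (nat p)" using assms by simp
  then show ?thesis using assms by (simp add: lp_symbol_def Let_def 1 mult.commute)
qed

lemma lp_symbol_minus: "lp_symbol chi p (- \<xi>) = lp_symbol chi p \<xi>"
  by (simp add: lp_symbol_def Let_def chi_minus)

lemma lp_symbol_zero:
  assumes "-1 \<le> p" "2 ^ nat (p + 1) \<le> norm \<xi>"
  shows "lp_symbol chi p \<xi> = 0"
proof (cases "p = -1")
  case True
  then show ?thesis using assms by (simp add: lp_symbol_def chi_zero)
next
  case False
  then have p: "0 \<le> p" using assms by simp
  have "2 ^ nat p \<le> (2::real) ^ nat (p + 1)" by (intro power_increasing) auto
  then have "2 ^ nat p \<le> norm \<xi>" using assms(2) by (rule order_trans)
  then show ?thesis
    unfolding lp_symbol_nonneg[OF p] using assms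
    by (simp add: chi_zero field_simps)
qed

lemma lp_symbol_freq_zero:
  assumes "-1 \<le> p" "k \<notin> fbox (2 ^ nat (p + 1))"
  shows "lp_symbol chi p (freq k) = 0"
proof (rule lp_symbol_zero[OF assms(1)])
  have "\<not> norm (freq k) \<le> 2 ^ nat (p + 1)"
    using assms(2) norm_freq_in_fbox[of k "2 ^ nat (p + 1)"] by auto
  then show "2 ^ nat (p + 1) \<le> norm (freq k)" by (rule less_imp_le[OF not_le_imp_less])
qed

text \<open>The symbols telescope, leaving a single cutoff at scale
  \<open>2 ^ (q + 1)\<close>.\<close>

lemma sum_lp_symbol:
  assumes "-1 \<le> q"
  shows "(\<Sum>p\<in>{-1..q}. lp_symbol chi p \<xi>) = chi (\<xi> /\<^sub>R 2 ^ nat (q + 1))"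
  using assms
proof (induction q rule: int_ge_induct)
  case base
  then show ?case by (simp add: lp_symbol_def)
next
  case (step q)
  have "{-1..q + 1} = insert (q + 1) {-1..q}" using step by auto
  then show ?case using step by (simp add: lp_symbol_nonneg)
qed

text \<open>The infinite sum reduces to the support of the symbol. Any larger box is allowed, so
  that all pieces of a low-pass sum can be written over the same frequencies.\<close>

lemma lp_proj_eq:
  assumes p: "-1 \<le> p" and n: "2 ^ nat (p + 1) \<le> n"
  shows "complex_of_real (lp_proj L chi p g x $ j)
    = fmult L (\<lambda>k. lp_symbol chi p (freq k)) (fbox n) (\<lambda>x. complex_of_real (g x $ j)) x"
proof -
  let ?s = "\<lambda>k. lp_symbol chi p (freq k)"
  let ?f = "\<lambda>k. fourier_coeff L g k $ j * complex_of_real (?s k) * cis ((2 * pi / L) * (freq k \<bullet> x))"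
  have "infsum ?f UNIV = infsum ?f (fbox n)"
    by (rule infsum_cong_neutral) (use lp_symbol_freq_zero[OF p] fbox_mono[OF n] in auto)
  also have "\<dots> = fmult L ?s (fbox n) (\<lambda>x. complex_of_real (g x $ j)) x"
    by (simp add: fmult_def tp_def fourier_coeff_eq_fc expw_def mult_ac)
  finally have "lp_proj L chi p g x $ j = Re (fmult L ?s (fbox n) (\<lambda>x. complex_of_real (g x $ j)) x)"
    by (simp add: lp_proj_def)
  then show ?thesis
    by (simp only: fmult_of_real[of ?s, OF lp_symbol_minus[of p "freq k" for k, folded freq_minus]])
qed

lemma lp_low_eq:
  assumes q: "-1 \<le> q"
  shows "complex_of_real (lp_low L chi q g x $ j)
    = fmult L (\<lambda>k. chi (freq k /\<^sub>R 2 ^ nat (q + 1))) (fbox (2 ^ nat (q + 1))) (\<lambda>x. complex_of_real (g x $ j)) x"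
proof -
  have "complex_of_real (lp_low L chi q g x $ j) = (\<Sum>p\<in>{-1..q}. complex_of_real (lp_proj L chi p g x $ j))"
    by (simp add: lp_low_def)
  also have "\<dots> = (\<Sum>p\<in>{-1..q}. fmult L (\<lambda>k. lp_symbol chi p (freq k)) (fbox (2 ^ nat (q + 1))) (\<lambda>x. complex_of_real (g x $ j)) x)"
    by (intro sum.cong refl lp_proj_eq power_increasing) auto
  also have "\<dots> = fmult L (\<lambda>k. \<Sum>p\<in>{-1..q}. lp_symbol chi p (freq k)) (fbox (2 ^ nat (q + 1))) (\<lambda>x. complex_of_real (g x $ j)) x"
    by (rule fmult_sum_symbol[symmetric])
  finally show ?thesis by (simp only: sum_lp_symbol[OF q])
qed

end

section \<open>Bernstein and Nikolskii inequalities\<close>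

definition tpv :: "real \<Rightarrow> (int^3 \<Rightarrow> complex^3) \<Rightarrow> (int^3) set \<Rightarrow> real^3 \<Rightarrow> complex^3" where
  "tpv L c S x = (\<chi> j. tp L (\<lambda>k. c k $ j) S x)"

lemma norm_vec_squared: "(norm v)\<^sup>2 = (\<Sum>j\<in>UNIV. (norm (v $ j))\<^sup>2)"
  for v :: "'a::real_normed_vector ^ 'n"
  by (simp add: norm_vec_def L2_set_def sum_nonneg)

lemma tpv_eq_sum: "tpv L c S x = (\<Sum>k\<in>S. \<chi> j. c k $ j * expw L k x)"
  by (simp add: tpv_def tp_def vec_eq_iff sum_component)

text \<open>Cauchy-Schwarz over the frequencies. Together with \<open>card_shell_le\<close> this is
  the Bernstein inequality from \<open>L^2\<close> to the supremum on a shell.\<close>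

lemma norm_tpv_le:
  assumes "finite S"
  shows "norm (tpv L c S x) \<le> sqrt (real (card S)) * sqrt (\<Sum>k\<in>S. (norm (c k))\<^sup>2)"
proof -
  have n: "norm (\<chi> j. c k $ j * expw L k x) = norm (c k)" for k
    by (simp add: norm_vec_def norm_mult)
  have "norm (tpv L c S x) \<le> (\<Sum>k\<in>S. norm (c k))"
    unfolding tpv_eq_sum by (rule order_trans[OF norm_sum]) (simp add: n)
  also have "\<dots> = (\<Sum>k\<in>S. 1 * norm (c k))" by simp
  also have "\<dots> \<le> sqrt (real (card S) * (\<Sum>k\<in>S. (norm (c k))\<^sup>2))"
    using Cauchy_Schwarz_ineq_sum[of "\<lambda>_. 1" "\<lambda>k. norm (c k)" S] by (intro real_le_rsqrt) simp
  finally show ?thesis by (simp add: real_sqrt_mult)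
qed

lemma tpv_borel [measurable]: "tpv L c S \<in> borel_measurable borel"
  unfolding tpv_def[abs_def] by (intro borel_measurable_continuous_onI continuous_intros)

lemma sqint_tpv: "finite S \<Longrightarrow> sqint (torus L) (tpv L c S)"
  by (rule finite_measure.sqint_bounded[OF finite_measure_torus borel_measurable_torus[OF tpv_borel] norm_tpv_le])

lemma l2_tpv:
  assumes "0 < L" "finite S"
  shows "(LINT x|torus L. (norm (tpv L c S x))\<^sup>2) = L ^ 3 * (\<Sum>k\<in>S. (norm (c k))\<^sup>2)"
proof -
  have "(LINT x|torus L. (norm (tpv L c S x))\<^sup>2) = (\<Sum>j\<in>UNIV. LINT x|torus L. (norm (tp L (\<lambda>k. c k $ j) S x))\<^sup>2)"
    unfolding norm_vec_squared tpv_def vec_lambda_beta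
    by (intro Bochner_Integration.integral_sum sqint_integrable sqint_tp)
  also have "\<dots> = (\<Sum>j\<in>UNIV. L ^ 3 * (\<Sum>k\<in>S. (norm (c k $ j))\<^sup>2))"
    by (simp add: l2_tp[OF assms] flip: l2_squared)
  also have "\<dots> = L ^ 3 * (\<Sum>k\<in>S. (norm (c k))\<^sup>2)"
    unfolding norm_vec_squared by (simp add: sum.swap[of _ UNIV S] flip: sum_distrib_left)
  finally show ?thesis .
qed

lemma tp_mult_tp:
  "\<exists>d. \<forall>x. tp L b (fbox m) x * tp L c (fbox n) x = tp L d (fbox (m + n)) x"
proof (intro exI allI)
  fix x
  let ?d = "\<lambda>i. \<Sum>k\<in>fbox m. \<Sum>l\<in>fbox n. if i = k + l then b k * c l else 0"
  have "tp L ?d (fbox (m + n)) x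
    = (\<Sum>i\<in>fbox (m + n). \<Sum>k\<in>fbox m. \<Sum>l\<in>fbox n. if i = k + l then b k * c l * expw L i x else 0)"
    unfolding tp_def sum_distrib_right by (intro sum.cong refl) auto
  also have "\<dots> = (\<Sum>k\<in>fbox m. \<Sum>l\<in>fbox n. \<Sum>i\<in>fbox (m + n). if i = k + l then b k * c l * expw L i x else 0)"
    by (rule trans[OF sum.swap], rule sum.cong[OF refl sum.swap])
  also have "\<dots> = (\<Sum>k\<in>fbox m. \<Sum>l\<in>fbox n. b k * c l * expw L (k + l) x)"
    by (intro sum.cong refl) (simp add: fbox_add)
  also have "\<dots> = tp L b (fbox m) x * tp L c (fbox n) x"
    unfolding tp_def sum_product expw_add by (intro sum.cong refl) (simp add: mult_ac)
  finally show "tp L b (fbox m) x * tp L c (fbox n) x = tp L ?d (fbox (m + n)) x" by simp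
qed

lemma norm_tp_le_l2:
  assumes "0 < L" "finite S"
  shows "L ^ 3 * (norm (tp L c S x))\<^sup>2 \<le> real (card S) * (l2 (torus L) (tp L c S))\<^sup>2"
proof -
  have "(norm (tp L c S x))\<^sup>2 \<le> (\<Sum>k\<in>S. 1 * norm (c k))\<^sup>2"
    using norm_tp_le[of L c S x] by (intro power_mono) auto
  also have "\<dots> \<le> real (card S) * (\<Sum>k\<in>S. (norm (c k))\<^sup>2)"
    using Cauchy_Schwarz_ineq_sum[of "\<lambda>_. 1" "\<lambda>k. norm (c k)" S] by simp
  finally have "L ^ 3 * (norm (tp L c S x))\<^sup>2 \<le> L ^ 3 * (real (card S) * (\<Sum>k\<in>S. (norm (c k))\<^sup>2))"
    using assms by (intro mult_left_mono) auto
  then show ?thesis unfolding l2_tp[OF assms] by (simp add: mult_ac)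
qed

text \<open>
  The square of a trigonometric polynomial is again one, so its supremum is controlled by its
  \<open>L\<^sup>2\<close> norm, that is, by \<open>\<integral> \<bar>T\<bar>\<^sup>4 \<le> sup \<bar>T\<bar>\<^bsup>4 - r\<^esup> \<integral> \<bar>T\<bar>\<^bsup>r\<^esup>\<close>.
\<close>

lemma nikolskii:
  assumes L: "0 < L" and r: "0 < r" "r < 4"
  shows "L ^ 3 * norm (tp L c (fbox N) x) powr r
     \<le> real ((4 * N + 1) ^ 3) * (LINT x|torus L. norm (tp L c (fbox N) x) powr r)"
proof -
  define T where "T = tp L c (fbox N)"
  define I where "I = (LINT x|torus L. norm (T x) powr r)"
  define s where "s = (SUP x. norm (T x))"
  have bdd: "bdd_above (range (\<lambda>x. norm (T x)))"
    using norm_tp_le[of L c "fbox N"] by (auto simp: T_def intro!: bdd_aboveI)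
  have le_s: "norm (T x) \<le> s" for x
    unfolding s_def by (rule cSUP_upper[OF UNIV_I bdd])
  have s0: "0 \<le> s" using order_trans[OF norm_ge_zero le_s] .
  have T_meas [measurable]: "T \<in> borel_measurable (torus L)"
    unfolding T_def by (intro borel_measurable_torus tp_borel)
  have Tint: "integrable (torus L) (\<lambda>x. norm (T x) powr r)"
    by (rule finite_measure.integrable_const_bound[OF finite_measure_torus, where B="s powr r"])
       (use le_s r in \<open>auto intro!: AE_I2 powr_mono2\<close>)
  let ?n = "real ((4 * N + 1) ^ 3)"
  obtain d where d: "\<And>x. T x * T x = tp L d (fbox (N + N)) x"
    using tp_mult_tp[of L c N c N] unfolding T_def by blast
  have four: "L ^ 3 * norm (T x) ^ 4 \<le> ?n * (s powr (4 - r) * I)" for x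
  proof -
    have "L ^ 3 * norm (T x) ^ 4 = L ^ 3 * (norm (tp L d (fbox (N + N)) x))\<^sup>2"
      unfolding d[symmetric] norm_mult by (simp add: power2_eq_square power4_eq_xxxx mult.assoc)
    \<comment> \<open>The square lives on \<open>fbox (2 N)\<close>, which has
      \<open>(4 N + 1) ^ 3\<close> points.\<close>
    also have "\<dots> \<le> ?n * (l2 (torus L) (tp L d (fbox (N + N))))\<^sup>2"
      using norm_tp_le_l2[OF L finite_fbox, of d "N + N" x] by (simp add: card_fbox)
    also have "(l2 (torus L) (tp L d (fbox (N + N))))\<^sup>2 = (LINT x|torus L. norm (T x) ^ 4)"
      unfolding l2_squared d[symmetric] norm_mult by (simp add: power2_eq_square power4_eq_xxxx mult.assoc)
    also have "(LINT x|torus L. norm (T x) ^ 4) \<le> (LINT x|torus L. s powr (4 - r) * norm (T x) powr r)"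
    proof (rule integral_mono)
      show "integrable (torus L) (\<lambda>x. norm (T x) ^ 4)"
        by (rule finite_measure.integrable_const_bound[OF finite_measure_torus, where B="s ^ 4"])
           (use le_s in \<open>auto intro!: AE_I2 power_mono\<close>)
      show "norm (T x) ^ 4 \<le> s powr (4 - r) * norm (T x) powr r" for x
      proof (cases "norm (T x) = 0")
        case False
        then have "norm (T x) ^ 4 = norm (T x) powr (4 - r) * norm (T x) powr r"
          by (simp add: powr_add[symmetric])
        also have "\<dots> \<le> s powr (4 - r) * norm (T x) powr r"
          using le_s r by (intro mult_right_mono powr_mono2) auto
        finally show ?thesis .
      qed simp
    qed (use Tint in simp)
    also have "\<dots> = s powr (4 - r) * I" by (simp add: I_def)
    finally show ?thesis by (simp add: mult_left_mono)
  qed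
  have "L ^ 3 * s powr r \<le> ?n * I"
  proof (cases "s = 0")
    case True
    have "0 \<le> I" by (simp add: I_def)
    then show ?thesis using True r by simp
  next
    case False
    then have s: "0 < s" using s0 by simp
    \<comment> \<open>No point attaining the supremum is chosen; a fourth root turns the pointwise
      bound into an upper bound of the range.\<close>
    have "L ^ 3 * s ^ 4 \<le> ?n * (s powr (4 - r) * I)"
    proof -
      let ?K = "?n * (s powr (4 - r) * I) / L ^ 3"
      have "norm (T x) \<le> root 4 ?K" for x
      proof -
        have "norm (T x) ^ 4 \<le> ?K" using four[of x] L by (simp add: pos_le_divide_eq mult.commute)
        then have "root 4 (norm (T x) ^ 4) \<le> root 4 ?K" by (intro real_root_le_mono) auto
        then show ?thesis by (simp add: real_root_power_cancel)
      qed
      then have "s \<le> root 4 ?K" unfolding s_def by (intro cSUP_least) auto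
      then have "s ^ 4 \<le> root 4 ?K ^ 4" using s0 by (intro power_mono)
      also have "\<dots> = ?K" using L by (intro real_root_pow_pos2) (auto simp: I_def)
      finally show ?thesis using L by (simp add: pos_le_divide_eq mult.commute)
    qed
    also have "s ^ 4 = s powr (4 - r) * s powr r" using s by (simp add: powr_add[symmetric])
    finally have "s powr (4 - r) * (L ^ 3 * s powr r) \<le> s powr (4 - r) * (?n * I)" by (simp add: mult_ac)
    then show ?thesis using s by simp
  qed
  moreover have "L ^ 3 * norm (T x) powr r \<le> L ^ 3 * s powr r"
    using le_s L r by (intro mult_left_mono powr_mono2) auto
  ultimately show ?thesis by (simp add: T_def I_def)
qed

text \<open>With radii \<open>2 ^ q - 1\<close> the shell consists of the frequencies whose largest
  component in modulus is at least \<open>2 ^ q\<close> and below \<open>2 ^ (q + 1)\<close>; the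
  zero frequency is in none. Sharp shells suffice for \<open>w\<close>, which enters only through
  Parseval and \<open>norm_tpv_le\<close>.\<close>

definition shell :: "nat \<Rightarrow> (int^3) set" where
  "shell q = fbox (2 ^ Suc q - 1) - fbox (2 ^ q - 1)"

lemma finite_shell [simp]: "finite (shell q)"
  by (simp add: shell_def)

lemma fbox_Suc_shell: "fbox (2 ^ Suc q - 1) = fbox (2 ^ q - 1) \<union> shell q" "fbox (2 ^ q - 1) \<inter> shell q = {}"
proof -
  have "(2::nat) ^ q - 1 \<le> 2 ^ Suc q - 1" by simp
  from fbox_mono[OF this] show "fbox (2 ^ Suc q - 1) = fbox (2 ^ q - 1) \<union> shell q"
    by (auto simp: shell_def)
qed (auto simp: shell_def)

lemma norm_freq_shell: "k \<in> shell q \<Longrightarrow> 2 ^ q \<le> norm (freq k)"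
proof -
  assume "k \<in> shell q"
  then obtain i where "\<not> \<bar>k $ i\<bar> \<le> int (2 ^ q - 1)" by (auto simp: shell_def fbox_def)
  then have "int (2 ^ q) \<le> \<bar>k $ i\<bar>" by (simp add: of_nat_diff)
  then have "real_of_int (int (2 ^ q)) \<le> \<bar>freq k $ i\<bar>" unfolding freq_nth by linarith
  also have "\<dots> \<le> norm (freq k)" by (rule component_le_norm_cart)
  finally show ?thesis by simp
qed

text \<open>The constant is \<open>5 ^ 3\<close>, from
  \<open>4 * 2 ^ q + 1 \<le> 5 * 2 ^ q\<close>.\<close>

lemma card_shell_le: "real (card (shell q)) \<le> 125 * 8 ^ q"
proof -
  have "card (shell q) \<le> card (fbox (2 ^ Suc q))"
    by (intro card_mono) (use fbox_mono[of "2 ^ Suc q - 1" "2 ^ Suc q"] in \<open>auto simp: shell_def\<close>)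
  also have "\<dots> = (4 * 2 ^ q + 1) ^ 3" by (simp add: card_fbox)
  also have "\<dots> \<le> (5 * 2 ^ q) ^ 3" by (intro power_mono) auto
  also have "\<dots> = 125 * 8 ^ q"
  proof -
    have "((2::nat) ^ q) ^ 3 = (2 ^ 3) ^ q" by (simp only: power_mult[symmetric] mult.commute)
    then show ?thesis by (simp add: power_mult_distrib)
  qed
  finally have "real (card (shell q)) \<le> real (125 * 8 ^ q)" by (simp only: of_nat_le_iff)
  then show ?thesis by simp
qed

text \<open>\<open>fbox (2 ^ 0 - 1)\<close> is \<open>{0}\<close>, which belongs to no shell; hence
  the assumption at \<open>0\<close>.\<close>

lemma sum_shells:
  fixes f :: "int^3 \<Rightarrow> 'b::comm_monoid_add"
  assumes "f 0 = 0"
  shows "(\<Sum>k\<in>fbox (2 ^ K - 1). f k) = (\<Sum>q<K. \<Sum>k\<in>shell q. f k)"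
proof (induction K)
  case 0
  have "fbox (2 ^ 0 - 1) = {0}" by (auto simp: fbox_def vec_eq_iff)
  then show ?case using assms by simp
next
  case (Suc K)
  show ?case
    unfolding fbox_Suc_shell(1) using fbox_Suc_shell(2) Suc by (simp add: sum.union_disjoint)
qed

text \<open>The value 2187 is \<open>3 * 9 ^ 3\<close>: \<open>nikolskii\<close> on
  \<open>fbox (2 ^ (j + 1))\<close> brings the factor
  \<open>(4 * 2 ^ (j + 1) + 1) ^ 3 \<le> (9 * 2 ^ j) ^ 3\<close>, and a vector has three
  components.\<close>

definition core_const :: "real \<Rightarrow> real" where
  "core_const r = shell_const r 2187"

text \<open>Multiplication by the high pieces is bounded from \<open>H^1\<close> to
  \<open>L^2\<close> with norm of order \<open>A\<close>. In \<open>shell_estimate\<close>,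
  \<open>h j\<close> becomes the modulus of a piece and \<open>d q\<close> becomes
  \<open>2 ^ q\<close> times the \<open>l^2\<close> norm of the coefficients in
  \<open>shell q\<close>.\<close>

theorem core_estimate:
  fixes b :: "nat \<Rightarrow> int^3 \<Rightarrow> complex^3" and c :: "int^3 \<Rightarrow> complex^3"
  assumes L: "0 < L" and r: "2 < r" "r < 3" and A: "0 < A" and c0: "c 0 = 0"
    and b: "\<And>j. (LINT x|torus L. norm (tpv L (b j) (fbox (2 ^ Suc j)) x) powr r) \<le> L ^ 3 * A powr r * 2 powr (real j * (r - 3))"
  shows "(LINT x|torus L. (\<Sum>j<J. norm (tpv L (b j) (fbox (2 ^ Suc j)) x))\<^sup>2 * (norm (tpv L c (fbox (2 ^ K - 1)) x))\<^sup>2)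
     \<le> L ^ 3 * core_const r * A\<^sup>2 * (\<Sum>k\<in>fbox (2 ^ K - 1). (norm (freq k))\<^sup>2 * (norm (c k))\<^sup>2)"
proof -
  interpret finite_measure "torus L" by (rule finite_measure_torus)
  define h where "h j x = norm (tpv L (b j) (fbox (2 ^ Suc j)) x)" for j x
  define n where "n q x = norm (tpv L c (shell q) x)" for q x
  define e where "e q = sqrt (\<Sum>k\<in>shell q. (norm (c k))\<^sup>2)" for q
  have hb: "\<exists>B. \<forall>x. h j x \<le> B" for j
    unfolding h_def using norm_tpv_le[OF finite_fbox] by blast
  have h_meas: "h j \<in> borel_measurable (torus L)" for j
    unfolding h_def[abs_def] by (rule measurable_compose[OF borel_measurable_torus[OF tpv_borel] borel_measurable_norm])
  have n_meas: "n j \<in> borel_measurable (torus L)" for j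
    unfolding n_def[abs_def] by (rule measurable_compose[OF borel_measurable_torus[OF tpv_borel] borel_measurable_norm])
  have h0: "0 \<le> h j x" for j x by (simp add: h_def)
  have hint: "integrable (torus L) (\<lambda>x. h j x powr r)" for j
  proof -
    obtain B where B: "\<And>x. h j x \<le> B" using hb[of j] by blast
    show ?thesis
      by (rule integrable_const_bound[where B="B powr r"])
         (use B r h_meas[of j] h0 in \<open>auto intro!: AE_I2 powr_mono2\<close>)
  qed
  have h_sup: "h j x \<le> 2187 * A * 2 ^ j" for j x
  proof -
    have comp: "norm (tpv L (b j) (fbox (2 ^ Suc j)) x $ i) \<le> 729 * A * 2 ^ j" for i
    proof (rule ccontr)
      let ?T = "tp L (\<lambda>k. b j k $ i) (fbox (2 ^ Suc j))"
      assume "\<not> ?thesis"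
      then have gt: "729 * A * 2 ^ j < norm (?T x)" by (simp add: tpv_def)
      have "L ^ 3 * norm (?T x) powr r \<le> real ((4 * 2 ^ Suc j + 1) ^ 3) * (LINT x|torus L. norm (?T x) powr r)"
        by (rule nikolskii) (use r L in auto)
      also have "\<dots> \<le> (9 * 2 ^ j) ^ 3 * (L ^ 3 * A powr r * 2 powr (real j * (r - 3)))"
      proof (rule mult_mono)
        have "real (4 * 2 ^ Suc j + 1) \<le> 9 * 2 ^ j" by simp
        from power_mono[OF this, of 3] show "real ((4 * 2 ^ Suc j + 1) ^ 3) \<le> (9 * 2 ^ j) ^ 3" by simp
        have "(LINT x|torus L. norm (?T x) powr r) \<le> (LINT x|torus L. h j x powr r)"
        proof (rule integral_mono_AE'[OF hint])
          have "norm (?T x) \<le> h j x" for x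
            using Finite_Cartesian_Product.norm_nth_le[of "tpv L (b j) (fbox (2 ^ Suc j)) x" i] by (simp add: h_def tpv_def)
          then show "AE x in torus L. norm (?T x) powr r \<le> h j x powr r"
            using r by (intro AE_I2 powr_mono2) auto
        qed auto
        then show "(LINT x|torus L. norm (?T x) powr r) \<le> L ^ 3 * A powr r * 2 powr (real j * (r - 3))"
          using b[of j] by (simp add: h_def)
      qed auto
      also have "\<dots> = L ^ 3 * (729 * (A powr r * (2 powr (real j * 3) * 2 powr (real j * (r - 3)))))"
      proof -
        have "(9 * (2::real) ^ j) ^ 3 = 729 * 2 ^ (j * 3)" by (simp add: power_mult_distrib power_mult)
        also have "\<dots> = 729 * 2 powr (real j * 3)" by (simp add: powr_realpow[symmetric])
        finally show ?thesis by (simp only: mult_ac)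
      qed
      \<comment> \<open>The order \<open>2 ^ (3 j)\<close> of the number of frequencies turns the
        decay of the integral into the growth \<open>(2 ^ j) powr r\<close>.\<close>
      also have "2 powr (real j * 3) * 2 powr (real j * (r - 3)) = (2 ^ j) powr r"
        by (simp add: powr_realpow[symmetric] powr_powr powr_add[symmetric] algebra_simps)
      also have "729 * (A powr r * (2 ^ j) powr r) \<le> 729 powr r * (A powr r * (2 ^ j) powr r)"
        using powr_mono[of 1 r 729] r by (intro mult_right_mono) auto
      also have "\<dots> = (729 * A * 2 ^ j) powr r" using A by (simp add: powr_mult)
      finally have "norm (?T x) powr r \<le> (729 * A * 2 ^ j) powr r" using L by (simp add: mult_left_mono)
      moreover have "(729 * A * 2 ^ j) powr r < norm (?T x) powr r"
        using gt r A by (intro powr_less_mono2) auto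
      ultimately show False by simp
    qed
    have "h j x \<le> (\<Sum>i\<in>UNIV. norm (tpv L (b j) (fbox (2 ^ Suc j)) x $ i))"
      unfolding h_def norm_vec_def by (rule L2_set_le_sum) simp
    also have "\<dots> \<le> (\<Sum>i\<in>(UNIV::3 set). 729 * A * 2 ^ j)" by (intro sum_mono comp)
    finally show ?thesis by simp
  qed
  have e0: "0 \<le> e q" for q by (simp add: e_def sum_nonneg)
  interpret shell_estimate "torus L" r A "L ^ 3" 2187 h n "\<lambda>q. 2 ^ q * e q"
  proof
    show "(LINT x|torus L. h j x powr r) \<le> L ^ 3 * A powr r * 2 powr (real j * (r - 3))" for j
      unfolding h_def by (rule b)
    show "n q x \<le> 2187 * sqrt 2 ^ q * (2 ^ q * e q)" for q x
    proof -
      have "n q x \<le> sqrt (real (card (shell q))) * e q"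
        unfolding n_def e_def by (rule norm_tpv_le) simp
      also have "\<dots> \<le> sqrt (125 * 8 ^ q) * e q"
        by (intro mult_right_mono e0 real_sqrt_le_mono card_shell_le)
      also have "sqrt (125 * 8 ^ q) \<le> 2187 * (sqrt 2 ^ q * 2 ^ q)"
      proof (rule real_le_lsqrt)
        have "(2187 * (sqrt 2 ^ q * 2 ^ q))\<^sup>2 = 2187\<^sup>2 * (8::real) ^ q"
          by (simp add: power_mult_distrib flip: power_mult power_even_eq)
             (simp add: power_mult mult.commute[of q] power_mult_distrib[symmetric])
        then show "125 * 8 ^ q \<le> (2187 * (sqrt 2 ^ q * (2::real) ^ q))\<^sup>2" by simp
      qed simp
      then have "sqrt (125 * 8 ^ q) * e q \<le> 2187 * (sqrt 2 ^ q * 2 ^ q) * e q"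
        by (intro mult_right_mono e0)
      finally show ?thesis by (simp add: mult_ac)
    qed
    show "(LINT x|torus L. (n q x)\<^sup>2) \<le> L ^ 3 * (2 ^ q * e q / 2 ^ q)\<^sup>2" for q
      unfolding n_def by (simp add: l2_tpv[OF L finite_shell] e_def sum_nonneg)
  qed (use r A L e0 h_meas n_meas h_sup in \<open>auto simp: h_def n_def\<close>)
  have split: "tpv L c (fbox (2 ^ K - 1)) x = (\<Sum>q<K. tpv L c (shell q) x)" for x
    unfolding tpv_eq_sum using c0 by (intro sum_shells) (simp add: vec_eq_iff)
  have "(LINT x|torus L. (\<Sum>j<J. h j x)\<^sup>2 * (norm (tpv L c (fbox (2 ^ K - 1)) x))\<^sup>2)
      \<le> (LINT x|torus L. (\<Sum>j<J. h j x)\<^sup>2 * (\<Sum>q<K. n q x)\<^sup>2)"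
  proof (rule integral_mono_AE')
    show "integrable (torus L) (\<lambda>x. (\<Sum>j<J. h j x)\<^sup>2 * (\<Sum>q<K. n q x)\<^sup>2)"
    proof (rule integrable_const_bound)
      have "(\<Sum>j<J. h j x)\<^sup>2 * (\<Sum>q<K. n q x)\<^sup>2 \<le> (\<Sum>j<J. 2187 * A * 2 ^ j)\<^sup>2 * (\<Sum>q<K. 2187 * sqrt 2 ^ q * (2 ^ q * e q))\<^sup>2" for x
        using h_nonneg n_nonneg h_sup n_sup by (intro mult_mono power_mono sum_mono sum_nonneg) auto
      then show "AE x in torus L. norm ((\<Sum>j<J. h j x)\<^sup>2 * (\<Sum>q<K. n q x)\<^sup>2)
          \<le> (\<Sum>j<J. 2187 * A * 2 ^ j)\<^sup>2 * (\<Sum>q<K. 2187 * sqrt 2 ^ q * (2 ^ q * e q))\<^sup>2"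
        by (intro AE_I2) simp
      show "(\<lambda>x. (\<Sum>j<J. h j x)\<^sup>2 * (\<Sum>q<K. n q x)\<^sup>2) \<in> borel_measurable (torus L)"
        using h_meas n_meas by (intro borel_measurable_times borel_measurable_power borel_measurable_sum)
    qed
    have "norm (tpv L c (fbox (2 ^ K - 1)) x) \<le> (\<Sum>q<K. n q x)" for x
      unfolding split n_def by (rule norm_sum)
    then show "AE x in torus L. (\<Sum>j<J. h j x)\<^sup>2 * (norm (tpv L c (fbox (2 ^ K - 1)) x))\<^sup>2
        \<le> (\<Sum>j<J. h j x)\<^sup>2 * (\<Sum>q<K. n q x)\<^sup>2"
      by (intro AE_I2 mult_left_mono power_mono) auto
  qed auto
  also have "\<dots> \<le> L ^ 3 * core_const r * A\<^sup>2 * (\<Sum>q<K. (2 ^ q * e q)\<^sup>2)"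
    unfolding core_const_def by (rule integral_H2W2)
  also have "\<dots> \<le> L ^ 3 * core_const r * A\<^sup>2 * (\<Sum>k\<in>fbox (2 ^ K - 1). (norm (freq k))\<^sup>2 * (norm (c k))\<^sup>2)"
  proof (rule mult_left_mono)
    have "(\<Sum>q<K. (2 ^ q * e q)\<^sup>2) \<le> (\<Sum>q<K. \<Sum>k\<in>shell q. (norm (freq k))\<^sup>2 * (norm (c k))\<^sup>2)"
    proof (rule sum_mono)
      fix q
      have "(2 ^ q * e q)\<^sup>2 = (\<Sum>k\<in>shell q. (2 ^ q)\<^sup>2 * (norm (c k))\<^sup>2)"
        by (simp add: power_mult_distrib e_def sum_nonneg sum_distrib_left)
      also have "\<dots> \<le> (\<Sum>k\<in>shell q. (norm (freq k))\<^sup>2 * (norm (c k))\<^sup>2)"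
        by (intro sum_mono mult_right_mono power_mono norm_freq_shell) auto
      finally show "(2 ^ q * e q)\<^sup>2 \<le> (\<Sum>k\<in>shell q. (norm (freq k))\<^sup>2 * (norm (c k))\<^sup>2)" .
    qed
    also have "\<dots> = (\<Sum>k\<in>fbox (2 ^ K - 1). (norm (freq k))\<^sup>2 * (norm (c k))\<^sup>2)"
      by (rule sum_shells[symmetric]) simp
    finally show "(\<Sum>q<K. (2 ^ q * e q)\<^sup>2) \<le> (\<Sum>k\<in>fbox (2 ^ K - 1). (norm (freq k))\<^sup>2 * (norm (c k))\<^sup>2)" .
    have "0 \<le> shell_const r 2187" using shell_const_pos[OF r, of 2187] by simp
    then show "0 \<le> L ^ 3 * core_const r * A\<^sup>2" using L by (simp add: core_const_def)
  qed
  finally show ?thesis by (simp add: h_def)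
qed

lemma core_const_pos: "2 < r \<Longrightarrow> r < 3 \<Longrightarrow> 0 < core_const r"
  by (simp add: core_const_def shell_const_pos)

section \<open>Trigonometric test fields\<close>

text \<open>A directional derivative of such a function has the same form with other coefficients,
  so the induction closes.\<close>

lemma Ck_on_trig:
  assumes "bounded_linear ph"
  shows "Ck_on k S (\<lambda>p. cos (ph p) *\<^sub>R a + sin (ph p) *\<^sub>R b)"
proof (induction k arbitrary: a b)
  case 0
  interpret bounded_linear ph by fact
  show ?case by (auto intro!: continuous_intros continuous_on)
next
  case (Suc k)
  interpret bounded_linear ph by fact
  have d: "((\<lambda>p. cos (ph p) *\<^sub>R a + sin (ph p) *\<^sub>R b) has_derivative
      (\<lambda>v. cos (ph x) *\<^sub>R (ph v *\<^sub>R b) + sin (ph x) *\<^sub>R (- ph v *\<^sub>R a))) (at x within S)" for x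
    by (auto intro!: derivative_eq_intros has_derivative ext simp: scaleR_left.diff algebra_simps)
  show ?case
    unfolding Ck_on.simps
    by (intro exI[of _ "\<lambda>x v. cos (ph x) *\<^sub>R (ph v *\<^sub>R b) + sin (ph x) *\<^sub>R (- ph v *\<^sub>R a)"] conjI ballI allI d Suc)
qed

lemma smooth_on_trig:
  "bounded_linear ph \<Longrightarrow> smooth_on S (\<lambda>p. cos (ph p) *\<^sub>R a + sin (ph p) *\<^sub>R b)"
  by (simp add: smooth_on_def Ck_on_trig)

text \<open>Test functions are real. Letting the amplitude \<open>a\<close> range over all complex
  numbers still recovers complex identities, by \<open>Re_mult_eq_zero\<close>.\<close>

definition wave :: "real \<Rightarrow> int^3 \<Rightarrow> complex \<Rightarrow> real^3 \<Rightarrow> real" where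
  "wave L k a x = Re (a * expw L k x)"

definition vwave :: "real \<Rightarrow> int^3 \<Rightarrow> complex^3 \<Rightarrow> vfield" where
  "vwave L k z x = (\<chi> j. Re (z $ j * expw L k x))"

lemma vwave_nth [simp]: "vwave L k z x $ j = wave L k (z $ j) x"
  by (simp add: vwave_def wave_def)

lemma wave_eq: "wave L k a = (\<lambda>x. cos ((2 * pi / L) * (freq k \<bullet> x)) *\<^sub>R Re a + sin ((2 * pi / L) * (freq k \<bullet> x)) *\<^sub>R (- Im a))"
  by (simp add: wave_def expw_def fun_eq_iff)

lemma vwave_eq: "vwave L k z = (\<lambda>x. cos ((2 * pi / L) * (freq k \<bullet> x)) *\<^sub>R (\<chi> j. Re (z $ j))
    + sin ((2 * pi / L) * (freq k \<bullet> x)) *\<^sub>R (\<chi> j. - Im (z $ j)))"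
  by (simp add: vwave_def expw_def fun_eq_iff vec_eq_iff mult.commute)

lemma bounded_linear_phase: "bounded_linear (\<lambda>x. c * (w \<bullet> x))" for w :: "'a::real_inner"
  by (intro bounded_linear_const_mult bounded_linear_inner_right)

lemma smooth_wave: "smooth_on S (wave L k a)"
  unfolding wave_eq by (rule smooth_on_trig[OF bounded_linear_phase])

lemma smooth_vwave_time: "smooth_on S (\<lambda>(s::real, x). vwave L k z x)"
proof -
  have "bounded_linear (\<lambda>p::real \<times> (real^3). (2 * pi / L) * (freq k \<bullet> snd p))"
    by (rule bounded_linear_compose[OF bounded_linear_phase bounded_linear_snd])
  from smooth_on_trig[OF this] show ?thesis by (simp add: vwave_eq case_prod_unfold)
qed

lemma periodic_wave: "L \<noteq> 0 \<Longrightarrow> periodic L (wave L k a)"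
  using periodic_expw[of L k] by (simp add: periodic_def wave_def)

lemma periodic_vwave: "L \<noteq> 0 \<Longrightarrow> periodic L (vwave L k z)"
  using periodic_expw[of L k] by (simp add: periodic_def vwave_def)

lemma continuous_wave [continuous_intros]: "continuous_on S (wave L k a)"
  unfolding wave_def[abs_def] by (intro continuous_intros)

lemma continuous_vwave [continuous_intros]: "continuous_on S (vwave L k z)"
  unfolding vwave_def[abs_def] by (intro continuous_intros)

lemma abs_wave_le: "\<bar>wave L k a x\<bar> \<le> norm a"
  unfolding wave_def using abs_Re_le_cmod[of "a * expw L k x"] by (simp add: norm_mult)

lemma pderiv_trig:
  "pderiv_x i (\<lambda>x. cos (c * (w \<bullet> x)) *\<^sub>R a + sin (c * (w \<bullet> x)) *\<^sub>R b) x
   = (c * w $ i) *\<^sub>R (cos (c * (w \<bullet> x)) *\<^sub>R b - sin (c * (w \<bullet> x)) *\<^sub>R a)"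
  unfolding pderiv_x_def
proof (rule vector_derivative_at)
  have e: "c * (w \<bullet> (x + h *\<^sub>R axis i 1)) = c * (w \<bullet> x) + h * (c * w $ i)" for h
    by (simp add: inner_add_right inner_axis algebra_simps)
  show "((\<lambda>h. cos (c * (w \<bullet> (x + h *\<^sub>R axis i 1))) *\<^sub>R a + sin (c * (w \<bullet> (x + h *\<^sub>R axis i 1))) *\<^sub>R b) has_vector_derivative
     (c * w $ i) *\<^sub>R (cos (c * (w \<bullet> x)) *\<^sub>R b - sin (c * (w \<bullet> x)) *\<^sub>R a)) (at 0)"
    unfolding e
    by (auto intro!: derivative_eq_intros simp: algebra_simps has_real_derivative_iff_has_vector_derivative[symmetric])
qed

lemma pderiv_wave: "pderiv_x i (wave L k a) x = wave L k (a * \<i> * of_real (2 * pi / L * of_int (k $ i))) x"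
  unfolding wave_eq pderiv_trig by (simp add: algebra_simps)

lemma pderiv_vwave: "pderiv_x i (vwave L k z) x = vwave L k (\<chi> j. z $ j * \<i> * of_real (2 * pi / L * of_int (k $ i))) x"
  unfolding vwave_eq pderiv_trig by (simp add: vec_eq_iff algebra_simps)

definition cof :: "vfield \<Rightarrow> 3 \<Rightarrow> real^3 \<Rightarrow> complex" where
  "cof g j x = complex_of_real (g x $ j)"

text \<open>The coefficient at \<open>- k\<close> without normalisation, which is what testing with
  waves of frequency \<open>k\<close> produces.\<close>

definition fI :: "real \<Rightarrow> (real^3 \<Rightarrow> complex) \<Rightarrow> int^3 \<Rightarrow> complex" where
  "fI L f k = (LINT x|torus L. f x * expw L k x)"

lemma fI_fc: "0 < L \<Longrightarrow> fI L f (- k) = of_real (L ^ 3) * fc L f k"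
  by (simp add: fI_def fc_def)

lemma fourier_coeff_cof: "fourier_coeff L g k $ j = fc L (cof g j) k"
  by (simp add: fourier_coeff_eq_fc cof_def[abs_def])

lemma L2_field_sqint: "L2_field L g \<Longrightarrow> sqint (torus L) g"
  by (simp add: L2_field_def sqint_def)

lemma sqint_cof: 
  assumes "L2_field L g" shows "sqint (torus L) (cof g j)"
proof (rule sqint_bound[OF L2_field_sqint[OF assms]])
  have gm: "g \<in> borel_measurable (torus L)" using assms by (simp add: L2_field_def)
  show "cof g j \<in> borel_measurable (torus L)"
    using measurable_compose[OF gm borel_measurable_continuous_onI[of "\<lambda>v. complex_of_real (v $ j)"]]
    unfolding cof_def[abs_def] by (simp add: continuous_intros)
qed (simp add: cof_def component_le_norm_cart)

lemma wave_mult_cof: "wave L k a x * g x $ j = Re (a * (cof g j x * expw L k x))"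
  by (simp add: wave_def cof_def algebra_simps)

lemma integral_wave_cof:
  assumes "L2_field L g"
  shows "(LINT x|torus L. wave L k a x * g x $ j) = Re (a * fI L (cof g j) k)"
proof -
  have i: "integrable (torus L) (\<lambda>x. a * (cof g j x * expw L k x))"
    by (intro integrable_mult_right integrable_mult_expw sqint_cof assms)
  have "(LINT x|torus L. wave L k a x * g x $ j) = (LINT x|torus L. Re (a * (cof g j x * expw L k x)))"
    by (simp only: wave_mult_cof)
  also have "\<dots> = Re (LINT x|torus L. a * (cof g j x * expw L k x))"
    by (rule integral_Re[OF i])
  finally show ?thesis by (simp add: fI_def)
qed

lemma integrable_wave_cof:
  assumes "L2_field L g"
  shows "integrable (torus L) (\<lambda>x. wave L k a x * g x $ j)"
proof -
  have "integrable (torus L) (\<lambda>x. Re (a * (cof g j x * expw L k x)))"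
    by (intro integrable_Re integrable_mult_right integrable_mult_expw sqint_cof assms)
  then show ?thesis by (simp only: wave_mult_cof)
qed

lemma integrable_wave_scaleR:
  assumes "L2_field L g"
  shows "integrable (torus L) (\<lambda>x. wave L k a x *\<^sub>R g x)"
proof (rule finite_measure.integrable_sqint[OF finite_measure_torus], rule sqint_bound)
  show "sqint (torus L) (\<lambda>x. norm (g x) * norm a)"
    by (intro sqint_mult_bounded[where C="norm a"] sqint_norm L2_field_sqint assms) auto
  have "wave L k a \<in> borel_measurable (torus L)"
    by (intro borel_measurable_torus borel_measurable_continuous_onI continuous_wave)
  then show "(\<lambda>x. wave L k a x *\<^sub>R g x) \<in> borel_measurable (torus L)"
    using assms by (intro borel_measurable_scaleR) (auto simp: L2_field_def)
  show "norm (wave L k a x *\<^sub>R g x) \<le> norm (norm (g x) * norm a)" for x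
    using mult_right_mono[OF abs_wave_le[of L k a x] norm_ge_zero[of "g x"]] by (simp add: abs_mult mult.commute)
qed

lemma integral_wave_scaleR_nth:
  assumes "L2_field L g"
  shows "(LINT x|torus L. wave L k a x *\<^sub>R g x) $ j = Re (a * fI L (cof g j) k)"
proof -
  have "(LINT x|torus L. wave L k a x *\<^sub>R g x) $ j = (LINT x|torus L. (wave L k a x *\<^sub>R g x) $ j)"
    by (rule integral_bounded_linear[symmetric, OF bounded_linear_vec_nth integrable_wave_scaleR[OF assms]])
  then show ?thesis by (simp add: integral_wave_cof[OF assms])
qed

lemma Re_mult_eq_zero:
  assumes "\<And>a. Re (a * w) = 0" shows "w = 0"
proof (rule complex_eqI)
  show "Re w = Re 0" using assms[of 1] by simp
  have "Re (\<i> * w) = 0" by (rule assms)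
  then show "Im w = Im 0" by simp
qed

lemma weak_pderiv_fI:
  assumes L: "0 < L" and g: "L2_field L g" and h: "L2_field L h" and w: "is_weak_pderiv L i g h"
  shows "fI L (cof h j) k = - (\<i> * of_real (2 * pi / L * of_int (k $ i)) * fI L (cof g j) k)"
proof -
  let ?m = "\<i> * complex_of_real (2 * pi / L * of_int (k $ i))"
  have "Re (a * (?m * fI L (cof g j) k + fI L (cof h j) k)) = 0" for a
  proof -
    have "(LINT x|torus L. pderiv_x i (wave L k a) x *\<^sub>R g x) = - (LINT x|torus L. wave L k a x *\<^sub>R h x)"
      by (rule w[unfolded is_weak_pderiv_def, rule_format])
        (use L in \<open>auto intro: smooth_wave periodic_wave\<close>)
    then have "(LINT x|torus L. wave L k (a * ?m) x *\<^sub>R g x) $ j = (- (LINT x|torus L. wave L k a x *\<^sub>R h x)) $ j"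
      by (simp add: pderiv_wave mult.assoc)
    then show ?thesis
      unfolding vector_uminus_component integral_wave_scaleR_nth[OF g] integral_wave_scaleR_nth[OF h]
      by (simp add: distrib_left mult.assoc)
  qed
  from Re_mult_eq_zero[OF this] show ?thesis by (simp add: eq_neg_iff_add_eq_0 add.commute)
qed

lemma div_free_fI:
  assumes L: "0 < L" and g: "L2_field L g" and d: "div_free_distr L g"
  shows "(\<Sum>i\<in>UNIV. of_int (k $ i) * fI L (cof g i) k) = 0"
proof -
  let ?m = "\<lambda>i. \<i> * complex_of_real (2 * pi / L * of_int (k $ i))"
  have "Re (a * (\<Sum>i\<in>UNIV. ?m i * fI L (cof g i) k)) = 0" for a
  proof -
    have "(LINT x|torus L. (\<Sum>i\<in>UNIV. g x $ i * pderiv_x i (wave L k a) x)) = 0"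
      by (rule d[unfolded div_free_distr_def, rule_format])
        (use L in \<open>auto intro: smooth_wave periodic_wave\<close>)
    then have "(LINT x|torus L. (\<Sum>i\<in>UNIV. wave L k (a * ?m i) x * g x $ i)) = 0"
      by (simp only: pderiv_wave mult.assoc mult.commute[of "g _ $ _"])
    then have "(\<Sum>i\<in>UNIV. Re (a * ?m i * fI L (cof g i) k)) = 0"
      by (simp only: Bochner_Integration.integral_sum integrable_wave_cof[OF g] integral_wave_cof[OF g])
    then show ?thesis by (simp only: sum_distrib_left Re_sum mult.assoc)
  qed
  from Re_mult_eq_zero[OF this]
  have "\<i> * of_real (2 * pi / L) * (\<Sum>i\<in>UNIV. of_int (k $ i) * fI L (cof g i) k) = 0"
    by (simp add: sum_distrib_left mult_ac)
  then show ?thesis using L by simp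
qed

lemma weak_pderiv_props:
  assumes "H1_field L g"
  shows "L2_field L (weak_pderiv L i g)" "is_weak_pderiv L i g (weak_pderiv L i g)"
proof -
  have "\<exists>h. L2_field L h \<and> is_weak_pderiv L i g h" using assms by (auto simp: H1_field_def)
  from someI_ex[OF this] show "L2_field L (weak_pderiv L i g)" "is_weak_pderiv L i g (weak_pderiv L i g)"
    by (auto simp: weak_pderiv_def)
qed

lemma L2_field_vwave: "0 < L \<Longrightarrow> L2_field L (vwave L k z)"
proof -
  assume L: "0 < L"
  have "norm (vwave L k z x) \<le> norm z" for x
    unfolding norm_vec_def using abs_wave_le by (intro L2_set_mono) auto
  then have "sqint (torus L) (vwave L k z)"
    by (intro finite_measure.sqint_bounded[OF finite_measure_torus] borel_measurable_torus
        borel_measurable_continuous_onI continuous_vwave)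
  then show ?thesis using L by (simp add: L2_field_def sqint_def periodic_vwave)
qed

lemma L2_inner_vwave:
  assumes "L2_field L g"
  shows "L2_inner L g (vwave L k z) = (\<Sum>j\<in>UNIV. Re (z $ j * fI L (cof g j) k))"
proof -
  have "L2_inner L g (vwave L k z) = (LINT x|torus L. (\<Sum>j\<in>UNIV. wave L k (z $ j) x * g x $ j))"
    by (simp add: L2_inner_def inner_vec_def mult.commute)
  then show ?thesis
    by (simp add: Bochner_Integration.integral_sum integrable_wave_cof assms integral_wave_cof)
qed

text \<open>The divergence of the wave is again a wave, whose amplitude is a multiple of
  \<open>k . z\<close>.\<close>

lemma test_field_vwave:
  assumes L: "0 < L" and z: "(\<Sum>i\<in>UNIV. of_int (k $ i) * z $ i) = 0"
  shows "test_field L T1 T2 (\<lambda>s. vwave L k z)"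
  unfolding test_field_def
proof (intro conjI ballI allI)
  show "smooth_on ({T1..T2} \<times> UNIV) (\<lambda>(s, x). vwave L k z x)" by (rule smooth_vwave_time)
  show "periodic L (vwave L k z)" using L by (simp add: periodic_vwave)
  fix x
  have "(\<Sum>i\<in>UNIV. pderiv_x i (\<lambda>y. vwave L k z y $ i) x)
     = (\<Sum>i\<in>UNIV. Re (z $ i * \<i> * of_real (2 * pi / L * of_int (k $ i)) * expw L k x))"
    unfolding vwave_nth pderiv_wave by (simp only: wave_def)
  also have "\<dots> = Re ((\<Sum>i\<in>UNIV. of_int (k $ i) * z $ i) * (\<i> * of_real (2 * pi / L) * expw L k x))"
    unfolding sum_distrib_right Re_sum by (intro sum.cong refl arg_cong[where f=Re]) (simp add: mult_ac)
  finally show "(\<Sum>i\<in>UNIV. pderiv_x i (\<lambda>y. vwave L k z y $ i) x) = 0" using z by simp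
qed

section \<open>The advection term\<close>

abbreviation psum :: "real \<Rightarrow> nat \<Rightarrow> (real^3 \<Rightarrow> complex) \<Rightarrow> real^3 \<Rightarrow> complex" where
  "psum L n f \<equiv> fmult L (\<lambda>_. 1) (fbox n) f"

lemma psum_tendsto:
  assumes "0 < L" "sqint (torus L) f"
  shows "(\<lambda>n. l2 (torus L) (\<lambda>x. psum L n f x - f x)) \<longlonglongrightarrow> 0"
proof (rule fmult_tendsto[where B=1])
  show "\<forall>\<^sub>F n in sequentially. \<forall>k\<in>fbox j. k \<in> fbox n \<and> (1::real) = 1" for j
    unfolding eventually_sequentially using fbox_mono by blast
qed (use assms in auto)

lemma psum_eq: "psum L n f x = (\<Sum>k\<in>fbox n. fc L f k * expw L k x)"
  by (simp add: fmult_def tp_def)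

definition tri :: "real \<Rightarrow> (real^3 \<Rightarrow> complex) \<Rightarrow> (real^3 \<Rightarrow> complex) \<Rightarrow> int^3 \<Rightarrow> complex" where
  "tri L f g k = (LINT x|torus L. f x * (g x * expw L k x))"

lemma sqint_mult_expw: "sqint (torus L) f \<Longrightarrow> sqint (torus L) (\<lambda>x. f x * expw L k x)"
  by (rule sqint_mult_bounded[where C=1]) (auto intro: borel_measurable_torus expw_borel)

lemma l2_mult_expw: "l2 (torus L) (\<lambda>x. f x * expw L k x) = l2 (torus L) f"
  by (simp add: l2_def norm_mult)

lemma integrable_tri:
  "sqint (torus L) f \<Longrightarrow> sqint (torus L) g \<Longrightarrow> integrable (torus L) (\<lambda>x. f x * (g x * expw L k x))"
  by (intro integrable_mult_sqint sqint_mult_expw)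

lemma tri_tendsto:
  assumes F: "\<And>n. sqint (torus L) (F n)" and f: "sqint (torus L) f" and Ff: "(\<lambda>n. l2 (torus L) (\<lambda>x. F n x - f x)) \<longlonglongrightarrow> 0"
    and G: "\<And>n. sqint (torus L) (G n)" and g: "sqint (torus L) g" and Gg: "(\<lambda>n. l2 (torus L) (\<lambda>x. G n x - g x)) \<longlonglongrightarrow> 0"
  shows "(\<lambda>n. tri L (F n) (G n) k) \<longlonglongrightarrow> tri L f g k"
  unfolding tri_def
proof (rule tendsto_integral_mult_l2[OF F f Ff])
  have "(\<lambda>n. l2 (torus L) (\<lambda>x. (G n x - g x) * expw L k x)) \<longlonglongrightarrow> 0"
    unfolding l2_mult_expw by (rule Gg)
  then show "(\<lambda>n. l2 (torus L) (\<lambda>x. G n x * expw L k x - g x * expw L k x)) \<longlonglongrightarrow> 0"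
    by (simp add: left_diff_distrib)
qed (intro sqint_mult_expw G g)+

lemma tendsto_l2_const: "(\<lambda>n. l2 M (\<lambda>x. f x - f x)) \<longlonglongrightarrow> 0"
  by (simp add: l2_def)

lemma norm_tri_le:
  assumes "sqint (torus L) f" "sqint (torus L) g"
  shows "norm (tri L f g k) \<le> l2 (torus L) f * l2 (torus L) g"
  unfolding tri_def using norm_integral_mult_le[OF assms(1) sqint_mult_expw[OF assms(2), of k]]
  by (simp add: l2_mult_expw)

lemma tri_psum:
  assumes "sqint (torus L) f"
  shows "tri L f (psum L n g) l = (\<Sum>k\<in>fbox n. fc L g k * fI L f (k + l))"
proof -
  have "tri L f (psum L n g) l = (LINT x|torus L. (\<Sum>k\<in>fbox n. fc L g k * (f x * expw L (k + l) x)))"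
    unfolding tri_def psum_eq by (simp add: sum_distrib_right sum_distrib_left expw_add mult_ac)
  then show ?thesis
    using assms by (simp add: Bochner_Integration.integral_sum integrable_mult_expw fI_def)
qed

lemma tri_psum_psum:
  "tri L (psum L n f) (psum L n g) k
    = (\<Sum>l\<in>fbox n. \<Sum>m\<in>fbox n. fc L f m * fc L g l * (LINT x|torus L. expw L (m + (l + k)) x))"
proof -
  have "fI L (psum L n f) k' = (\<Sum>m\<in>fbox n. fc L f m * (LINT x|torus L. expw L (m + k') x))" for k'
  proof -
    have "fI L (psum L n f) k' = (LINT x|torus L. (\<Sum>m\<in>fbox n. fc L f m * expw L (m + k') x))"
      unfolding fI_def psum_eq sum_distrib_right expw_add by (simp only: mult.assoc)
    then show ?thesis
      by (simp add: Bochner_Integration.integral_sum finite_measure.integrable_sqint[OF finite_measure_torus] sqint_expw)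
  qed
  then show ?thesis
    unfolding tri_psum[OF sqint_fmult] by (simp add: sum_distrib_left mult_ac)
qed

lemma fc_weak_pderiv:
  assumes L: "0 < L" and g: "H1_field L g"
  shows "fc L (cof (weak_pderiv L i g) j) k = \<i> * of_real (2 * pi / L * of_int (k $ i)) * fc L (cof g j) k"
proof -
  have g2: "L2_field L g" using g by (simp add: H1_field_def)
  have "fI L (cof (weak_pderiv L i g) j) (- k) = - (\<i> * of_real (2 * pi / L * of_int ((- k) $ i)) * fI L (cof g j) (- k))"
    by (rule weak_pderiv_fI[OF L g2 weak_pderiv_props[OF g]])
  then have "complex_of_real (L ^ 3) * fc L (cof (weak_pderiv L i g) j) k
     = complex_of_real (L ^ 3) * (\<i> * of_real (2 * pi / L * of_int (k $ i)) * fc L (cof g j) k)"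
    unfolding fI_fc[OF L] by (simp add: mult_ac)
  moreover have "complex_of_real (L ^ 3) \<noteq> 0" using L by simp
  ultimately show ?thesis by (simp only: mult_cancel_left simp_thms)
qed

text \<open>
  The weak form of the advection term: the integral of \<open>\<Sum>j. g\<^sub>j g\<^sub>i \<partial>\<^sub>j e\<^sub>k\<close>, where \<open>e\<^sub>k = expw L k\<close>.
\<close>

definition NL :: "real \<Rightarrow> vfield \<Rightarrow> int^3 \<Rightarrow> 3 \<Rightarrow> complex" where
  "NL L g k i = (\<Sum>j\<in>UNIV. \<i> * of_real (2 * pi / L * of_int (k $ j)) * tri L (cof g j) (cof g i) k)"

text \<open>Integration by parts for fields that are only in \<open>H^1\<close>. Truncating just the
  differentiated factor reduces the identity to finitely many coefficients; then both sides
  converge.\<close>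

lemma product_rule:
  assumes L: "0 < L" and g: "H1_field L g" and d: "div_free_distr L g"
  shows "(\<Sum>j\<in>UNIV. tri L (cof g j) (cof (weak_pderiv L j g) i) l) = - NL L g l i"
proof -
  have g2: "L2_field L g" using g by (simp add: H1_field_def)
  let ?m = "\<lambda>k j. \<i> * complex_of_real (2 * pi / L * of_int (k $ j))"
  have eq: "(\<Sum>j\<in>UNIV. tri L (cof g j) (psum L n (cof (weak_pderiv L j g) i)) l)
      = - (\<Sum>j\<in>UNIV. ?m l j * tri L (cof g j) (psum L n (cof g i)) l)" for n
  proof -
    \<comment> \<open>By \<open>div_free_fI\<close> at frequency \<open>k + l\<close>, the factors
      \<open>k_j\<close> and \<open>- l_j\<close> give the same sum: the derivative moves from
      \<open>g_i\<close> to the mode.\<close>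
    have dk: "(\<Sum>j\<in>UNIV. ?m k j * fI L (cof g j) (k + l)) = - (\<Sum>j\<in>UNIV. ?m l j * fI L (cof g j) (k + l))" for k
    proof -
      have "(\<Sum>j\<in>UNIV. ?m k j * fI L (cof g j) (k + l)) + (\<Sum>j\<in>UNIV. ?m l j * fI L (cof g j) (k + l))
        = \<i> * of_real (2 * pi / L) * (\<Sum>j\<in>UNIV. of_int ((k + l) $ j) * fI L (cof g j) (k + l))"
        by (simp add: sum_distrib_left sum.distrib[symmetric] algebra_simps add_divide_distrib)
      then show ?thesis using div_free_fI[OF L g2 d, of "k + l"] by (simp add: eq_neg_iff_add_eq_0)
    qed
    have "(\<Sum>j\<in>UNIV. tri L (cof g j) (psum L n (cof (weak_pderiv L j g) i)) l)
        = (\<Sum>j\<in>UNIV. \<Sum>k\<in>fbox n. fc L (cof g i) k * (?m k j * fI L (cof g j) (k + l)))"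
      by (simp add: tri_psum sqint_cof g2 fc_weak_pderiv[OF L g] mult_ac)
    also have "\<dots> = (\<Sum>k\<in>fbox n. fc L (cof g i) k * (\<Sum>j\<in>UNIV. ?m k j * fI L (cof g j) (k + l)))"
      unfolding sum_distrib_left by (rule sum.swap)
    also have "\<dots> = - (\<Sum>k\<in>fbox n. \<Sum>j\<in>UNIV. ?m l j * (fc L (cof g i) k * fI L (cof g j) (k + l)))"
      unfolding dk by (simp add: sum_negf sum_distrib_left mult_ac)
    also have "(\<Sum>k\<in>fbox n. \<Sum>j\<in>UNIV. ?m l j * (fc L (cof g i) k * fI L (cof g j) (k + l)))
       = (\<Sum>j\<in>UNIV. ?m l j * tri L (cof g j) (psum L n (cof g i)) l)"
      by (subst sum.swap) (simp only: tri_psum[OF sqint_cof[OF g2]] sum_distrib_left)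
    finally show ?thesis .
  qed
  have "(\<lambda>n. \<Sum>j\<in>UNIV. tri L (cof g j) (psum L n (cof (weak_pderiv L j g) i)) l)
      \<longlonglongrightarrow> (\<Sum>j\<in>UNIV. tri L (cof g j) (cof (weak_pderiv L j g) i) l)"
    by (intro tendsto_sum tri_tendsto psum_tendsto sqint_fmult sqint_cof g2 L weak_pderiv_props(1)[OF g] tendsto_l2_const)
  moreover have "(\<lambda>n. - (\<Sum>j\<in>UNIV. ?m l j * tri L (cof g j) (psum L n (cof g i)) l))
      \<longlonglongrightarrow> - (\<Sum>j\<in>UNIV. ?m l j * tri L (cof g j) (cof g i) l)"
    by (intro tendsto_minus tendsto_sum tendsto_mult tendsto_const tri_tendsto psum_tendsto sqint_fmult sqint_cof g2 L tendsto_l2_const)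
  ultimately show ?thesis unfolding eq NL_def by (rule LIMSEQ_unique)
qed

lemma L2_inner_advection:
  assumes L: "0 < L" and g: "H1_field L g" and d: "div_free_distr L g"
  shows "L2_inner L (advection L g) (vwave L k z) = - (\<Sum>i\<in>UNIV. Re (z $ i * NL L g k i))"
proof -
  have g2: "L2_field L g" using g by (simp add: H1_field_def)
  note wp = weak_pderiv_props(1)[OF g]
  let ?t = "\<lambda>i j x. z $ i * (cof g j x * (cof (weak_pderiv L j g) i x * expw L k x))"
  have int: "integrable (torus L) (?t i j)" for i j
    by (intro integrable_mult_right integrable_tri sqint_cof g2 wp)
  have "advection L g x \<bullet> vwave L k z x = (\<Sum>i\<in>UNIV. \<Sum>j\<in>UNIV. Re (?t i j x))" for x
  proof -
    have "Re (?t i j x) = (g x $ j * weak_pderiv L j g x $ i) * wave L k (z $ i) x" for i j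
      unfolding wave_def cof_def by (simp add: algebra_simps)
    then show ?thesis by (simp add: inner_vec_def advection_def sum_component sum_distrib_right)
  qed
  then have "L2_inner L (advection L g) (vwave L k z) = (LINT x|torus L. (\<Sum>i\<in>UNIV. \<Sum>j\<in>UNIV. Re (?t i j x)))"
    by (simp add: L2_inner_def)
  also have "\<dots> = (\<Sum>i\<in>UNIV. \<Sum>j\<in>UNIV. LINT x|torus L. Re (?t i j x))"
    by (subst Bochner_Integration.integral_sum, intro Bochner_Integration.integrable_sum integrable_Re int,
        intro sum.cong refl Bochner_Integration.integral_sum integrable_Re int)
  also have "\<dots> = (\<Sum>i\<in>UNIV. \<Sum>j\<in>UNIV. Re (z $ i * tri L (cof g j) (cof (weak_pderiv L j g) i) k))"
    by (intro sum.cong refl) (simp only: integral_Re[OF int] integral_mult_right_zero tri_def)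
  also have "\<dots> = (\<Sum>i\<in>UNIV. Re (z $ i * (\<Sum>j\<in>UNIV. tri L (cof g j) (cof (weak_pderiv L j g) i) k)))"
    by (simp only: Re_sum[symmetric] sum_distrib_left[symmetric])
  finally show ?thesis by (simp only: product_rule[OF L g d] mult_minus_right uminus_complex.sel sum_negf)
qed

lemma L2_inner_grad:
  assumes L: "0 < L" and g: "H1_field L g"
  shows "(\<Sum>i\<in>UNIV. L2_inner L (weak_pderiv L i g) (pderiv_x i (vwave L k z)))
    = (2 * pi / L)\<^sup>2 * (norm (freq k))\<^sup>2 * L2_inner L g (vwave L k z)"
proof -
  have g2: "L2_field L g" using g by (simp add: H1_field_def)
  note wp = weak_pderiv_props[OF g]
  have R: "Re (complex_of_real a * w) = a * Re w" for a w by simp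
  have "L2_inner L (weak_pderiv L i g) (pderiv_x i (vwave L k z))
     = (2 * pi / L)\<^sup>2 * (freq k $ i)\<^sup>2 * L2_inner L g (vwave L k z)" for i
  proof -
    let ?m = "2 * pi / L * of_int (k $ i)"
    have "pderiv_x i (vwave L k z) = vwave L k (\<chi> j. z $ j * \<i> * of_real ?m)"
      by (rule ext, rule pderiv_vwave)
    then have "L2_inner L (weak_pderiv L i g) (pderiv_x i (vwave L k z))
       = (\<Sum>j\<in>UNIV. Re (z $ j * \<i> * of_real ?m * fI L (cof (weak_pderiv L i g) j) k))"
      by (simp only: L2_inner_vwave[OF wp(1)] vec_lambda_beta)
    also have "\<dots> = (\<Sum>j\<in>UNIV. ?m\<^sup>2 * Re (z $ j * fI L (cof g j) k))"
    proof (intro sum.cong refl)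
      fix j
      have "z $ j * \<i> * of_real ?m * fI L (cof (weak_pderiv L i g) j) k
        = of_real (?m\<^sup>2) * (z $ j * fI L (cof g j) k)"
        unfolding weak_pderiv_fI[OF L g2 wp] of_real_power power2_eq_square[of "complex_of_real ?m"]
        by (simp add: algebra_simps)
      then show "Re (z $ j * \<i> * of_real ?m * fI L (cof (weak_pderiv L i g) j) k) = ?m\<^sup>2 * Re (z $ j * fI L (cof g j) k)"
        by (simp only: R)
    qed
    also have "\<dots> = ?m\<^sup>2 * L2_inner L g (vwave L k z)"
      by (simp only: L2_inner_vwave[OF g2] sum_distrib_left)
    finally show ?thesis by (simp add: power_mult_distrib power_divide)
  qed
  then show ?thesis by (simp add: norm_vec_squared[of "freq k"] sum_distrib_left sum_distrib_right)
qed

section \<open>The energy identity\<close>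

text \<open>The time integrand of the weak formulation contains \<open>weak_pderiv\<close>, a choice
  made separately at each time. Its measurability is obtained from a measurable function that agrees
  with it almost everywhere, by completeness of Lebesgue measure.\<close>

lemma borel_measurable_lebesgue_on_AE:
  fixes f g :: "real \<Rightarrow> real"
  assumes S: "S \<in> sets lebesgue" and g: "g \<in> borel_measurable (lebesgue_on S)"
    and ae: "AE x in lebesgue_on S. f x = g x"
  shows "f \<in> borel_measurable (lebesgue_on S)"
proof -
  have "(\<lambda>x. indicator S x *\<^sub>R g x) \<in> borel_measurable lebesgue"
    using borel_measurable_restrict_space_iff[of S lebesgue g] S g by simp
  moreover have "AE x in lebesgue. x \<in> S \<longrightarrow> f x = g x"
    using ae S by (simp add: AE_restrict_space_iff)
  then have "AE x in lebesgue. indicator S x *\<^sub>R g x = indicator S x *\<^sub>R f x"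
    by (rule eventually_mono) (auto simp: indicator_def)
  ultimately have "(\<lambda>x. indicator S x *\<^sub>R f x) \<in> borel_measurable lebesgue"
    by (rule borel_measurable_AE)
  then show ?thesis
    using borel_measurable_restrict_space_iff[of S lebesgue f] S by simp
qed

lemma integral_lebesgue_on_cong_AE:
  fixes f g :: "real \<Rightarrow> real"
  assumes S: "S \<in> sets lebesgue" and g: "g \<in> borel_measurable (lebesgue_on S)"
    and ae: "AE x in lebesgue_on S. f x = g x"
  shows "integral\<^sup>L (lebesgue_on S) f = integral\<^sup>L (lebesgue_on S) g"
  by (rule integral_cong_AE[OF borel_measurable_lebesgue_on_AE[OF S g ae] g ae])

section \<open>Integrals in time over compact intervals\<close>

lemma finite_measure_Icc: "finite_measure (lebesgue_on {a..b::real})"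
  by (rule finite_measure_lebesgue_on) auto

lemma measure_Icc: "a \<le> b \<Longrightarrow> measure (lebesgue_on {a..b::real}) (space (lebesgue_on {a..b})) = b - a"
  by (simp add: measure_restrict_space)

lemma integrable_lebesgue_on_bounded:
  fixes f :: "real \<Rightarrow> real"
  assumes "f \<in> borel_measurable (lebesgue_on {a..b})" "\<And>s. s \<in> {a..b} \<Longrightarrow> \<bar>f s\<bar> \<le> C"
  shows "integrable (lebesgue_on {a..b}) f"
  by (rule finite_measure.integrable_const_bound[OF finite_measure_Icc, where B=C])
     (use assms in \<open>auto intro!: AE_I2\<close>)

lemma abs_integral_lebesgue_on_le:
  fixes f :: "real \<Rightarrow> real"
  assumes "a \<le> b" "\<And>s. s \<in> {a..b} \<Longrightarrow> \<bar>f s\<bar> \<le> C"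
  shows "\<bar>LINT s|lebesgue_on {a..b}. f s\<bar> \<le> C * (b - a)"
proof -
  have "0 \<le> C" using assms(2)[of a] assms(1) abs_ge_zero[of "f a"] by simp
  have "norm (LINT s|lebesgue_on {a..b}. f s) \<le> (LINT s|lebesgue_on {a..b}. norm (f s))"
    by (rule integral_norm_bound)
  also have "\<dots> \<le> (LINT s|lebesgue_on {a..b}. C)"
    by (rule integral_mono_AE')
       (use assms \<open>0 \<le> C\<close> finite_measure.integrable_const[OF finite_measure_Icc] in \<open>auto intro!: AE_I2\<close>)
  also have "\<dots> = C * (b - a)" using measure_Icc[OF assms(1)] by simp
  finally show ?thesis by simp
qed

lemma integral_lebesgue_on_combine:
  fixes f :: "real \<Rightarrow> real"
  assumes "a \<le> c" "c \<le> b" and f: "integrable (lebesgue_on {a..b}) f"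
  shows "(LINT s|lebesgue_on {a..c}. f s) + (LINT s|lebesgue_on {c..b}. f s) = (LINT s|lebesgue_on {a..b}. f s)"
proof -
  have sub: "integrable (lebesgue_on {x..y}) f" if "{x..y} \<subseteq> {a..b}" for x y
    using integrable_subinterval[OF f, of x y] that by simp
  have eq: "(LINT s|lebesgue_on {x..y}. f s) = integral {x..y} f" if "{x..y} \<subseteq> {a..b}" for x y
    using sub[OF that] by (intro lebesgue_integral_eq_integral) auto
  have "f integrable_on {a..b}"
    by (rule integrable_on_lebesgue_on[OF f]) auto
  then have "integral {a..c} f + integral {c..b} f = integral {a..b} f"
    using assms by (intro Henstock_Kurzweil_Integration.integral_combine) auto
  then show ?thesis using assms by (simp add: eq)
qed

text \<open>Over \<open>n\<close> equal subintervals the increments add up to at most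
  \<open>K * (b - a)^2 / n\<close>. This takes the place of a product rule for functions that are
  only Lipschitz in time.\<close>

lemma eq_endpoints_if_quadratic_increments:
  fixes H :: "real \<Rightarrow> real"
  assumes ab: "a \<le> b" and H: "\<And>c d. a \<le> c \<Longrightarrow> c \<le> d \<Longrightarrow> d \<le> b \<Longrightarrow> \<bar>H d - H c\<bar> \<le> K * (d - c)\<^sup>2"
  shows "H b = H a"
proof (rule ccontr)
  assume ne: "H b \<noteq> H a"
  have le: "\<bar>H b - H a\<bar> \<le> K * (b - a)\<^sup>2 / real n" if n: "0 < n" for n :: nat
  proof -
    define x where "x i = a + real i * ((b - a) / real n)" for i :: nat
    have x0: "x 0 = a" "x n = b" using n by (auto simp: x_def)
    have inc: "x (Suc i) - x i = (b - a) / real n" for i by (simp add: x_def algebra_simps add_divide_distrib diff_divide_distrib)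
    have mono: "x i \<le> x j" if "i \<le> j" for i j
      unfolding x_def using that ab by (intro add_left_mono mult_right_mono divide_nonneg_nonneg) auto
    have "\<bar>H b - H a\<bar> = \<bar>\<Sum>i<n. H (x (Suc i)) - H (x i)\<bar>"
      by (subst sum_lessThan_telescope) (simp add: x0)
    also have "\<dots> \<le> (\<Sum>i<n. \<bar>H (x (Suc i)) - H (x i)\<bar>)" by (rule sum_abs)
    also have "\<dots> \<le> (\<Sum>i<n. K * ((b - a) / real n)\<^sup>2)"
    proof (rule sum_mono)
      fix i assume "i \<in> {..<n}"
      then have "a \<le> x i" "x i \<le> x (Suc i)" "x (Suc i) \<le> b"
        using mono[of 0 i] mono[of i "Suc i"] mono[of "Suc i" n] x0 by auto
      from H[OF this] show "\<bar>H (x (Suc i)) - H (x i)\<bar> \<le> K * ((b - a) / real n)\<^sup>2" by (simp only: inc)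
    qed
    also have "\<dots> = K * (b - a)\<^sup>2 / real n"
      using n by (simp add: power2_eq_square power_divide)
    finally show ?thesis .
  qed
  obtain n :: nat where n: "K * (b - a)\<^sup>2 < real n * \<bar>H b - H a\<bar>"
    using reals_Archimedean3[of "\<bar>H b - H a\<bar>"] ne by auto
  have "0 \<le> K * (b - a)\<^sup>2" using le[of 1] by simp
  then have "0 < n" using n by (cases n) auto
  then have "\<bar>H b - H a\<bar> * real n \<le> K * (b - a)\<^sup>2"
    using le[of n] by (simp add: pos_le_divide_eq)
  then show False using n by (simp add: mult.commute)
qed

text \<open>
  The function \<open>y\<close> is only known through its pairings with \<open>V\<close>. Testing with \<open>y d + y c\<close> shows that
  the increments of the difference of the two sides are quadratic in \<open>d - c\<close>.
\<close>

lemma energy_identity: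
  fixes y :: "real \<Rightarrow> 'a::real_inner" and g :: "real \<Rightarrow> 'a \<Rightarrow> real"
  assumes ab: "a \<le> b" and V: "subspace V" and yV: "\<And>s. y s \<in> V"
    and lin: "\<And>s. linear (g s)" and bound: "\<And>s z. s \<in> {a..b} \<Longrightarrow> \<bar>g s z\<bar> \<le> C * norm z"
    and weak: "\<And>c d z. a \<le> c \<Longrightarrow> c < d \<Longrightarrow> d \<le> b \<Longrightarrow> z \<in> V \<Longrightarrow> y d \<bullet> z - y c \<bullet> z = (LINT s|lebesgue_on {c..d}. g s z)"
    and meas: "\<And>c d z. (\<lambda>s. g s z) \<in> borel_measurable (lebesgue_on {c..d})"
    and measy: "\<And>c d. (\<lambda>s. g s (y s)) \<in> borel_measurable (lebesgue_on {c..d})"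
    and ybound: "\<And>s. s \<in> {a..b} \<Longrightarrow> norm (y s) \<le> B"
  shows "(norm (y b))\<^sup>2 - (norm (y a))\<^sup>2 = (LINT s|lebesgue_on {a..b}. 2 * g s (y s))"
proof (cases "a = b")
  case True
  have "\<bar>LINT s|lebesgue_on {a..b}. 2 * g s (y s)\<bar> \<le> 2 * \<bar>g a (y a)\<bar> * (b - a)"
    using True by (intro abs_integral_lebesgue_on_le) (auto simp: abs_mult)
  then show ?thesis using True by simp
next
  case False
  then have ab': "a < b" using ab by simp
  \<comment> \<open>Testing with the increment itself shows that \<open>y\<close> is
    Lipschitz.\<close>
  have lip: "norm (y d - y c) \<le> \<bar>C\<bar> * (d - c)" if cd: "a \<le> c" "c \<le> d" "d \<le> b" for c d
  proof (cases "c = d")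
    case False
    let ?z = "y d - y c"
    have zV: "?z \<in> V" by (intro subspace_diff V yV)
    have "(norm ?z)\<^sup>2 = y d \<bullet> ?z - y c \<bullet> ?z"
      by (simp add: power2_norm_eq_inner inner_diff_left)
    also have "\<dots> = (LINT s|lebesgue_on {c..d}. g s ?z)"
      using cd False by (intro weak zV) auto
    also have "\<dots> \<le> (\<bar>C\<bar> * norm ?z) * (d - c)"
    proof (rule order_trans[OF abs_ge_self abs_integral_lebesgue_on_le])
      show "\<bar>g s ?z\<bar> \<le> \<bar>C\<bar> * norm ?z" if "s \<in> {c..d}" for s
        using bound[of s ?z] that cd mult_right_mono[OF abs_ge_self[of C] norm_ge_zero[of ?z]] by auto
    qed (use cd in auto)
    finally have "norm ?z * norm ?z \<le> norm ?z * (\<bar>C\<bar> * (d - c))" by (simp add: power2_eq_square mult_ac)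
    then show ?thesis using cd by (cases "norm ?z = 0") (auto simp: mult_le_cancel_left)
  qed simp
  have giy: "integrable (lebesgue_on {c..d}) (\<lambda>s. 2 * g s (y s))" if cd: "a \<le> c" "d \<le> b" for c d
  proof (rule integrable_lebesgue_on_bounded)
    show "\<bar>2 * g s (y s)\<bar> \<le> 2 * (\<bar>C\<bar> * B)" if "s \<in> {c..d}" for s
    proof -
      have s: "s \<in> {a..b}" using that cd by auto
      have "\<bar>g s (y s)\<bar> \<le> \<bar>C\<bar> * norm (y s)"
        using bound[OF s, of "y s"] mult_right_mono[OF abs_ge_self[of C] norm_ge_zero[of "y s"]] by linarith
      also have "\<dots> \<le> \<bar>C\<bar> * B" using ybound[OF s] by (intro mult_left_mono) auto
      finally show ?thesis by (simp add: abs_mult)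
    qed
  qed (use measy in measurable)
  define H where "H t = (norm (y t))\<^sup>2 - (LINT s|lebesgue_on {a..t}. 2 * g s (y s))" for t
  have "H b = H a"
  proof (rule eq_endpoints_if_quadratic_increments[OF ab])
    fix c d assume cd: "a \<le> c" "c \<le> d" "d \<le> b"
    show "\<bar>H d - H c\<bar> \<le> (2 * \<bar>C\<bar> * \<bar>C\<bar>) * (d - c)\<^sup>2"
    proof (cases "c = d")
      case False
      let ?z = "y d + y c"
      have zV: "?z \<in> V" by (intro subspace_add V yV)
      have gz: "integrable (lebesgue_on {c..d}) (\<lambda>s. g s ?z)"
        by (rule integrable_lebesgue_on_bounded[OF meas, where C="C * norm ?z"]) (use bound cd in auto)
      have "(LINT s|lebesgue_on {a..d}. 2 * g s (y s)) = (LINT s|lebesgue_on {a..c}. 2 * g s (y s)) + (LINT s|lebesgue_on {c..d}. 2 * g s (y s))"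
        using integral_lebesgue_on_combine[OF cd(1,2) giy[of a d]] cd by simp
      then have "H d - H c = (y d \<bullet> ?z - y c \<bullet> ?z) - (LINT s|lebesgue_on {c..d}. 2 * g s (y s))"
        by (simp add: H_def power2_norm_eq_inner inner_add_right inner_commute)
      also have "\<dots> = (LINT s|lebesgue_on {c..d}. g s ?z) - (LINT s|lebesgue_on {c..d}. 2 * g s (y s))"
        using weak[OF cd(1) _ cd(3) zV] cd False by simp
      also have "\<dots> = (LINT s|lebesgue_on {c..d}. g s ?z - 2 * g s (y s))"
        using giy cd gz by (intro Bochner_Integration.integral_diff[symmetric]) auto
      also have "\<bar>\<dots>\<bar> \<le> (\<bar>C\<bar> * (2 * \<bar>C\<bar> * (d - c))) * (d - c)"
      proof (rule abs_integral_lebesgue_on_le[OF cd(2)])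
        fix s assume s: "s \<in> {c..d}"
        \<comment> \<open>By linearity the integrand is \<open>g s\<close> at a combination of two
          increments of \<open>y\<close>, so it is of order \<open>d - c\<close> and its integral of
          order \<open>(d - c)^2\<close>.\<close>
        have eq: "g s ?z - 2 * g s (y s) = g s ((y d - y s) - (y s - y c))"
        proof -
          interpret linear "g s" by (rule lin)
          show ?thesis by (simp add: add diff)
        qed
        have "\<bar>g s ((y d - y s) - (y s - y c))\<bar> \<le> \<bar>C\<bar> * norm ((y d - y s) - (y s - y c))"
          using bound[of s "(y d - y s) - (y s - y c)"] s cd
            mult_right_mono[OF abs_ge_self[of C] norm_ge_zero[of "(y d - y s) - (y s - y c)"]] by auto
        also have "\<dots> \<le> \<bar>C\<bar> * (\<bar>C\<bar> * (d - s) + \<bar>C\<bar> * (s - c))"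
          using s cd by (intro mult_left_mono order_trans[OF norm_triangle_ineq4 add_mono] lip) auto
        also have "\<dots> \<le> \<bar>C\<bar> * (2 * \<bar>C\<bar> * (d - c))"
        proof (intro mult_left_mono)
          have "\<bar>C\<bar> * (d - s) + \<bar>C\<bar> * (s - c) = \<bar>C\<bar> * (d - c)" by (simp add: algebra_simps)
          also have "\<dots> \<le> 2 * \<bar>C\<bar> * (d - c)" using cd by (intro mult_right_mono) auto
          finally show "\<bar>C\<bar> * (d - s) + \<bar>C\<bar> * (s - c) \<le> 2 * \<bar>C\<bar> * (d - c)" .
        qed simp
        finally show "\<bar>g s ?z - 2 * g s (y s)\<bar> \<le> \<bar>C\<bar> * (2 * \<bar>C\<bar> * (d - c))" by (simp only: eq)
      qed
      finally show ?thesis by (simp add: power2_eq_square mult_ac)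
    qed simp
  qed
  moreover have "(LINT s|lebesgue_on {a..a}. 2 * g s (y s)) = 0"
  proof -
    have "\<bar>LINT s|lebesgue_on {a..a}. 2 * g s (y s)\<bar> \<le> 2 * \<bar>g a (y a)\<bar> * (a - a)"
      by (intro abs_integral_lebesgue_on_le) (auto simp: abs_mult)
    then show ?thesis by simp
  qed
  ultimately show ?thesis by (simp add: H_def)
qed

section \<open>Fourier form of the pairings and bounds for the nonlinear term\<close>

lemma L2_norm_eq_l2: "L2_norm L g = l2 (torus L) g"
  by (simp add: L2_norm_def l2_def L2_inner_def power2_norm_eq_inner)

lemma l2_cof_le: "L2_field L g \<Longrightarrow> l2 (torus L) (cof g j) \<le> L2_norm L g"
  unfolding L2_norm_eq_l2
  by (rule l2_mono) (auto intro: L2_field_sqint simp: cof_def component_le_norm_cart)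

lemma fI_cof: "0 < L \<Longrightarrow> fI L (cof g j) k = of_real (L ^ 3) * cnj (fourier_coeff L g k $ j)"
  using fI_fc[of L "cof g j" "- k"] fc_of_real_minus[of L "\<lambda>x. g x $ j" k]
  by (simp add: fourier_coeff_eq_fc cof_def[abs_def])

text \<open>The inner product of \<open>complex^3\<close> as a real space is the real part of the
  Hermitian one, so testing with \<open>vwave L k z\<close> reads off the coefficient in the
  direction \<open>z\<close>.\<close>

lemma L2_inner_vwave_fourier:
  assumes "0 < L" "L2_field L g"
  shows "L2_inner L g (vwave L k z) = L ^ 3 * (fourier_coeff L g k \<bullet> z)"
  unfolding L2_inner_vwave[OF assms(2)] fI_cof[OF assms(1)]
  by (simp add: inner_vec_def inner_complex_def sum_distrib_left algebra_simps)

lemma fourier_div_free: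
  assumes L: "0 < L" and g: "L2_field L g" and d: "div_free_distr L g"
  shows "(\<Sum>i\<in>UNIV. of_int (k $ i) * fourier_coeff L g k $ i) = 0"
proof -
  have "cnj (\<Sum>i\<in>UNIV. of_int (k $ i) * fI L (cof g i) k) = of_real (L ^ 3) * (\<Sum>i\<in>UNIV. of_int (k $ i) * fourier_coeff L g k $ i)"
    unfolding fI_cof[OF L] by (simp add: sum_distrib_left mult_ac)
  then show ?thesis using div_free_fI[OF L g d, of k] L by simp
qed

text \<open>The derivative has been moved to the mode, so only the \<open>L^2\<close> norm of
  \<open>g\<close> enters; for bounded solutions this gives the uniform bound that
  \<open>energy_identity\<close> requires.\<close>

lemma norm_NL_le:
  assumes g: "L2_field L g" and B: "L2_norm L g \<le> B"
  shows "norm (NL L g k i) \<le> (\<Sum>j\<in>UNIV. \<bar>2 * pi / L * of_int (k $ j)\<bar>) * B\<^sup>2"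
proof -
  have le: "l2 (torus L) (cof g j) \<le> B" for j
    using order_trans[OF l2_cof_le[OF g] B] .
  have "norm (tri L (cof g j) (cof g i) k) \<le> B\<^sup>2" for j
  proof -
    have "norm (tri L (cof g j) (cof g i) k) \<le> l2 (torus L) (cof g j) * l2 (torus L) (cof g i)"
      by (intro norm_tri_le sqint_cof g)
    also have "\<dots> \<le> B * B"
      by (intro mult_mono le l2_nonneg order_trans[OF l2_nonneg le[of i]])
    finally show ?thesis by (simp add: power2_eq_square)
  qed
  then show ?thesis
    unfolding NL_def sum_distrib_right
    by (intro sum_norm_le) (simp only: norm_mult norm_of_real norm_ii mult_1_left mult_left_mono abs_ge_zero)
qed

section \<open>Evolution of the Fourier coefficients of the difference\<close>

locale solution_pair =
  fixes L \<nu> :: real and F :: "vfield \<Rightarrow> real" and u v :: "real \<Rightarrow> vfield"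
  assumes L: "0 < L" and nu: "0 < \<nu>"
    and u: "complete_bounded_leray_hopf L \<nu> F u" and v: "complete_bounded_leray_hopf L \<nu> F v"
begin

lemma leray_hopf_uv: "a < b \<Longrightarrow> leray_hopf L \<nu> F a b u" "a < b \<Longrightarrow> leray_hopf L \<nu> F a b v"
  using u v by (auto simp: complete_bounded_leray_hopf_def)

end

lemma leray_hopf_L2: "leray_hopf L \<nu> F a b u \<Longrightarrow> t \<in> {a..b} \<Longrightarrow> L2_field L (u t)"
  and leray_hopf_div_free: "leray_hopf L \<nu> F a b u \<Longrightarrow> t \<in> {a..b} \<Longrightarrow> div_free_distr L (u t)"
  and leray_hopf_H1: "leray_hopf L \<nu> F a b u \<Longrightarrow> AE t in lebesgue_on {a..b}. H1_field L (u t)"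
  and leray_hopf_mean: "leray_hopf L \<nu> F a b u \<Longrightarrow> t \<in> {a..b} \<Longrightarrow> (LINT x|torus L. u t x) = 0"
  and leray_hopf_cont: "leray_hopf L \<nu> F a b u \<Longrightarrow> L2_field L w \<Longrightarrow> continuous_on {a..b} (\<lambda>t. L2_inner L (u t) w)"
  by (simp_all add: leray_hopf_def)

lemma leray_hopf_weak:
  assumes lh: "leray_hopf L \<nu> F a b u" and ab: "a < b" and \<phi>: "test_field L a b (\<lambda>s. \<phi>)"
  shows "L2_inner L (u b) \<phi> + (LINT s|lebesgue_on {a..b}.
      \<nu> * (\<Sum>i\<in>UNIV. L2_inner L (weak_pderiv L i (u s)) (pderiv_x i \<phi>)) + L2_inner L (advection L (u s)) \<phi> - F \<phi>)
     = L2_inner L (u a) \<phi>"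
proof -
  have eq: "L2_inner L (u b) \<phi> + (LINT s|lebesgue_on {a..b}.
      - L2_inner L (u s) (\<lambda>x. vector_derivative (\<lambda>s'. \<phi> x) (at s within {a..b}))
      + \<nu> * (\<Sum>i\<in>UNIV. L2_inner L (weak_pderiv L i (u s)) (pderiv_x i \<phi>)) + L2_inner L (advection L (u s)) \<phi> - F \<phi>)
     = L2_inner L (u a) \<phi>"
    using conjunct1[OF conjunct2[OF conjunct2[OF conjunct2[OF conjunct2[OF conjunct2[OF conjunct2[OF
      lh[unfolded leray_hopf_def]]]]]]], rule_format, OF \<phi>, of b] ab by simp
  \<comment> \<open>The test field does not depend on time; \<open>a < b\<close> makes the
    derivative within the interval unique.\<close>
  have "vector_derivative (\<lambda>s'. \<phi> x) (at s within {a..b}) = 0" if "s \<in> {a..b}" for s x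
    by (rule vector_derivative_within_closed_interval[OF ab that has_vector_derivative_const])
  then have "(LINT s|lebesgue_on {a..b}.
      - L2_inner L (u s) (\<lambda>x. vector_derivative (\<lambda>s'. \<phi> x) (at s within {a..b}))
      + \<nu> * (\<Sum>i\<in>UNIV. L2_inner L (weak_pderiv L i (u s)) (pderiv_x i \<phi>)) + L2_inner L (advection L (u s)) \<phi> - F \<phi>)
    = (LINT s|lebesgue_on {a..b}.
      \<nu> * (\<Sum>i\<in>UNIV. L2_inner L (weak_pderiv L i (u s)) (pderiv_x i \<phi>)) + L2_inner L (advection L (u s)) \<phi> - F \<phi>)"
    by (intro Bochner_Integration.integral_cong refl) (simp add: L2_inner_def)
  then show ?thesis using eq by simp
qed

lemma continuous_fourier_coeff:
  assumes L: "0 < L" and lh: "leray_hopf L \<nu> F a b u"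
  shows "continuous_on {a..b} (\<lambda>t. fourier_coeff L (u t) k)"
proof -
  have c: "continuous_on {a..b} (\<lambda>t. fourier_coeff L (u t) k \<bullet> z)" for z
  proof -
    have "continuous_on {a..b} (\<lambda>t. L2_inner L (u t) (vwave L k z) / L ^ 3)"
      using L by (intro continuous_intros leray_hopf_cont[OF lh] L2_field_vwave) auto
    then show ?thesis
      by (rule continuous_on_eq) (use L leray_hopf_L2[OF lh] in \<open>simp add: L2_inner_vwave_fourier\<close>)
  qed
  show ?thesis by (rule continuous_on_componentwise[THEN iffD2]) (use c in blast)
qed

lemma continuous_tri_psum:
  assumes L: "0 < L" and lh: "leray_hopf L \<nu> F a b u"
  shows "continuous_on {a..b} (\<lambda>t. tri L (psum L n (cof (u t) j)) (psum L n (cof (u t) i)) k)"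
proof -
  have "continuous_on {a..b} (\<lambda>t. fc L (cof (u t) j) l)" for j l
    unfolding fourier_coeff_cof[symmetric]
    by (intro continuous_on_component continuous_fourier_coeff[OF L lh])
  then show ?thesis unfolding tri_psum_psum by (intro continuous_intros)
qed

text \<open>\<open>NL\<close> is quadratic, so weak continuity in time does not pass to it. It is
  the pointwise limit of the same expression for partial sums, a polynomial in finitely many
  continuous coefficients.\<close>

lemma NL_measurable:
  assumes L: "0 < L" and lh: "leray_hopf L \<nu> F a b u"
  shows "(\<lambda>t. NL L (u t) k i) \<in> borel_measurable (lebesgue_on {a..b})"
  unfolding NL_def
proof (intro borel_measurable_sum borel_measurable_times borel_measurable_const)
  fix j
  show "(\<lambda>t. tri L (cof (u t) j) (cof (u t) i) k) \<in> borel_measurable (lebesgue_on {a..b})"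
  proof (rule borel_measurable_LIMSEQ_metric)
    show "(\<lambda>t. tri L (psum L n (cof (u t) j)) (psum L n (cof (u t) i)) k) \<in> borel_measurable (lebesgue_on {a..b})" for n
      by (intro continuous_imp_measurable_on_sets_lebesgue continuous_tri_psum[OF L lh]) auto
    fix t assume "t \<in> space (lebesgue_on {a..b})"
    then have "L2_field L (u t)" using leray_hopf_L2[OF lh] by simp
    then show "(\<lambda>n. tri L (psum L n (cof (u t) j)) (psum L n (cof (u t) i)) k) \<longlonglongrightarrow> tri L (cof (u t) j) (cof (u t) i) k"
      by (intro tri_tendsto psum_tendsto sqint_fmult sqint_cof L)
  qed
qed

definition NLp :: "real \<Rightarrow> vfield \<Rightarrow> int^3 \<Rightarrow> complex^3 \<Rightarrow> real" where
  "NLp L g k z = (\<Sum>i\<in>UNIV. Re (z $ i * NL L g k i))"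

lemma NLp_linear: "linear (NLp L g k)"
proof (rule linearI)
  show "NLp L g k (x + y) = NLp L g k x + NLp L g k y" for x y
    unfolding NLp_def sum.distrib[symmetric] by (intro sum.cong) (simp_all add: algebra_simps)
  show "NLp L g k (c *\<^sub>R x) = c *\<^sub>R NLp L g k x" for c x
    unfolding NLp_def real_scaleR_def sum_distrib_left by (intro sum.cong) (simp_all add: algebra_simps)
qed

lemma abs_NLp_le:
  assumes g: "L2_field L g" and B: "L2_norm L g \<le> B"
  shows "\<bar>NLp L g k z\<bar> \<le> 3 * ((\<Sum>j\<in>UNIV. \<bar>2 * pi / L * of_int (k $ j)\<bar>) * B\<^sup>2) * norm z"
proof -
  let ?C = "(\<Sum>j\<in>UNIV. \<bar>2 * pi / L * of_int (k $ j)\<bar>) * B\<^sup>2"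
  have C0: "0 \<le> ?C" by (intro mult_nonneg_nonneg sum_nonneg) auto
  have "\<bar>NLp L g k z\<bar> \<le> (\<Sum>i\<in>UNIV. \<bar>Re (z $ i * NL L g k i)\<bar>)"
    unfolding NLp_def by (rule sum_abs)
  also have "\<dots> \<le> (\<Sum>i\<in>(UNIV :: 3 set). norm z * ?C)"
  proof (rule sum_mono)
    fix i :: 3
    have "\<bar>Re (z $ i * NL L g k i)\<bar> \<le> norm (z $ i) * norm (NL L g k i)"
      using abs_Re_le_cmod[of "z $ i * NL L g k i"] by (simp only: norm_mult)
    also have "\<dots> \<le> norm z * ?C"
      by (intro mult_mono Finite_Cartesian_Product.norm_nth_le norm_NL_le g B C0) auto
    finally show "\<bar>Re (z $ i * NL L g k i)\<bar> \<le> norm z * ?C" .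
  qed
  also have "\<dots> = 3 * ?C * norm z" by simp
  finally show ?thesis .
qed

text \<open>The weak formulation tested with a steady wave. The Laplacian acts on it by a scalar,
  and the force contributes a multiple of \<open>b - a\<close> that is the same for both
  solutions.\<close>

lemma fourier_evolution:
  assumes L: "0 < L" and lh: "leray_hopf L \<nu> F a b u" and ab: "a < b"
    and B: "\<And>t. t \<in> {a..b} \<Longrightarrow> L2_norm L (u t) \<le> B"
    and z: "(\<Sum>i\<in>UNIV. of_int (k $ i) * z $ i) = 0"
  defines "G \<equiv> \<lambda>s. - \<nu> * (2 * pi / L)\<^sup>2 * (norm (freq k))\<^sup>2 * (L ^ 3 * (fourier_coeff L (u s) k \<bullet> z)) + NLp L (u s) k z"
  shows "integrable (lebesgue_on {a..b}) G"
    and "L ^ 3 * (fourier_coeff L (u b) k \<bullet> z) - L ^ 3 * (fourier_coeff L (u a) k \<bullet> z)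
       = (LINT s|lebesgue_on {a..b}. G s) + F (vwave L k z) * (b - a)"
proof -
  let ?\<phi> = "vwave L k z"
  have tf: "test_field L a b (\<lambda>s. ?\<phi>)" by (rule test_field_vwave[OF L z])
  let ?c = "\<lambda>s. fourier_coeff L (u s) k \<bullet> z"
  have cont: "continuous_on {a..b} ?c"
    by (intro continuous_intros continuous_fourier_coeff[OF L lh])
  have i1: "integrable (lebesgue_on {a..b}) ?c"
    using continuous_imp_integrable_real[OF cont] by simp
  have i2: "integrable (lebesgue_on {a..b}) (\<lambda>s. NLp L (u s) k z)"
  proof (rule integrable_lebesgue_on_bounded)
    show "(\<lambda>s. NLp L (u s) k z) \<in> borel_measurable (lebesgue_on {a..b})"
      unfolding NLp_def using NL_measurable[OF L lh, of k] by measurable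
    show "\<bar>NLp L (u s) k z\<bar> \<le> 3 * ((\<Sum>j\<in>UNIV. \<bar>2 * pi / L * of_int (k $ j)\<bar>) * B\<^sup>2) * norm z" if "s \<in> {a..b}" for s
      by (rule abs_NLp_le[OF leray_hopf_L2[OF lh that] B[OF that]])
  qed
  show iG: "integrable (lebesgue_on {a..b}) G"
    unfolding G_def by (intro Bochner_Integration.integrable_add i2 integrable_mult_right i1)
  let ?f = "\<lambda>s. \<nu> * (\<Sum>i\<in>UNIV. L2_inner L (weak_pderiv L i (u s)) (pderiv_x i ?\<phi>)) + L2_inner L (advection L (u s)) ?\<phi> - F ?\<phi>"
  \<comment> \<open>At \<open>H^1\<close> times, hence almost always, the integrand equals a
    measurable expression in the coefficients.\<close>
  have "(LINT s|lebesgue_on {a..b}. ?f s) = (LINT s|lebesgue_on {a..b}. - G s - F ?\<phi>)"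
  proof (rule integral_lebesgue_on_cong_AE)
    show "(\<lambda>s. - G s - F ?\<phi>) \<in> borel_measurable (lebesgue_on {a..b})"
      using borel_measurable_integrable[OF iG] by measurable
    have "AE s in lebesgue_on {a..b}. s \<in> {a..b} \<and> H1_field L (u s)"
      using leray_hopf_H1[OF lh] AE_space[of "lebesgue_on {a..b}"] by eventually_elim auto
    then show "AE s in lebesgue_on {a..b}. ?f s = - G s - F ?\<phi>"
    proof (rule eventually_mono)
      fix s assume s: "s \<in> {a..b} \<and> H1_field L (u s)"
      then have h: "H1_field L (u s)" and d: "div_free_distr L (u s)" and l: "L2_field L (u s)"
        using leray_hopf_div_free[OF lh] leray_hopf_L2[OF lh] by auto
      show "?f s = - G s - F ?\<phi>"
        unfolding L2_inner_grad[OF L h] L2_inner_advection[OF L h d] L2_inner_vwave_fourier[OF L l] G_def NLp_def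
        by (simp add: mult_ac)
    qed
  qed auto
  also have "\<dots> = - (LINT s|lebesgue_on {a..b}. G s) - F ?\<phi> * (b - a)"
    using iG measure_Icc[of a b] ab finite_measure.integrable_const[OF finite_measure_Icc, of a b]
    by (simp add: mult.commute)
  finally show "L ^ 3 * (fourier_coeff L (u b) k \<bullet> z) - L ^ 3 * (fourier_coeff L (u a) k \<bullet> z)
       = (LINT s|lebesgue_on {a..b}. G s) + F (vwave L k z) * (b - a)"
    using leray_hopf_weak[OF lh ab tf] leray_hopf_L2[OF lh] ab
    by (simp add: L2_inner_vwave_fourier[OF L])
qed

context solution_pair
begin

definition Y :: "real \<Rightarrow> int^3 \<Rightarrow> complex^3" where
  "Y t k = fourier_coeff L (u t) k - fourier_coeff L (v t) k"

text \<open>Right-hand side of the evolution of \<open>L ^ 3 * (Y t k . z)\<close>, after the force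
  has cancelled.\<close>

definition G :: "int^3 \<Rightarrow> real \<Rightarrow> complex^3 \<Rightarrow> real" where
  "G k s z = - \<nu> * (2 * pi / L)\<^sup>2 * (norm (freq k))\<^sup>2 * (L ^ 3 * (Y s k \<bullet> z)) + (NLp L (u s) k z - NLp L (v s) k z)"

lemma L2_uv: "L2_field L (u t)" "L2_field L (v t)"
  using leray_hopf_L2[OF leray_hopf_uv(1)[of t "t + 1"]] leray_hopf_L2[OF leray_hopf_uv(2)[of t "t + 1"]] by auto

lemma div_free_uv: "div_free_distr L (u t)" "div_free_distr L (v t)"
  using leray_hopf_div_free[OF leray_hopf_uv(1)[of t "t + 1"]] leray_hopf_div_free[OF leray_hopf_uv(2)[of t "t + 1"]] by auto

lemma bounded_uv: "\<exists>B\<ge>0. \<forall>t. L2_norm L (u t) \<le> B \<and> L2_norm L (v t) \<le> B"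
proof -
  have "bdd_above (range (\<lambda>t. L2_norm L (u t)))" "bdd_above (range (\<lambda>t. L2_norm L (v t)))"
    using u v by (auto simp: complete_bounded_leray_hopf_def)
  then obtain A B where "\<And>t. L2_norm L (u t) \<le> A" "\<And>t. L2_norm L (v t) \<le> B"
    unfolding bdd_above_def by auto
  then show ?thesis by (intro exI[of _ "max 0 (max A B)"]) (auto simp: le_max_iff_disj)
qed

lemma continuous_Y: "continuous_on {a..b} (\<lambda>t. Y t k)"
proof -
  have "continuous_on {a..max b (a + 1)} (\<lambda>t. Y t k)"
    unfolding Y_def
    by (intro continuous_intros continuous_fourier_coeff[OF L leray_hopf_uv(1)] continuous_fourier_coeff[OF L leray_hopf_uv(2)]) auto
  then show ?thesis by (rule continuous_on_subset) auto
qed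

lemma NLp_measurable_uv:
  "(\<lambda>s. NL L (u s) k i) \<in> borel_measurable (lebesgue_on {a..b})"
  "(\<lambda>s. NL L (v s) k i) \<in> borel_measurable (lebesgue_on {a..b})"
proof -
  have "(\<lambda>s. NL L (u s) k i) \<in> borel_measurable (lebesgue_on {a..max b (a + 1)})"
    "(\<lambda>s. NL L (v s) k i) \<in> borel_measurable (lebesgue_on {a..max b (a + 1)})"
    by (intro NL_measurable[OF L leray_hopf_uv(1)] NL_measurable[OF L leray_hopf_uv(2)]; simp)+
  then show "(\<lambda>s. NL L (u s) k i) \<in> borel_measurable (lebesgue_on {a..b})"
    "(\<lambda>s. NL L (v s) k i) \<in> borel_measurable (lebesgue_on {a..b})"
    by (auto elim!: measurable_restrict_mono)
qed

lemma Y_measurable: "(\<lambda>s. Y s k) \<in> borel_measurable (lebesgue_on {a..b})"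
  by (intro continuous_imp_measurable_on_sets_lebesgue continuous_Y) auto

lemma Y_orth: "(\<Sum>i\<in>UNIV. of_int (k $ i) * Y t k $ i) = 0"
  using fourier_div_free[OF L L2_uv(1) div_free_uv(1), of k t] fourier_div_free[OF L L2_uv(2) div_free_uv(2), of k t]
  by (simp add: Y_def right_diff_distrib sum_subtractf)

lemma Y_zero: "Y t 0 = 0"
proof -
  have "fourier_coeff L (w t) 0 = 0" if lh: "leray_hopf L \<nu> F t (t + 1) w" for w
  proof -
    have w2: "L2_field L (w t)" using leray_hopf_L2[OF lh, of t] by simp
    have "fourier_coeff L (w t) 0 $ j = 0" for j
    proof -
      have int: "integrable (torus L) (w t)"
        by (rule finite_measure.integrable_sqint[OF finite_measure_torus L2_field_sqint[OF w2]])
      have "(LINT x|torus L. w t x $ j) = (LINT x|torus L. w t x) $ j"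
        by (rule integral_bounded_linear[OF bounded_linear_vec_nth int])
      also have "\<dots> = 0" using leray_hopf_mean[OF lh, of t] by simp
      finally have "(LINT x|torus L. complex_of_real (w t x $ j)) = 0"
        by (simp only: integral_complex_of_real of_real_0)
      then show ?thesis by (simp add: fourier_coeff_def)
    qed
    then show ?thesis by (simp add: vec_eq_iff)
  qed
  from this[OF leray_hopf_uv(1)] this[OF leray_hopf_uv(2)] show ?thesis by (simp add: Y_def)
qed

lemma norm_fourier_coeff_le: "L2_field L g \<Longrightarrow> norm (fourier_coeff L g k) \<le> 3 * (L2_norm L g / sqrt (L ^ 3))"
proof -
  assume g: "L2_field L g"
  have "norm (fourier_coeff L g k $ j) \<le> L2_norm L g / sqrt (L ^ 3)" for j
  proof -
    have "L ^ 3 * (norm (fc L (cof g j) k))\<^sup>2 \<le> (l2 (torus L) (cof g j))\<^sup>2"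
      using bessel[OF L, of "{k}" "cof g j"] sqint_cof[OF g] by simp
    also have "\<dots> \<le> (L2_norm L g)\<^sup>2" using l2_cof_le[OF g] by (intro power_mono) auto
    finally have "(norm (fc L (cof g j) k))\<^sup>2 \<le> (L2_norm L g / sqrt (L ^ 3))\<^sup>2"
      using L by (simp add: power_divide pos_le_divide_eq mult.commute)
    then have "norm (fc L (cof g j) k) \<le> L2_norm L g / sqrt (L ^ 3)"
      by (rule power2_le_imp_le) (use L in \<open>simp add: L2_norm_eq_l2\<close>)
    then show ?thesis by (simp add: fourier_coeff_cof)
  qed
  then have "(\<Sum>j\<in>UNIV. norm (fourier_coeff L g k $ j)) \<le> (\<Sum>j\<in>(UNIV::3 set). L2_norm L g / sqrt (L ^ 3))"
    by (intro sum_mono)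
  moreover have "norm (fourier_coeff L g k) \<le> (\<Sum>j\<in>UNIV. norm (fourier_coeff L g k $ j))"
    unfolding norm_vec_def by (rule L2_set_le_sum) simp
  ultimately show ?thesis by simp
qed

lemma Y_bounded: "\<exists>B\<ge>0. \<forall>t k. norm (Y t k) \<le> B"
proof -
  obtain B where B: "0 \<le> B" "\<And>t. L2_norm L (u t) \<le> B" "\<And>t. L2_norm L (v t) \<le> B"
    using bounded_uv by blast
  have "norm (Y t k) \<le> 3 * (B / sqrt (L ^ 3)) + 3 * (B / sqrt (L ^ 3))" for t k
    unfolding Y_def using L B
    by (intro order_trans[OF norm_triangle_ineq4] add_mono order_trans[OF norm_fourier_coeff_le] L2_uv mult_left_mono divide_right_mono) auto
  then show ?thesis using B(1) L by (intro exI[of _ "3 * (B / sqrt (L ^ 3)) + 3 * (B / sqrt (L ^ 3))"]) auto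
qed

lemma G_linear: "linear (G k s)"
proof -
  interpret N1: linear "NLp L (u s) k" by (rule NLp_linear)
  interpret N2: linear "NLp L (v s) k" by (rule NLp_linear)
  show ?thesis
    by (rule linearI) (simp_all add: G_def N1.add N2.add N1.scaleR N2.scaleR inner_add_right algebra_simps)
qed

lemma G_bounded: "\<exists>C. \<forall>s z. \<bar>G k s z\<bar> \<le> C * norm z"
proof -
  obtain B where B: "0 \<le> B" "\<And>t. L2_norm L (u t) \<le> B" "\<And>t. L2_norm L (v t) \<le> B"
    using bounded_uv by blast
  obtain B' where B': "\<And>t k. norm (Y t k) \<le> B'" using Y_bounded by blast
  let ?a = "\<nu> * (2 * pi / L)\<^sup>2 * (norm (freq k))\<^sup>2 * L ^ 3"
  let ?b = "3 * ((\<Sum>j\<in>UNIV. \<bar>2 * pi / L * of_int (k $ j)\<bar>) * B\<^sup>2)"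
  have a0: "0 \<le> ?a" using L nu by simp
  have "\<bar>G k s z\<bar> \<le> (?a * B' + ?b + ?b) * norm z" for s z
  proof -
    have "\<bar>Y s k \<bullet> z\<bar> \<le> B' * norm z"
      by (rule order_trans[OF Cauchy_Schwarz_ineq2 mult_right_mono[OF B']]) simp
    then have "?a * \<bar>Y s k \<bullet> z\<bar> \<le> ?a * (B' * norm z)" by (rule mult_left_mono[OF _ a0])
    moreover have "\<bar>?a * (Y s k \<bullet> z)\<bar> = ?a * \<bar>Y s k \<bullet> z\<bar>"
      unfolding abs_mult[of ?a] by (simp only: abs_of_nonneg[OF a0])
    ultimately have "\<bar>?a * (Y s k \<bullet> z)\<bar> \<le> ?a * B' * norm z" by (simp only: mult.assoc)
    moreover have "\<bar>NLp L (u s) k z\<bar> \<le> ?b * norm z" "\<bar>NLp L (v s) k z\<bar> \<le> ?b * norm z"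
      by (intro abs_NLp_le L2_uv B)+
    moreover have "G k s z = - (?a * (Y s k \<bullet> z)) + (NLp L (u s) k z - NLp L (v s) k z)"
      by (simp add: G_def mult_ac)
    ultimately show ?thesis unfolding distrib_right by linarith
  qed
  then show ?thesis by blast
qed

lemma G_measurable:
  assumes "\<And>i. (\<lambda>s. z s $ i) \<in> borel_measurable (lebesgue_on {a..b})"
  shows "(\<lambda>s. G k s (z s)) \<in> borel_measurable (lebesgue_on {a..b})"
proof -
  have yc: "(\<lambda>s. Y s k $ i) \<in> borel_measurable (lebesgue_on {a..b})" for i
    using measurable_compose[OF Y_measurable borel_measurable_continuous_onI[OF continuous_on_component[OF continuous_on_id]]] by simp
  show ?thesis
    unfolding G_def NLp_def inner_vec_def
    using assms yc NLp_measurable_uv[of k _ a b] by measurable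
qed

lemma Y_energy:
  assumes ab: "a \<le> b"
  shows "integrable (lebesgue_on {a..b}) (\<lambda>s. 2 * G k s (Y s k))"
    and "L ^ 3 * (norm (Y b k))\<^sup>2 - L ^ 3 * (norm (Y a k))\<^sup>2 = (LINT s|lebesgue_on {a..b}. 2 * G k s (Y s k))"
proof -
  obtain B where B: "0 \<le> B" "\<And>t. L2_norm L (u t) \<le> B" "\<And>t. L2_norm L (v t) \<le> B"
    using bounded_uv by blast
  obtain B' where B': "0 \<le> B'" "\<And>t k. norm (Y t k) \<le> B'" using Y_bounded by blast
  obtain C where C: "\<And>s z. \<bar>G k s z\<bar> \<le> C * norm z" using G_bounded by blast
  have yc: "(\<lambda>s. Y s k $ i) \<in> borel_measurable (lebesgue_on {a..b})" for i a b
    using measurable_compose[OF Y_measurable borel_measurable_continuous_onI[OF continuous_on_component[OF continuous_on_id]]] by simp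
  have L3: "0 < L ^ 3" using L by simp
  show "integrable (lebesgue_on {a..b}) (\<lambda>s. 2 * G k s (Y s k))"
  proof (rule integrable_lebesgue_on_bounded)
    show "\<bar>2 * G k s (Y s k)\<bar> \<le> 2 * (\<bar>C\<bar> * B')" for s
    proof -
      have "C * norm (Y s k) \<le> \<bar>C\<bar> * B'" using B'(2)[of s k] by (intro mult_mono) auto
      then show ?thesis using C[of s "Y s k"] by simp
    qed
  qed (use G_measurable[OF yc] in measurable)
  \<comment> \<open>Steady divergence-free waves have amplitudes orthogonal to \<open>k\<close>. By
    \<open>Y_orth\<close> the coefficient \<open>Y s k\<close> is of this kind itself, so
    \<open>energy_identity\<close> applies on this subspace.\<close>
  let ?V = "{z :: complex^3. (\<Sum>i\<in>UNIV. of_int (k $ i) * z $ i) = 0}"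
  have sub: "subspace ?V"
  proof (rule subspaceI)
    fix c :: real and x assume "x \<in> ?V"
    moreover have "(\<Sum>i\<in>UNIV. of_int (k $ i) * (c *\<^sub>R x) $ i) = c *\<^sub>R (\<Sum>i\<in>UNIV. of_int (k $ i) * x $ i)"
      unfolding scaleR_sum_right by (intro sum.cong) simp_all
    ultimately show "c *\<^sub>R x \<in> ?V" by simp
  qed (simp_all add: distrib_left sum.distrib)
  have "(norm (Y b k))\<^sup>2 - (norm (Y a k))\<^sup>2 = (LINT s|lebesgue_on {a..b}. 2 * (G k s (Y s k) / L ^ 3))"
  proof (rule energy_identity[OF ab sub, where C="C / L ^ 3" and B=B'])
    show "Y s k \<in> ?V" for s using Y_orth by simp
    show "linear (\<lambda>z. G k s z / L ^ 3)" for s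
      using G_linear[of k s] by (auto simp: linear_iff add_divide_distrib)
    show "\<bar>G k s z / L ^ 3\<bar> \<le> C / L ^ 3 * norm z" for s z
      using C[of s z] L3 by (simp add: abs_divide divide_right_mono)
    show "Y d k \<bullet> z - Y c k \<bullet> z = (LINT s|lebesgue_on {c..d}. G k s z / L ^ 3)"
      if cd: "a \<le> c" "c < d" "d \<le> b" and zV: "z \<in> ?V" for c d z
    proof -
      have z: "(\<Sum>i\<in>UNIV. of_int (k $ i) * z $ i) = 0" using zV by simp
      note eu = fourier_evolution[OF L leray_hopf_uv(1)[OF cd(2)] cd(2) B(2) z]
      note ev = fourier_evolution[OF L leray_hopf_uv(2)[OF cd(2)] cd(2) B(3) z]
      have "L ^ 3 * (Y d k \<bullet> z) - L ^ 3 * (Y c k \<bullet> z) = (LINT s|lebesgue_on {c..d}. G k s z)"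
        unfolding Y_def G_def inner_diff_left
        using eu(2) ev(2) Bochner_Integration.integral_diff[OF eu(1) ev(1)]
        by (simp add: algebra_simps)
      then have "L ^ 3 * (Y d k \<bullet> z - Y c k \<bullet> z) = (LINT s|lebesgue_on {c..d}. G k s z)" by (simp add: right_diff_distrib)
      then show ?thesis using L3 by (simp add: field_simps)
    qed
    show "(\<lambda>s. G k s z / L ^ 3) \<in> borel_measurable (lebesgue_on {c..d})" for c d z
      using G_measurable[of "\<lambda>_. z" c d k] by simp
    show "(\<lambda>s. G k s (Y s k) / L ^ 3) \<in> borel_measurable (lebesgue_on {c..d})" for c d
      using G_measurable[OF yc] by simp
    show "norm (Y s k) \<le> B'" for s by (rule B')
  qed
  then have "L ^ 3 * ((norm (Y b k))\<^sup>2 - (norm (Y a k))\<^sup>2) = (LINT s|lebesgue_on {a..b}. 2 * G k s (Y s k))"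
    using L3 by (simp add: field_simps)
  then show "L ^ 3 * (norm (Y b k))\<^sup>2 - L ^ 3 * (norm (Y a k))\<^sup>2 = (LINT s|lebesgue_on {a..b}. 2 * G k s (Y s k))"
    by (simp add: right_diff_distrib)
qed

end

section \<open>The trilinear estimate\<close>

text \<open>The two conditions of the determining wavenumber at a level \<open>Q\<close> common to
  both solutions, which may exceed the least admissible level of \<open>g\<close>.\<close>

definition lp_controlled :: "real \<Rightarrow> (real^3 \<Rightarrow> real) \<Rightarrow> real \<Rightarrow> real \<Rightarrow> vfield \<Rightarrow> nat \<Rightarrow> bool" where
  "lp_controlled L chi r a g Q \<longleftrightarrow>
     (\<forall>p>int Q. wavenum L p powr (-1 + 3 / r) * Lr_norm L r (lp_proj L chi p g) < a) \<and>
     (AE x in torus L. norm (lp_low L chi (int Q) g x) \<le> a * wavenum L (int Q))"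

lemma wavenum_nat: "wavenum L (int n) = 2 ^ n / L"
  by (simp add: wavenum_def)

text \<open>Puts the bound in the form required by \<open>core_estimate\<close> with
  \<open>A = a / L\<close>: the powers of \<open>L\<close> in
  \<open>wavenum L p powr (r - 3)\<close> leave the volume \<open>L ^ 3\<close>.\<close>

lemma integral_Lr_le:
  assumes L: "0 < L" and r: "0 < r" and a: "0 < a"
    and le: "wavenum L (int p) powr (-1 + 3 / r) * Lr_norm L r g < a"
  shows "(LINT x|torus L. norm (g x) powr r) \<le> L ^ 3 * (a / L) powr r * 2 powr (real p * (r - 3))"
proof -
  define I where "I = (LINT x|torus L. norm (g x) powr r)"
  define w where "w = wavenum L (int p)"
  have w: "0 < w" using L by (simp add: w_def wavenum_nat)
  have I0: "0 \<le> I" by (simp add: I_def)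
  have "w powr (-1 + 3 / r) * I powr (1 / r) < a"
    using le by (simp add: Lr_norm_def I_def w_def)
  then have "w powr (1 - 3 / r) * (w powr (-1 + 3 / r) * I powr (1 / r)) \<le> w powr (1 - 3 / r) * a"
    by (intro mult_left_mono) auto
  then have "I powr (1 / r) \<le> w powr (1 - 3 / r) * a"
    using w by (simp add: mult.assoc[symmetric] powr_add[symmetric])
  then have "(I powr (1 / r)) powr r \<le> (w powr (1 - 3 / r) * a) powr r"
    using r by (intro powr_mono2) auto
  then have "I \<le> w powr (r - 3) * a powr r"
    using r I0 a by (simp add: powr_powr powr_mult algebra_simps)
  also have "w powr (r - 3) = 2 powr (real p * (r - 3)) / L powr (r - 3)"
    unfolding w_def wavenum_nat using L by (simp add: powr_divide powr_realpow[symmetric] powr_powr)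
  also have "2 powr (real p * (r - 3)) / L powr (r - 3) * a powr r = L ^ 3 * (a / L) powr r * 2 powr (real p * (r - 3))"
  proof -
    have "L powr r = L powr (r - 3) * L ^ 3"
      using L by (simp add: powr_diff)
    then show ?thesis using L a by (simp add: powr_divide field_simps)
  qed
  finally show ?thesis by (simp add: I_def)
qed

lemma norm_of_real_vec: "norm (\<chi> j. complex_of_real (x $ j)) = norm (x :: real^3)"
  by (simp add: norm_vec_def)

lemma trilinear_pointwise:
  fixes c d :: "3 \<Rightarrow> complex" and P :: "3 \<Rightarrow> 3 \<Rightarrow> complex"
  shows "norm (\<Sum>i\<in>UNIV. \<Sum>j\<in>UNIV. c i * d j * P i j)
    \<le> norm (\<chi> i. c i) * norm (\<chi> j. d j) * sqrt (\<Sum>i\<in>UNIV. \<Sum>j\<in>UNIV. (norm (P i j))\<^sup>2)"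
proof (rule power2_le_imp_le)
  let ?I = "UNIV \<times> UNIV :: (3 \<times> 3) set"
  let ?f = "\<lambda>p. norm (c (fst p)) * norm (d (snd p))" and ?g = "\<lambda>p. norm (P (fst p) (snd p))"
  have "norm (\<Sum>i\<in>UNIV. \<Sum>j\<in>UNIV. c i * d j * P i j) \<le> (\<Sum>i\<in>UNIV. \<Sum>j\<in>UNIV. norm (c i * d j * P i j))"
    by (intro sum_norm_le norm_sum)
  also have "\<dots> = (\<Sum>p\<in>?I. ?f p * ?g p)"
    by (simp add: sum.cartesian_product norm_mult case_prod_unfold)
  finally have "(norm (\<Sum>i\<in>UNIV. \<Sum>j\<in>UNIV. c i * d j * P i j))\<^sup>2 \<le> (\<Sum>p\<in>?I. ?f p * ?g p)\<^sup>2"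
    by (intro power_mono) auto
  also have "\<dots> \<le> (\<Sum>p\<in>?I. (?f p)\<^sup>2) * (\<Sum>p\<in>?I. (?g p)\<^sup>2)"
    by (rule Cauchy_Schwarz_ineq_sum)
  also have "(\<Sum>p\<in>?I. (?f p)\<^sup>2) = (norm (\<chi> i. c i))\<^sup>2 * (norm (\<chi> j. d j))\<^sup>2"
    unfolding norm_vec_squared sum_product
    by (simp add: sum.cartesian_product power_mult_distrib case_prod_unfold)
  also have "(\<Sum>p\<in>?I. (?g p)\<^sup>2) = (\<Sum>i\<in>UNIV. \<Sum>j\<in>UNIV. (norm (P i j))\<^sup>2)"
    by (simp add: sum.cartesian_product case_prod_unfold)
  finally show "(norm (\<Sum>i\<in>UNIV. \<Sum>j\<in>UNIV. c i * d j * P i j))\<^sup>2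
      \<le> (norm (\<chi> i. c i) * norm (\<chi> j. d j) * sqrt (\<Sum>i\<in>UNIV. \<Sum>j\<in>UNIV. (norm (P i j))\<^sup>2))\<^sup>2"
    by (simp add: power_mult_distrib sum_nonneg)
qed (simp add: sum_nonneg)

text \<open>At a fixed time, \<open>y\<close> stands for the coefficients of the difference. They
  vanish up to \<open>3 / 2 * 2 ^ Q\<close>, the range where the symbol of the low-pass equals
  1.\<close>

context
  fixes L r a :: real and chi :: "real^3 \<Rightarrow> real" and y :: "int^3 \<Rightarrow> complex^3" and Q :: nat
  assumes L: "0 < L" and r: "2 < r" "r < 3" and a: "0 < a" and chi: "lp_cutoff chi"
    and ylow: "\<And>k. norm (freq k) \<le> 3 / 2 * 2 ^ Q \<Longrightarrow> y k = 0"
begin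

abbreviation "Dsum S \<equiv> (\<Sum>k\<in>S. (norm (freq k))\<^sup>2 * (norm (y k))\<^sup>2)"

abbreviation "yM M \<equiv> tpv L y (fbox (2 ^ M - 1))"

lemma y0: "y 0 = 0"
  by (rule ylow) simp

text \<open>The low part is at most \<open>a * 2 ^ Q / L\<close>, and \<open>2 ^ Q\<close> is below
  every frequency carried by \<open>y\<close>, so one derivative of \<open>y\<close> absorbs
  it.\<close>

lemma low_estimate:
  assumes g: "lp_controlled L chi r a g Q"
  shows "(LINT x|torus L. (norm (lp_low L chi (int Q) g x))\<^sup>2 * (norm (yM M x))\<^sup>2) \<le> L ^ 3 * (a / L)\<^sup>2 * Dsum (fbox (2 ^ M - 1))"
proof -
  let ?S = "fbox (2 ^ M - 1)"
  have ysq: "integrable (torus L) (\<lambda>x. (norm (yM M x))\<^sup>2)"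
    by (intro sqint_integrable sqint_tpv) simp
  have "(LINT x|torus L. (norm (lp_low L chi (int Q) g x))\<^sup>2 * (norm (yM M x))\<^sup>2)
     \<le> (LINT x|torus L. (a * wavenum L (int Q))\<^sup>2 * (norm (yM M x))\<^sup>2)"
  proof (rule integral_mono_AE')
    show "AE x in torus L. (norm (lp_low L chi (int Q) g x))\<^sup>2 * (norm (yM M x))\<^sup>2 \<le> (a * wavenum L (int Q))\<^sup>2 * (norm (yM M x))\<^sup>2"
      using g unfolding lp_controlled_def by (auto elim!: eventually_mono intro!: mult_right_mono power_mono)
  qed (use ysq in auto)
  also have "\<dots> = (a * wavenum L (int Q))\<^sup>2 * (L ^ 3 * (\<Sum>k\<in>?S. (norm (y k))\<^sup>2))"
    by (simp add: l2_tpv L)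
  also have "\<dots> = L ^ 3 * (a / L)\<^sup>2 * (\<Sum>k\<in>?S. (2 ^ Q)\<^sup>2 * (norm (y k))\<^sup>2)"
    by (simp add: wavenum_nat power_divide power_mult_distrib sum_distrib_left[symmetric])
  also have "\<dots> \<le> L ^ 3 * (a / L)\<^sup>2 * Dsum ?S"
  proof (intro mult_left_mono sum_mono)
    fix k
    show "(2 ^ Q)\<^sup>2 * (norm (y k))\<^sup>2 \<le> (norm (freq k))\<^sup>2 * (norm (y k))\<^sup>2"
    proof (cases "norm (freq k) \<le> 3 / 2 * 2 ^ Q")
      case False
      then have "2 ^ Q \<le> norm (freq k)" using zero_less_power[of "2::real" Q] by linarith
      then show ?thesis by (intro mult_right_mono power_mono) auto
    qed (simp add: ylow)
  qed (use L in auto)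
  finally show ?thesis .
qed

lemma lp_low_split:
  assumes "Q \<le> M"
  shows "lp_low L chi (int M) g x = lp_low L chi (int Q) g x + (\<Sum>j\<in>{Q<..M}. lp_proj L chi (int j) g x)"
proof -
  have "lp_low L chi (int M) g x = (\<Sum>p\<in>{-1..int Q}. lp_proj L chi p g x) + (\<Sum>p\<in>{int Q<..int M}. lp_proj L chi p g x)"
    unfolding lp_low_def using assms by (subst sum.union_disjoint[symmetric]) (auto intro!: sum.cong)
  also have "(\<Sum>p\<in>{int Q<..int M}. lp_proj L chi p g x) = (\<Sum>j\<in>{Q<..M}. lp_proj L chi (int j) g x)"
    by (rule sum.reindex_bij_witness[of _ int nat]) auto
  finally show ?thesis by (simp add: lp_low_def)
qed

lemma high_estimate:
  assumes g: "lp_controlled L chi r a g Q"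
  shows "(LINT x|torus L. (\<Sum>j\<in>{Q<..M}. norm (lp_proj L chi (int j) g x))\<^sup>2 * (norm (yM M x))\<^sup>2)
     \<le> L ^ 3 * core_const r * (a / L)\<^sup>2 * Dsum (fbox (2 ^ M - 1))"
proof -
  \<comment> \<open>Pieces up to \<open>Q\<close> carry no \<open>L^r\<close> bound. They are set to
    zero here and belong to the low part.\<close>
  define b where "b j k = (if Q < j then (\<chi> i. of_real (lp_symbol chi (int j) (freq k)) * fc L (\<lambda>x. complex_of_real (g x $ i)) k) else 0)"
    for j k
  have tb: "norm (tpv L (b j) (fbox (2 ^ Suc j)) x) = (if Q < j then norm (lp_proj L chi (int j) g x) else 0)" for j x
  proof (cases "Q < j")
    case True
    have n: "nat (int j + 1) = Suc j" by simp
    have "tpv L (b j) (fbox (2 ^ Suc j)) x = (\<chi> i. complex_of_real (lp_proj L chi (int j) g x $ i))"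
      using True lp_proj_eq[OF chi, of "int j" "2 ^ Suc j" L g x, unfolded n]
      by (simp add: tpv_def b_def vec_eq_iff fmult_def)
    then show ?thesis using True by (simp only: norm_of_real_vec if_True)
  next
    case False
    then show ?thesis by (simp add: b_def tpv_def tp_def zero_vec_def[symmetric] norm_eq_zero vec_eq_iff)
  qed
  have "(LINT x|torus L. (\<Sum>j<Suc M. norm (tpv L (b j) (fbox (2 ^ Suc j)) x))\<^sup>2 * (norm (yM M x))\<^sup>2)
     \<le> L ^ 3 * core_const r * (a / L)\<^sup>2 * Dsum (fbox (2 ^ M - 1))"
  proof (rule core_estimate[where c=y, OF L r _ y0])
    show "0 < a / L" using a L by simp
    show "(LINT x|torus L. norm (tpv L (b j) (fbox (2 ^ Suc j)) x) powr r) \<le> L ^ 3 * (a / L) powr r * 2 powr (real j * (r - 3))" for j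
    proof (cases "Q < j")
      case True
      then show ?thesis
        unfolding tb using g r by (simp only: if_True) (intro integral_Lr_le L a; auto simp: lp_controlled_def)
    next
      case False
      then show ?thesis unfolding tb using L r by simp
    qed
  qed
  moreover have "(\<Sum>j<Suc M. norm (tpv L (b j) (fbox (2 ^ Suc j)) x)) = (\<Sum>j\<in>{Q<..M}. norm (lp_proj L chi (int j) g x))" for x
    unfolding tb by (rule sum.mono_neutral_cong_right) auto
  ultimately show ?thesis by simp
qed

lemma lp_low_vec: "(\<chi> j. complex_of_real (lp_low L chi (int M) g x $ j))
   = (\<chi> j. fmult L (\<lambda>k. chi (freq k /\<^sub>R 2 ^ Suc M)) (fbox (2 ^ Suc M)) (cof g j) x)"
proof -
  have n: "nat (int M + 1) = Suc M" by simp
  show ?thesis using lp_low_eq[OF chi, of "int M" L g x, unfolded n] by (simp add: cof_def[abs_def])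
qed

lemma lp_proj_continuous: "continuous_on UNIV (\<lambda>x. lp_proj L chi (int p) g x)"
proof -
  have "lp_proj L chi (int p) g x = (\<chi> j. Re (fmult L (\<lambda>k. lp_symbol chi (int p) (freq k)) (fbox (2 ^ Suc p)) (\<lambda>x. complex_of_real (g x $ j)) x))" for x
  proof -
    have n: "nat (int p + 1) = Suc p" by simp
    have "lp_proj L chi (int p) g x $ j = Re (complex_of_real (lp_proj L chi (int p) g x $ j))" for j by simp
    then show ?thesis
      using lp_proj_eq[OF chi, of "int p" "2 ^ Suc p" L g x, unfolded n] by (simp add: vec_eq_iff)
  qed
  then show ?thesis unfolding fmult_def by (simp add: continuous_intros)
qed

lemma lp_low_continuous: "continuous_on UNIV (\<lambda>x. lp_low L chi (int M) g x)"
proof -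
  have "lp_low L chi (int M) g x = (\<chi> j. Re ((\<chi> j. complex_of_real (lp_low L chi (int M) g x $ j)) $ j))" for x
    by (simp add: vec_eq_iff)
  then show ?thesis unfolding lp_low_vec fmult_def by (simp add: continuous_intros)
qed

lemma integrable_torus_continuous:
  fixes f :: "real^3 \<Rightarrow> real"
  assumes "continuous_on UNIV f" shows "integrable (torus L) f"
proof -
  have "compact (f ` cbox 0 (vec L))"
    by (intro compact_continuous_image continuous_on_subset[OF assms]) auto
  then obtain B where "\<forall>y\<in>f ` cbox 0 (vec L). norm y \<le> B"
    using compact_imp_bounded bounded_iff by blast
  then show ?thesis
    by (intro finite_measure.integrable_const_bound[OF finite_measure_torus, where B=B] borel_measurable_torus
        borel_measurable_continuous_onI assms AE_I2) auto
qed

lemma continuous_yM: "continuous_on UNIV (yM M)"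
  unfolding tpv_def[abs_def] by (intro continuous_intros)

text \<open>The factor \<open>2\<close> comes from the square of a sum, the \<open>1\<close> from
  the low part and \<open>core_const r\<close> from the high pieces.\<close>

lemma product_estimate:
  assumes g: "lp_controlled L chi r a g Q" and M: "Q \<le> M"
  shows "(LINT x|torus L. (norm (lp_low L chi (int M) g x))\<^sup>2 * (norm (yM M x))\<^sup>2)
     \<le> L ^ 3 * (2 * (1 + core_const r)) * (a / L)\<^sup>2 * Dsum (fbox (2 ^ M - 1))"
proof -
  let ?l = "\<lambda>x. norm (lp_low L chi (int Q) g x)" and ?h = "\<lambda>x. \<Sum>j\<in>{Q<..M}. norm (lp_proj L chi (int j) g x)"
  let ?y = "\<lambda>x. (norm (yM M x))\<^sup>2"
  note c = lp_low_continuous lp_proj_continuous continuous_yM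
  have i1: "integrable (torus L) (\<lambda>x. (?l x)\<^sup>2 * ?y x)" and i2: "integrable (torus L) (\<lambda>x. (?h x)\<^sup>2 * ?y x)"
    and i3: "integrable (torus L) (\<lambda>x. (norm (lp_low L chi (int M) g x))\<^sup>2 * ?y x)"
    by (intro integrable_torus_continuous continuous_intros c)+
  have "(LINT x|torus L. (norm (lp_low L chi (int M) g x))\<^sup>2 * ?y x) \<le> (LINT x|torus L. 2 * ((?l x)\<^sup>2 * ?y x) + 2 * ((?h x)\<^sup>2 * ?y x))"
  proof (rule integral_mono[OF i3])
    fix x
    have "norm (lp_low L chi (int M) g x) \<le> ?l x + ?h x"
      unfolding lp_low_split[OF M] by (intro order_trans[OF norm_triangle_ineq add_left_mono] norm_sum)
    then have "(norm (lp_low L chi (int M) g x))\<^sup>2 \<le> (?l x + ?h x)\<^sup>2" by (intro power_mono) auto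
    also have "\<dots> \<le> 2 * (?l x)\<^sup>2 + 2 * (?h x)\<^sup>2"
      using sum_squares_bound[of "?l x" "?h x"] by (simp add: power2_sum)
    finally have "(norm (lp_low L chi (int M) g x))\<^sup>2 * ?y x \<le> (2 * (?l x)\<^sup>2 + 2 * (?h x)\<^sup>2) * ?y x"
      by (rule mult_right_mono) simp
    then show "(norm (lp_low L chi (int M) g x))\<^sup>2 * ?y x \<le> 2 * ((?l x)\<^sup>2 * ?y x) + 2 * ((?h x)\<^sup>2 * ?y x)"
      by (simp only: distrib_right mult.assoc)
  qed (intro Bochner_Integration.integrable_add integrable_mult_right i1 i2)
  also have "\<dots> = 2 * (LINT x|torus L. (?l x)\<^sup>2 * ?y x) + 2 * (LINT x|torus L. (?h x)\<^sup>2 * ?y x)"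
    using i1 i2 by (subst Bochner_Integration.integral_add) simp_all
  also have "\<dots> \<le> 2 * (L ^ 3 * (a / L)\<^sup>2 * Dsum (fbox (2 ^ M - 1))) + 2 * (L ^ 3 * core_const r * (a / L)\<^sup>2 * Dsum (fbox (2 ^ M - 1)))"
    by (intro add_mono mult_left_mono low_estimate high_estimate g) auto
  also have "\<dots> = L ^ 3 * (2 * (1 + core_const r)) * (a / L)\<^sup>2 * Dsum (fbox (2 ^ M - 1))"
    by (simp add: algebra_simps)
  finally show ?thesis .
qed

text \<open>\<open>P\<close> is arbitrary because the two parts of the nonlinear term use a gradient
  and its transpose. As \<open>D\<close> bounds all truncated dissipations, the right-hand side is
  independent of \<open>M\<close>.\<close>

lemma trilinear_estimate:
  fixes P :: "3 \<Rightarrow> 3 \<Rightarrow> real^3 \<Rightarrow> complex"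
  assumes g: "lp_controlled L chi r a g Q" and M: "Q \<le> M" and D: "\<And>n. Dsum (fbox n) \<le> D"
    and P: "\<And>i j. continuous_on UNIV (P i j)"
    and E: "(\<Sum>i\<in>UNIV. \<Sum>j\<in>UNIV. LINT x|torus L. (norm (P i j x))\<^sup>2) \<le> E"
  shows "norm (LINT x|torus L. (\<Sum>i\<in>UNIV. \<Sum>j\<in>UNIV. complex_of_real (lp_low L chi (int M) g x $ i) * (yM M x $ j) * P i j x))
    \<le> sqrt (L ^ 3 * (2 * (1 + core_const r)) * (a / L)\<^sup>2 * D) * sqrt E"
proof -
  let ?p = "\<lambda>x. sqrt (\<Sum>i\<in>UNIV. \<Sum>j\<in>UNIV. (norm (P i j x))\<^sup>2)"
  let ?f = "\<lambda>x. norm (lp_low L chi (int M) g x) * norm (yM M x)"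
  note c = lp_low_continuous continuous_yM P
  have cf: "continuous_on UNIV ?f" and cp: "continuous_on UNIV ?p"
    by (intro continuous_intros c)+
  have sq: "sqint (torus L) h" if "continuous_on UNIV h" for h :: "real^3 \<Rightarrow> real"
    unfolding sqint_def using that
    by (auto intro!: borel_measurable_torus borel_measurable_continuous_onI integrable_torus_continuous continuous_intros)
  have core0: "0 < core_const r" by (rule core_const_pos[OF r])
  have "norm (LINT x|torus L. (\<Sum>i\<in>UNIV. \<Sum>j\<in>UNIV. complex_of_real (lp_low L chi (int M) g x $ i) * (yM M x $ j) * P i j x))
    \<le> (LINT x|torus L. ?f x * ?p x)"
  proof (rule order_trans[OF integral_norm_bound integral_mono_AE'])
    have "norm (\<Sum>i\<in>UNIV. \<Sum>j\<in>UNIV. complex_of_real (lp_low L chi (int M) g x $ i) * (yM M x $ j) * P i j x) \<le> ?f x * ?p x" for x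
      using trilinear_pointwise[of "\<lambda>i. complex_of_real (lp_low L chi (int M) g x $ i)" "\<lambda>j. yM M x $ j" "\<lambda>i j. P i j x"]
      by (simp only: norm_of_real_vec vec_lambda_eta)
    then show "AE x in torus L. norm (\<Sum>i\<in>UNIV. \<Sum>j\<in>UNIV. complex_of_real (lp_low L chi (int M) g x $ i) * (yM M x $ j) * P i j x) \<le> ?f x * ?p x"
      by (rule AE_I2)
    show "integrable (torus L) (\<lambda>x. ?f x * ?p x)"
      by (intro integrable_torus_continuous continuous_intros cf cp)
    show "AE x in torus L. 0 \<le> ?f x * ?p x"
      by (intro AE_I2 mult_nonneg_nonneg norm_ge_zero real_sqrt_ge_zero sum_nonneg zero_le_power2)
  qed
  also have "\<dots> \<le> l2 (torus L) ?f * l2 (torus L) ?p"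
    by (intro Cauchy_Schwarz_integral sq cf cp)
  also have "\<dots> \<le> sqrt (L ^ 3 * (2 * (1 + core_const r)) * (a / L)\<^sup>2 * D) * sqrt E"
  proof (rule mult_mono)
    have "(LINT x|torus L. (norm (?f x))\<^sup>2) \<le> L ^ 3 * (2 * (1 + core_const r)) * (a / L)\<^sup>2 * Dsum (fbox (2 ^ M - 1))"
      using product_estimate[OF g M] by (simp add: power_mult_distrib)
    also have "\<dots> \<le> L ^ 3 * (2 * (1 + core_const r)) * (a / L)\<^sup>2 * D"
      using L core0 by (intro mult_left_mono D) auto
    finally show "l2 (torus L) ?f \<le> sqrt (L ^ 3 * (2 * (1 + core_const r)) * (a / L)\<^sup>2 * D)"
      by (simp add: l2_def)
    have "(LINT x|torus L. (norm (?p x))\<^sup>2) = (LINT x|torus L. (\<Sum>i\<in>UNIV. \<Sum>j\<in>UNIV. (norm (P i j x))\<^sup>2))"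
      by (simp add: sum_nonneg)
    also have "\<dots> = (\<Sum>i\<in>UNIV. \<Sum>j\<in>UNIV. LINT x|torus L. (norm (P i j x))\<^sup>2)"
      by (simp add: Bochner_Integration.integral_sum integrable_torus_continuous continuous_intros P)
    finally show "l2 (torus L) ?p \<le> sqrt E" using E by (simp add: l2_def)
    have "0 \<le> Dsum (fbox 0)" by (intro sum_nonneg) auto
    then have "0 \<le> D" using D[of 0] by linarith
    then show "0 \<le> sqrt (L ^ 3 * (2 * (1 + core_const r)) * (a / L)\<^sup>2 * D)" using L core0 by simp
  qed simp
  finally show ?thesis .
qed

end

section \<open>Removal of the truncation\<close>

lemma lp_low_tendsto:
  assumes L: "0 < L" and chi: "lp_cutoff chi" and g: "L2_field L g"
  shows "(\<lambda>M. l2 (torus L) (\<lambda>x. complex_of_real (lp_low L chi (int M) g x $ j) - cof g j x)) \<longlonglongrightarrow> 0"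
proof -
  obtain B where B: "\<And>\<xi>. \<bar>chi \<xi>\<bar> \<le> B" using chi_bounded[OF chi] by blast
  have "(\<lambda>M. l2 (torus L) (\<lambda>x. fmult L (\<lambda>k. chi (freq k /\<^sub>R 2 ^ Suc M)) (fbox (2 ^ Suc M)) (cof g j) x - cof g j x)) \<longlonglongrightarrow> 0"
  proof (rule fmult_tendsto[OF L sqint_cof[OF g] finite_fbox B])
    fix n
    \<comment> \<open>\<open>4 * n \<le> M < 2 ^ M\<close> gives
      \<open>norm (freq k) \<le> 3 * n \<le> 3 / 4 * 2 ^ (M + 1)\<close>, where \<open>chi\<close>
      of the rescaled frequency is 1.\<close>
    have "k \<in> fbox (2 ^ Suc M) \<and> chi (freq k /\<^sub>R 2 ^ Suc M) = 1" if M: "4 * n \<le> M" and k: "k \<in> fbox n" for M k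
    proof
      have "M < 2 ^ M" by (rule less_exp)
      then have le: "4 * n \<le> 2 ^ M" using M by linarith
      then have "n \<le> 2 ^ Suc M" by simp
      from fbox_mono[OF this] show "k \<in> fbox (2 ^ Suc M)" using k by blast
      have "norm (freq k) \<le> (\<Sum>i\<in>UNIV. norm (freq k $ i))"
        unfolding norm_vec_def by (rule L2_set_le_sum) simp
      also have "\<dots> \<le> (\<Sum>i\<in>(UNIV::3 set). real n)"
      proof (rule sum_mono)
        fix i
        have "\<bar>k $ i\<bar> \<le> int n" using k by (simp add: fbox_def)
        then have "real_of_int \<bar>k $ i\<bar> \<le> real n" by linarith
        then show "norm (freq k $ i) \<le> real n" by simp
      qed
      also have "\<dots> = 3 * real n" by simp
      also have "\<dots> \<le> 3 / 4 * 2 ^ Suc M"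
      proof -
        have "real (4 * n) \<le> real (2 ^ M)" using le by (simp only: of_nat_le_iff)
        then show ?thesis by simp
      qed
      finally have "norm (freq k /\<^sub>R 2 ^ Suc M) \<le> 3 / 4" by (simp add: field_simps)
      then show "chi (freq k /\<^sub>R 2 ^ Suc M) = 1" by (rule chi_one[OF chi])
    qed
    then show "\<forall>\<^sub>F M in sequentially. \<forall>k\<in>fbox n. k \<in> fbox (2 ^ Suc M) \<and> chi (freq k /\<^sub>R 2 ^ Suc M) = 1"
      unfolding eventually_sequentially by blast
  qed
  moreover have "complex_of_real (lp_low L chi (int M) g x $ j) = fmult L (\<lambda>k. chi (freq k /\<^sub>R 2 ^ Suc M)) (fbox (2 ^ Suc M)) (cof g j) x" for M x
  proof -
    have n: "nat (int M + 1) = Suc M" by simp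
    show ?thesis using lp_low_eq[OF chi, of "int M" L g x j, unfolded n] by (simp add: cof_def[abs_def])
  qed
  ultimately show ?thesis by simp
qed

text \<open>
  With this constant the nonlinear term is at most half of the dissipation.
\<close>

definition determining_const :: "real \<Rightarrow> real" where
  "determining_const r = 1 / (4 * sqrt (2 * (1 + core_const r)))"

lemma determining_const_pos: "2 < r \<Longrightarrow> r < 3 \<Longrightarrow> 0 < determining_const r"
  using core_const_pos[of r] by (simp add: determining_const_def)

context
  fixes L r \<nu> :: real and chi :: "real^3 \<Rightarrow> real" and g h :: vfield and Q :: nat and D :: real and y
  assumes L: "0 < L" and r: "2 < r" "r < 3" and nu: "0 < \<nu>" and chi: "lp_cutoff chi"
    and g: "L2_field L g" and h: "L2_field L h"
    and y_def: "y \<equiv> \<lambda>k. fourier_coeff L g k - fourier_coeff L h k"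
    and ylow: "\<And>k. norm (freq k) \<le> 3 / 2 * 2 ^ Q \<Longrightarrow> y k = 0"
    and gc: "lp_controlled L chi r (determining_const r * \<nu>) g Q" and hc: "lp_controlled L chi r (determining_const r * \<nu>) h Q"
    and D: "\<And>n. (\<Sum>k\<in>fbox n. (norm (freq k))\<^sup>2 * (norm (y k))\<^sup>2) \<le> D"
begin

abbreviation "diffc j \<equiv> \<lambda>x. cof g j x - cof h j x"

lemma sqint_diffc: "sqint (torus L) (diffc j)"
  by (intro sqint_diff sqint_cof g h)

lemma fc_diffc: "fc L (diffc j) k = y k $ j"
  by (simp add: y_def fc_diff sqint_cof g h fourier_coeff_cof)

lemma yM_tendsto: "(\<lambda>M. l2 (torus L) (\<lambda>x. tpv L y (fbox (2 ^ M - 1)) x $ j - diffc j x)) \<longlonglongrightarrow> 0"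
proof -
  have "(\<lambda>M. l2 (torus L) (\<lambda>x. fmult L (\<lambda>_. 1) (fbox (2 ^ M - 1)) (diffc j) x - diffc j x)) \<longlonglongrightarrow> 0"
  proof (rule fmult_tendsto[OF L sqint_diffc finite_fbox, where B=1])
    show "\<forall>\<^sub>F M in sequentially. \<forall>k\<in>fbox n. k \<in> fbox (2 ^ M - 1) \<and> (1::real) = 1" for n
    proof -
      have "fbox n \<subseteq> fbox (2 ^ M - 1)" if "n \<le> M" for M
        using that less_exp[of M] by (intro fbox_mono) linarith
      then show ?thesis unfolding eventually_sequentially by blast
    qed
  qed simp
  moreover have "fmult L (\<lambda>_. 1) (fbox (2 ^ M - 1)) (diffc j) x = tpv L y (fbox (2 ^ M - 1)) x $ j" for M x
    by (simp add: fmult_def tpv_def fc_diffc)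
  ultimately show ?thesis by simp
qed

text \<open>The preceding estimate concerns truncations. \<open>P\<close> is a fixed bounded
  function, so convergence of the two other factors in \<open>L^2\<close> lets \<open>M\<close> tend
  to infinity under an unchanged bound.\<close>

lemma trilinear_limit_bound:
  fixes P :: "3 \<Rightarrow> 3 \<Rightarrow> real^3 \<Rightarrow> complex"
  assumes w: "L2_field L w" and wc: "lp_controlled L chi r (determining_const r * \<nu>) w Q"
    and Pc: "\<And>i j. continuous_on UNIV (P i j)" and PB: "\<And>i j x. norm (P i j x) \<le> B i j"
    and E: "(\<Sum>i\<in>UNIV. \<Sum>j\<in>UNIV. LINT x|torus L. (norm (P i j x))\<^sup>2) \<le> E"
  shows "norm (\<Sum>i\<in>UNIV. \<Sum>j\<in>UNIV. LINT x|torus L. cof w i x * (diffc j x * P i j x))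
     \<le> sqrt (L ^ 3 * (2 * (1 + core_const r)) * (determining_const r * \<nu> / L)\<^sup>2 * D) * sqrt E"
proof (rule tendsto_upperbound)
  let ?a = "\<lambda>M i x. complex_of_real (lp_low L chi (int M) w x $ i)" and ?b = "\<lambda>M j x. tpv L y (fbox (2 ^ M - 1)) x $ j"
  have Pm: "P i j \<in> borel_measurable (torus L)" for i j
    by (intro borel_measurable_torus borel_measurable_continuous_onI Pc)
  have sa: "sqint (torus L) (?a M i)" for M i
  proof -
    have n: "nat (int M + 1) = Suc M" by simp
    have "?a M i = fmult L (\<lambda>k. chi (freq k /\<^sub>R 2 ^ Suc M)) (fbox (2 ^ Suc M)) (cof w i)"
      using lp_low_eq[OF chi, of "int M" L w _ i, unfolded n] by (simp add: cof_def[abs_def])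
    then show ?thesis by (simp only: sqint_fmult)
  qed
  have sb: "sqint (torus L) (?b M j)" for M j
    by (simp add: tpv_def sqint_tp)
  have sP: "sqint (torus L) (\<lambda>x. f x * P i j x)" if "sqint (torus L) f" for f i j
    by (rule sqint_mult_bounded[OF that Pm PB])
  have lim: "(\<lambda>M. LINT x|torus L. ?a M i x * (?b M j x * P i j x)) \<longlonglongrightarrow> (LINT x|torus L. cof w i x * (diffc j x * P i j x))" for i j
  proof (rule tendsto_integral_mult_l2[OF sa sqint_cof[OF w] lp_low_tendsto[OF L chi w] sP[OF sb] sP[OF sqint_diffc]])
    have B0: "0 \<le> B i j" by (rule order_trans[OF norm_ge_zero PB])
    show "(\<lambda>M. l2 (torus L) (\<lambda>x. ?b M j x * P i j x - diffc j x * P i j x)) \<longlonglongrightarrow> 0"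
    proof (rule Lim_null_comparison[OF always_eventually])
      have "l2 (torus L) (\<lambda>x. (?b M j x - diffc j x) * P i j x) \<le> B i j * l2 (torus L) (\<lambda>x. ?b M j x - diffc j x)" for M
        by (intro l2_mult_bounded sqint_diff sb sqint_diffc Pm PB B0)
      then show "\<forall>M. norm (l2 (torus L) (\<lambda>x. ?b M j x * P i j x - diffc j x * P i j x)) \<le> B i j * l2 (torus L) (\<lambda>x. ?b M j x - diffc j x)"
        by (simp add: left_diff_distrib)
      show "(\<lambda>M. B i j * l2 (torus L) (\<lambda>x. ?b M j x - diffc j x)) \<longlonglongrightarrow> 0"
        using tendsto_mult_right_zero[OF yM_tendsto] .
    qed
  qed
  show "(\<lambda>M. norm (\<Sum>i\<in>UNIV. \<Sum>j\<in>UNIV. LINT x|torus L. ?a M i x * (?b M j x * P i j x)))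
     \<longlonglongrightarrow> norm (\<Sum>i\<in>UNIV. \<Sum>j\<in>UNIV. LINT x|torus L. cof w i x * (diffc j x * P i j x))"
    by (intro tendsto_norm tendsto_sum lim)
  have a0: "0 < determining_const r * \<nu>" using determining_const_pos[OF r] nu by simp
  have "norm (\<Sum>i\<in>UNIV. \<Sum>j\<in>UNIV. LINT x|torus L. ?a M i x * (?b M j x * P i j x))
     \<le> sqrt (L ^ 3 * (2 * (1 + core_const r)) * (determining_const r * \<nu> / L)\<^sup>2 * D) * sqrt E" if M: "Q \<le> M" for M
  proof -
    have int: "integrable (torus L) (\<lambda>x. ?a M i x * (?b M j x * P i j x))" for i j
      by (intro integrable_mult_sqint sa sP sb)
    have "(\<Sum>i\<in>UNIV. \<Sum>j\<in>UNIV. LINT x|torus L. ?a M i x * (?b M j x * P i j x))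
       = (LINT x|torus L. (\<Sum>i\<in>UNIV. \<Sum>j\<in>UNIV. ?a M i x * ?b M j x * P i j x))"
      unfolding mult.assoc using int by (simp add: Bochner_Integration.integral_sum)
    then show ?thesis
      using trilinear_estimate[OF L r a0 chi ylow wc M D Pc E] by (simp only:)
  qed
  then show "\<forall>\<^sub>F M in sequentially. norm (\<Sum>i\<in>UNIV. \<Sum>j\<in>UNIV. LINT x|torus L. ?a M i x * (?b M j x * P i j x))
     \<le> sqrt (L ^ 3 * (2 * (1 + core_const r)) * (determining_const r * \<nu> / L)\<^sup>2 * D) * sqrt E"
    unfolding eventually_sequentially by blast
qed simp

text \<open>The derivative in direction \<open>i\<close> of component \<open>j\<close> of the
  truncated difference.\<close>

definition gradP :: "nat \<Rightarrow> 3 \<Rightarrow> 3 \<Rightarrow> real^3 \<Rightarrow> complex" where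
  "gradP n i j = tp L (\<lambda>k. \<i> * of_real (2 * pi / L * of_int (k $ i)) * y k $ j) (fbox n)"

lemma sum_NLp:
  assumes w: "L2_field L w"
  shows "(\<Sum>k\<in>fbox n. NLp L w k (y k)) = Re (\<Sum>i\<in>UNIV. \<Sum>j\<in>UNIV. LINT x|torus L. cof w i x * (cof w j x * gradP n i j x))"
proof -
  let ?c = "\<lambda>k i j. \<i> * complex_of_real (2 * pi / L * of_int (k $ i)) * y k $ j"
  have "(LINT x|torus L. cof w i x * (cof w j x * gradP n i j x)) = (\<Sum>k\<in>fbox n. ?c k i j * tri L (cof w i) (cof w j) k)" for i j
  proof -
    have "(LINT x|torus L. cof w i x * (cof w j x * gradP n i j x))
       = (LINT x|torus L. (\<Sum>k\<in>fbox n. ?c k i j * (cof w i x * (cof w j x * expw L k x))))"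
      unfolding gradP_def tp_def sum_distrib_left by (intro Bochner_Integration.integral_cong sum.cong refl) (simp only: mult_ac)
    also have "\<dots> = (\<Sum>k\<in>fbox n. LINT x|torus L. ?c k i j * (cof w i x * (cof w j x * expw L k x)))"
      by (intro Bochner_Integration.integral_sum integrable_mult_right integrable_tri sqint_cof w)
    finally show ?thesis by (simp only: integral_mult_right_zero tri_def)
  qed
  then have "(\<Sum>i\<in>UNIV. \<Sum>j\<in>UNIV. LINT x|torus L. cof w i x * (cof w j x * gradP n i j x))
     = (\<Sum>i\<in>UNIV. \<Sum>j\<in>UNIV. \<Sum>k\<in>fbox n. ?c k i j * tri L (cof w i) (cof w j) k)" by simp
  also have "\<dots> = (\<Sum>i\<in>UNIV. \<Sum>k\<in>fbox n. \<Sum>j\<in>UNIV. ?c k i j * tri L (cof w i) (cof w j) k)"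
    by (intro sum.cong refl sum.swap)
  also have "\<dots> = (\<Sum>k\<in>fbox n. \<Sum>i\<in>UNIV. \<Sum>j\<in>UNIV. ?c k i j * tri L (cof w i) (cof w j) k)"
    by (rule sum.swap)
  also have "\<dots> = (\<Sum>k\<in>fbox n. \<Sum>j\<in>UNIV. \<Sum>i\<in>UNIV. ?c k i j * tri L (cof w i) (cof w j) k)"
    by (intro sum.cong refl sum.swap)
  also have "\<dots> = (\<Sum>k\<in>fbox n. \<Sum>j\<in>UNIV. y k $ j * NL L w k j)"
    unfolding NL_def sum_distrib_left by (intro sum.cong refl) (simp only: mult_ac)
  finally show ?thesis by (simp only: NLp_def Re_sum)
qed

lemma norm_gradP_le: "\<exists>B. \<forall>x. norm (gradP n i j x) \<le> B"
  unfolding gradP_def using norm_tp_le by blast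

lemma sum_l2_gradP:
  "(\<Sum>i\<in>UNIV. \<Sum>j\<in>UNIV. LINT x|torus L. (norm (gradP n i j x))\<^sup>2)
    = L ^ 3 * (2 * pi / L)\<^sup>2 * (\<Sum>k\<in>fbox n. (norm (freq k))\<^sup>2 * (norm (y k))\<^sup>2)"
proof -
  have "(LINT x|torus L. (norm (gradP n i j x))\<^sup>2) = (\<Sum>k\<in>fbox n. L ^ 3 * (2 * pi / L)\<^sup>2 * ((norm (freq k $ i))\<^sup>2 * (norm (y k $ j))\<^sup>2))" for i j
    using l2_tp[OF L finite_fbox, of "\<lambda>k. \<i> * of_real (2 * pi / L * of_int (k $ i)) * y k $ j" n]
    unfolding l2_squared gradP_def norm_mult norm_of_real norm_ii freq_nth
    by (simp add: sum_distrib_left power_mult_distrib power_divide mult_ac)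
  then have "(\<Sum>i\<in>UNIV. \<Sum>j\<in>UNIV. LINT x|torus L. (norm (gradP n i j x))\<^sup>2)
     = (\<Sum>i\<in>UNIV. \<Sum>j\<in>UNIV. \<Sum>k\<in>fbox n. L ^ 3 * (2 * pi / L)\<^sup>2 * ((norm (freq k $ i))\<^sup>2 * (norm (y k $ j))\<^sup>2))" by simp
  also have "\<dots> = (\<Sum>i\<in>UNIV. \<Sum>k\<in>fbox n. \<Sum>j\<in>UNIV. L ^ 3 * (2 * pi / L)\<^sup>2 * ((norm (freq k $ i))\<^sup>2 * (norm (y k $ j))\<^sup>2))"
    by (intro sum.cong refl sum.swap)
  also have "\<dots> = (\<Sum>k\<in>fbox n. \<Sum>i\<in>UNIV. \<Sum>j\<in>UNIV. L ^ 3 * (2 * pi / L)\<^sup>2 * ((norm (freq k $ i))\<^sup>2 * (norm (y k $ j))\<^sup>2))"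
    by (rule sum.swap)
  also have "\<dots> = L ^ 3 * (2 * pi / L)\<^sup>2 * (\<Sum>k\<in>fbox n. (norm (freq k))\<^sup>2 * (norm (y k))\<^sup>2)"
  proof -
    have "(norm (freq k))\<^sup>2 * (norm (y k))\<^sup>2 = (\<Sum>i\<in>UNIV. \<Sum>j\<in>UNIV. (norm (freq k $ i))\<^sup>2 * (norm (y k $ j))\<^sup>2)" for k
      by (simp only: norm_vec_squared[of "freq k"] norm_vec_squared[of "y k"] sum_product)
    then show ?thesis by (simp only: sum_distrib_left)
  qed
  finally show ?thesis .
qed

text \<open>The tensor \<open>g_i g_j - h_i h_j\<close> splits as \<open>g_i w_j + w_i h_j\<close>.
  The gradient is that of a truncation of \<open>w\<close>, so neither term cancels; each is at most
  a quarter of \<open>\<nu> * (2 * pi / L)^2 * L ^ 3 * D\<close>.\<close>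

lemma nonlinear_bound:
  "\<bar>\<Sum>k\<in>fbox n. NLp L g k (y k) - NLp L h k (y k)\<bar> \<le> \<nu> * (2 * pi / L)\<^sup>2 * L ^ 3 * D / 2"
proof -
  let ?P = "gradP n"
  obtain B where B: "\<And>i j x. norm (?P i j x) \<le> B i j"
    using norm_gradP_le[of n] by metis
  have Pc: "continuous_on UNIV (?P i j)" for i j
    unfolding gradP_def by (rule continuous_tp)
  have Pm: "?P i j \<in> borel_measurable (torus L)" for i j
    by (intro borel_measurable_torus borel_measurable_continuous_onI Pc)
  let ?E = "L ^ 3 * (2 * pi / L)\<^sup>2 * D"
  have D0: "0 \<le> D" using order_trans[OF sum_nonneg D[of 0]] by auto
  have E1: "(\<Sum>i\<in>UNIV. \<Sum>j\<in>UNIV. LINT x|torus L. (norm (?P i j x))\<^sup>2) \<le> ?E"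
    unfolding sum_l2_gradP using L by (intro mult_left_mono D) auto
  have E2: "(\<Sum>i\<in>UNIV. \<Sum>j\<in>UNIV. LINT x|torus L. (norm (?P j i x))\<^sup>2) \<le> ?E"
    using E1 by (subst sum.swap)
  have int: "integrable (torus L) (\<lambda>x. a x * (b x * ?P i j x))" if "sqint (torus L) a" "sqint (torus L) b" for a b i j
    by (intro integrable_mult_sqint that sqint_mult_bounded[OF that(2) Pm B])
  have split: "(LINT x|torus L. cof g i x * (cof g j x * ?P i j x)) - (LINT x|torus L. cof h i x * (cof h j x * ?P i j x))
      = (LINT x|torus L. cof g i x * (diffc j x * ?P i j x)) + (LINT x|torus L. cof h j x * (diffc i x * ?P i j x))" for i j
  proof -
    have "(LINT x|torus L. cof g i x * (cof g j x * ?P i j x)) - (LINT x|torus L. cof h i x * (cof h j x * ?P i j x))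
       = (LINT x|torus L. cof g i x * (cof g j x * ?P i j x) - cof h i x * (cof h j x * ?P i j x))"
      by (intro Bochner_Integration.integral_diff[symmetric] int sqint_cof g h)
    also have "\<dots> = (LINT x|torus L. cof g i x * (diffc j x * ?P i j x) + cof h j x * (diffc i x * ?P i j x))"
      by (intro Bochner_Integration.integral_cong refl) (simp add: algebra_simps)
    also have "\<dots> = (LINT x|torus L. cof g i x * (diffc j x * ?P i j x)) + (LINT x|torus L. cof h j x * (diffc i x * ?P i j x))"
      by (intro Bochner_Integration.integral_add int sqint_cof g h sqint_diffc)
    finally show ?thesis .
  qed
  let ?X = "\<Sum>i\<in>UNIV. \<Sum>j\<in>UNIV. LINT x|torus L. cof g i x * (diffc j x * ?P i j x)"
  let ?Z = "\<Sum>i\<in>UNIV. \<Sum>j\<in>UNIV. LINT x|torus L. cof h i x * (diffc j x * ?P j i x)"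
  let ?K = "sqrt (L ^ 3 * (2 * (1 + core_const r)) * (determining_const r * \<nu> / L)\<^sup>2 * D) * sqrt ?E"
  have X: "norm ?X \<le> ?K" by (rule trilinear_limit_bound[OF g gc Pc B E1])
  have Z: "norm ?Z \<le> ?K"
    by (rule trilinear_limit_bound[OF h hc Pc[of j i for i j] B[of j i for i j] E2])
  have "(\<Sum>k\<in>fbox n. NLp L g k (y k) - NLp L h k (y k))
    = Re (\<Sum>i\<in>UNIV. \<Sum>j\<in>UNIV. (LINT x|torus L. cof g i x * (cof g j x * ?P i j x)) - (LINT x|torus L. cof h i x * (cof h j x * ?P i j x)))"
    by (simp only: sum_subtractf sum_NLp[OF g] sum_NLp[OF h] minus_complex.sel)
  also have "\<dots> = Re (?X + (\<Sum>i\<in>UNIV. \<Sum>j\<in>UNIV. LINT x|torus L. cof h j x * (diffc i x * ?P i j x)))"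
    unfolding split sum.distrib ..
  also have "(\<Sum>i\<in>UNIV. \<Sum>j\<in>UNIV. LINT x|torus L. cof h j x * (diffc i x * ?P i j x)) = ?Z"
    by (rule sum.swap)
  finally have "\<bar>\<Sum>k\<in>fbox n. NLp L g k (y k) - NLp L h k (y k)\<bar> \<le> norm (?X + ?Z)"
    using abs_Re_le_cmod[of "?X + ?Z"] by simp
  also have "\<dots> \<le> ?K + ?K"
    by (intro order_trans[OF norm_triangle_ineq] add_mono X Z)
  also have "?K + ?K \<le> \<nu> * (2 * pi / L)\<^sup>2 * L ^ 3 * D / 2"
  proof -
    define c where "c = sqrt (2 * (1 + core_const r))"
    have c: "0 < c" using core_const_pos[OF r] by (simp add: c_def)
    have "?K = sqrt (L ^ 3 * D) * c * (determining_const r * \<nu> / L) * (sqrt (L ^ 3 * D) * (2 * pi / L))"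
      using L nu determining_const_pos[OF r] by (simp add: real_sqrt_mult c_def real_sqrt_divide)
    also have "\<dots> = (sqrt (L ^ 3 * D) * sqrt (L ^ 3 * D)) * (c * determining_const r) * \<nu> * (2 * pi) / L\<^sup>2"
      by (simp add: power2_eq_square mult_ac)
    also have "sqrt (L ^ 3 * D) * sqrt (L ^ 3 * D) = L ^ 3 * D" using L D0 by simp
    also have "c * determining_const r = 1 / 4" unfolding determining_const_def c_def[symmetric] using c by simp
    finally have K: "?K = L ^ 3 * D * \<nu> * (2 * pi) / L\<^sup>2 / 4" by simp
    \<comment> \<open>The product estimate measures frequencies without the factor
      \<open>2 * pi\<close>, so the bound has one such factor fewer than the dissipation.\<close>
    have "2 * pi \<le> (2 * pi)\<^sup>2" using pi_gt3 by (simp add: power2_eq_square)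
    then have "L ^ 3 * D * \<nu> * (2 * pi) / L\<^sup>2 \<le> L ^ 3 * D * \<nu> * (2 * pi)\<^sup>2 / L\<^sup>2"
      using L D0 nu by (intro divide_right_mono mult_left_mono) auto
    moreover have "\<nu> * (2 * pi / L)\<^sup>2 * L ^ 3 * D / 2 = L ^ 3 * D * \<nu> * (2 * pi)\<^sup>2 / L\<^sup>2 / 2"
      by (simp only: power_divide times_divide_eq_left times_divide_eq_right mult_ac)
    moreover have "p / 4 + p / 4 \<le> s" if "p \<le> q" "s = q / 2" for p q s :: real
      using that by simp
    ultimately show ?thesis unfolding K by blast
  qed
  finally show ?thesis .
qed

end

section \<open>The determining wavenumber\<close>

text \<open>The infimum of the empty set is infinite, so a finite value provides a least admissible
  \<open>q\<close>, where the infimum is attained because \<open>wavenum\<close> increases.\<close>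

lemma det_wavenum_least:
  assumes L: "0 < L" and le: "det_wavenum L chi r c \<nu> g \<le> ereal (wavenum L (int Q))"
  obtains q where "q \<le> Q" "det_wavenum L chi r c \<nu> g = ereal (wavenum L (int q))"
    "\<forall>p>int q. wavenum L p powr (-1 + 3 / r) * Lr_norm L r (lp_proj L chi p g) < c * \<nu>"
    "ereal (1 / wavenum L (int q)) * Linf_norm L (lp_low L chi (int q) g) < ereal (c * \<nu>)"
proof -
  define P where "P q \<longleftrightarrow> (\<forall>p>int q. wavenum L p powr (-1 + 3 / r) * Lr_norm L r (lp_proj L chi p g) < c * \<nu>) \<and>
     ereal (1 / wavenum L (int q)) * Linf_norm L (lp_low L chi (int q) g) < ereal (c * \<nu>)" for q :: nat
  have d: "det_wavenum L chi r c \<nu> g = Inf {ereal (wavenum L (int q)) | q :: nat. P q}"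
    by (simp add: det_wavenum_def P_def)
  have ex: "\<exists>q. P q"
  proof (rule ccontr)
    assume "\<not> ?thesis"
    then have "{ereal (wavenum L (int q)) | q :: nat. P q} = {}" by blast
    then have "det_wavenum L chi r c \<nu> g = \<infinity>" unfolding d by (simp add: top_ereal_def)
    then show False using le by simp
  qed
  define q where "q = (LEAST q. P q)"
  have q: "P q" unfolding q_def using ex by (rule LeastI_ex)
  have mono: "wavenum L (int m) \<le> wavenum L (int n)" if "m \<le> n" for m n
    unfolding wavenum_nat using L that by (intro divide_right_mono power_increasing) auto
  have inf: "det_wavenum L chi r c \<nu> g = ereal (wavenum L (int q))"
    unfolding d
  proof (rule antisym)
    show "Inf {ereal (wavenum L (int q)) | q :: nat. P q} \<le> ereal (wavenum L (int q))"
      using q by (intro Inf_lower) blast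
    show "ereal (wavenum L (int q)) \<le> Inf {ereal (wavenum L (int q)) | q :: nat. P q}"
      by (rule Inf_greatest) (auto simp: q_def intro!: mono Least_le)
  qed
  have "q \<le> Q"
  proof (rule ccontr)
    assume "\<not> ?thesis"
    then have "(2::real) ^ Q < 2 ^ q" by (intro power_strict_increasing) auto
    then have "wavenum L (int Q) < wavenum L (int q)"
      unfolding wavenum_nat using L by (simp add: divide_strict_right_mono)
    then show False using le unfolding inf by simp
  qed
  then show ?thesis using that inf q unfolding P_def by blast
qed

lemma Linf_norm_AE:
  assumes L: "0 < L" and le: "ereal (1 / wavenum L (int q)) * Linf_norm L g < ereal a"
  shows "AE x in torus L. norm (g x) \<le> a * wavenum L (int q)"
proof -
  let ?w = "wavenum L (int q)"
  have w: "0 < ?w" using L by (simp add: wavenum_nat)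
  have "Linf_norm L g \<le> ereal (a * ?w)"
  proof (cases "Linf_norm L g")
    case (real m)
    then show ?thesis using le w by (simp add: field_simps)
  next
    case PInf
    then show ?thesis using le w by simp
  qed simp
  then show ?thesis
    using esssup_AE[of "\<lambda>x. ereal (norm (g x))" "torus L"] unfolding Linf_norm_def[symmetric]
    by (auto elim!: eventually_mono dest: order_trans)
qed

text \<open>The low-pass symbol equals 1 as long as
  \<open>norm (freq k) / 2 ^ (Q + 1) \<le> 3 / 4\<close>, so these coefficients can be read off from
  the low part.\<close>

lemma low_modes_equal:
  assumes L: "0 < L" and chi: "lp_cutoff chi" 
    and eq: "AE x in torus L. lp_low L chi (int Q) g x = lp_low L chi (int Q) h x"
    and k: "norm (freq k) \<le> 3 / 2 * 2 ^ Q"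
  shows "fourier_coeff L g k = fourier_coeff L h k"
proof -
  have n: "nat (int Q + 1) = Suc Q" by simp
  let ?m = "\<lambda>k. chi (freq k /\<^sub>R 2 ^ Suc Q)"
  have kf: "k \<in> fbox (2 ^ Suc Q)"
    using k by (intro norm_freq_in_fbox) (simp add: order_trans[OF _ mult_right_mono[of "3/2" 2]])
  have mk: "?m k = 1"
    using k by (intro chi_one[OF chi]) (simp add: field_simps)
  have "fourier_coeff L g k $ j = fourier_coeff L h k $ j" for j
  proof -
    have fe: "fmult L ?m (fbox (2 ^ Suc Q)) (cof f j) = (\<lambda>x. complex_of_real (lp_low L chi (int Q) f x $ j))" for f
      using lp_low_eq[OF chi, of "int Q" L f _ j, unfolded n] by (simp add: cof_def[abs_def])
    have "fc L (fmult L ?m (fbox (2 ^ Suc Q)) (cof g j)) k = fc L (fmult L ?m (fbox (2 ^ Suc Q)) (cof h j)) k"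
      unfolding fc_def
    proof (rule arg_cong[where f="\<lambda>z. z / _"], rule integral_cong_AE)
      show "AE x in torus L. fmult L ?m (fbox (2 ^ Suc Q)) (cof g j) x * expw L (- k) x
          = fmult L ?m (fbox (2 ^ Suc Q)) (cof h j) x * expw L (- k) x"
        unfolding fe using eq by (rule eventually_mono) simp
    qed (intro borel_measurable_times sqint_borel[OF sqint_fmult] borel_measurable_torus[OF expw_borel])+
    then show ?thesis using kf mk by (simp add: fc_fmult L fourier_coeff_cof)
  qed
  then show ?thesis by (simp add: vec_eq_iff)
qed

section \<open>Fields and their Fourier coefficients\<close>

lemma fourier_coeff_cong_AE:
  assumes "L2_field L g" "L2_field L h" and "AE x in torus L. g x = h x"
  shows "fourier_coeff L g k = fourier_coeff L h k"
proof -
  have "fc L (cof g j) k = fc L (cof h j) k" for j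
    unfolding fc_def
    by (intro arg_cong[where f="\<lambda>z. z / _"] integral_cong_AE borel_measurable_times sqint_borel sqint_cof assms borel_measurable_torus expw_borel)
       (use assms(3) in \<open>auto simp: cof_def elim!: eventually_mono\<close>)
  then show ?thesis by (simp add: vec_eq_iff fourier_coeff_cof)
qed

lemma AE_eq_if_fourier_coeff_eq:
  assumes L: "0 < L" and g: "L2_field L g" and h: "L2_field L h"
    and eq: "\<And>k. fourier_coeff L g k = fourier_coeff L h k"
  shows "AE x in torus L. g x = h x"
proof -
  have "AE x in torus L. g x $ j = h x $ j" for j
  proof -
    let ?w = "\<lambda>x. cof g j x - cof h j x"
    have sw: "sqint (torus L) ?w" by (intro sqint_diff sqint_cof g h)
    have "fc L ?w k = 0" for k
      using eq[of k] by (simp add: fc_diff sqint_cof g h flip: fourier_coeff_cof)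
    then have "psum L n ?w x = 0" for n x by (simp add: psum_eq)
    then have "(\<lambda>n. l2 (torus L) (\<lambda>x. 0 - ?w x)) \<longlonglongrightarrow> 0"
      using psum_tendsto[OF L sw] by simp
    then have "l2 (torus L) (\<lambda>x. 0 - ?w x) = 0" by (simp add: LIMSEQ_const_iff)
    then have "l2 (torus L) ?w = 0" by (simp add: l2_minus del: minus_diff_eq)
    then have "(LINT x|torus L. (norm (?w x))\<^sup>2) = 0" by (simp add: l2_def)
    then have "AE x in torus L. (norm (?w x))\<^sup>2 = 0"
      using integral_nonneg_eq_0_iff_AE[OF sqint_integrable[OF sw]] by simp
    then show ?thesis by (rule eventually_mono) (simp add: cof_def)
  qed
  then have "AE x in torus L. \<forall>j. g x $ j = h x $ j" unfolding AE_all_countable by blast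
  then show ?thesis by (rule eventually_mono) (simp add: vec_eq_iff)
qed

text \<open>Bessel's inequality for each weak derivative, which ties the coefficients to the
  \<open>H^1\<close> norm in the definition of a solution.\<close>

lemma dissipation_bound:
  assumes L: "0 < L" and g: "H1_field L g"
  shows "(2 * pi / L)\<^sup>2 * L ^ 3 * (\<Sum>k\<in>fbox n. (norm (freq k))\<^sup>2 * (norm (fourier_coeff L g k))\<^sup>2) \<le> grad_norm_sq L g"
proof -
  note wp = weak_pderiv_props(1)[OF g]
  have comp: "L ^ 3 * (\<Sum>k\<in>fbox n. (2 * pi / L)\<^sup>2 * ((norm (freq k $ i))\<^sup>2 * (norm (fourier_coeff L g k $ j))\<^sup>2))
      \<le> (LINT x|torus L. (weak_pderiv L i g x $ j)\<^sup>2)" for i j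
  proof -
    have "(norm (fc L (cof (weak_pderiv L i g) j) k))\<^sup>2 = (2 * pi / L)\<^sup>2 * ((norm (freq k $ i))\<^sup>2 * (norm (fourier_coeff L g k $ j))\<^sup>2)" for k
      unfolding fc_weak_pderiv[OF L g] fourier_coeff_cof norm_mult norm_of_real norm_ii freq_nth
      by (simp add: power_mult_distrib power_divide)
    then show ?thesis
      using bessel[OF L finite_fbox[of n] sqint_cof[OF wp[of i], of j]] by (simp add: l2_squared cof_def)
  qed
  have "(2 * pi / L)\<^sup>2 * L ^ 3 * (\<Sum>k\<in>fbox n. (norm (freq k))\<^sup>2 * (norm (fourier_coeff L g k))\<^sup>2)
     = (\<Sum>k\<in>fbox n. \<Sum>i\<in>UNIV. \<Sum>j\<in>UNIV. L ^ 3 * ((2 * pi / L)\<^sup>2 * ((norm (freq k $ i))\<^sup>2 * (norm (fourier_coeff L g k $ j))\<^sup>2)))"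
  proof -
    have "(norm (freq k))\<^sup>2 * (norm (fourier_coeff L g k))\<^sup>2
      = (\<Sum>i\<in>UNIV. \<Sum>j\<in>UNIV. (norm (freq k $ i))\<^sup>2 * (norm (fourier_coeff L g k $ j))\<^sup>2)" for k
      by (simp only: norm_vec_squared[of "freq k"] norm_vec_squared[of "fourier_coeff L g k"] sum_product)
    then show ?thesis by (simp only: sum_distrib_left mult_ac)
  qed
  also have "\<dots> = (\<Sum>i\<in>UNIV. \<Sum>k\<in>fbox n. \<Sum>j\<in>UNIV. L ^ 3 * ((2 * pi / L)\<^sup>2 * ((norm (freq k $ i))\<^sup>2 * (norm (fourier_coeff L g k $ j))\<^sup>2)))"
    by (rule sum.swap)
  also have "\<dots> = (\<Sum>i\<in>UNIV. \<Sum>j\<in>UNIV. \<Sum>k\<in>fbox n. L ^ 3 * ((2 * pi / L)\<^sup>2 * ((norm (freq k $ i))\<^sup>2 * (norm (fourier_coeff L g k $ j))\<^sup>2)))"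
    by (intro sum.cong refl sum.swap)
  also have "\<dots> \<le> (\<Sum>i\<in>UNIV. \<Sum>j\<in>UNIV. LINT x|torus L. (weak_pderiv L i g x $ j)\<^sup>2)"
    by (intro sum_mono comp[unfolded sum_distrib_left])
  also have "\<dots> = grad_norm_sq L g"
  proof -
    have "(L2_norm L (weak_pderiv L i g))\<^sup>2 = (\<Sum>j\<in>UNIV. LINT x|torus L. (weak_pderiv L i g x $ j)\<^sup>2)" for i
    proof -
      have int: "integrable (torus L) (\<lambda>x. (weak_pderiv L i g x $ j)\<^sup>2)" for j
        using sqint_integrable[OF sqint_cof[OF wp, of i j]] by (simp add: cof_def)
      have "(L2_norm L (weak_pderiv L i g))\<^sup>2 = (LINT x|torus L. (\<Sum>j\<in>UNIV. (weak_pderiv L i g x $ j)\<^sup>2))"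
        unfolding L2_norm_eq_l2 l2_squared by (simp add: norm_vec_squared)
      then show ?thesis by (simp add: Bochner_Integration.integral_sum int)
    qed
    then show ?thesis by (simp add: grad_norm_sq_def)
  qed
  finally show ?thesis .
qed

section \<open>Decay of the difference\<close>

lemma leray_hopf_H1_integrable:
  "leray_hopf L \<nu> F a b u \<Longrightarrow> integrable (lebesgue_on {a..b}) (\<lambda>t. (H1_norm L (u t))\<^sup>2)"
  by (simp add: leray_hopf_def)

context solution_pair
begin

section \<open>Energy and dissipation of the difference\<close>

definition Dn :: "nat \<Rightarrow> real \<Rightarrow> real" where
  "Dn n t = (\<Sum>k\<in>fbox n. (norm (freq k))\<^sup>2 * (norm (Y t k))\<^sup>2)"

definition En :: "nat \<Rightarrow> real \<Rightarrow> real" where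
  "En n t = (\<Sum>k\<in>fbox n. (norm (Y t k))\<^sup>2)"

text \<open>A conditional supremum: it has its intended value at times where both fields are in
  \<open>H^1\<close>, since \<open>Dn_le_R\<close> bounds the family there, hence at almost every
  time.\<close>

definition D :: "real \<Rightarrow> real" where
  "D t = (SUP n. Dn n t)"

text \<open>An integrable majorant of all \<open>Dn n\<close>. The factor 2 is from the square of a
  difference, the denominator from \<open>dissipation_bound\<close>.\<close>

definition R :: "real \<Rightarrow> real" where
  "R t = 2 / ((2 * pi / L)\<^sup>2 * L ^ 3) * ((H1_norm L (u t))\<^sup>2 + (H1_norm L (v t))\<^sup>2)"

lemma Dn_mono: "m \<le> n \<Longrightarrow> Dn m t \<le> Dn n t"
  unfolding Dn_def by (intro sum_mono2 fbox_mono) auto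

lemma En_mono: "m \<le> n \<Longrightarrow> En m t \<le> En n t"
  unfolding En_def by (intro sum_mono2 fbox_mono) auto

lemma Dn_nonneg: "0 \<le> Dn n t"
  unfolding Dn_def by (intro sum_nonneg) auto

text \<open>Poincare inequality: the zero mode is absent, and every other frequency has norm at
  least 1.\<close>

lemma En_le_Dn: "En n t \<le> Dn n t"
  unfolding En_def Dn_def
proof (rule sum_mono)
  fix k
  show "(norm (Y t k))\<^sup>2 \<le> (norm (freq k))\<^sup>2 * (norm (Y t k))\<^sup>2"
  proof (cases "k = 0")
    case False
    then obtain i where "k $ i \<noteq> 0" by (auto simp: vec_eq_iff)
    then have "1 \<le> \<bar>freq k $ i\<bar>" by simp
    also have "\<dots> \<le> norm (freq k)" by (rule component_le_norm_cart)
    finally have "1\<^sup>2 \<le> (norm (freq k))\<^sup>2" by (intro power_mono) auto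
    then show ?thesis using mult_right_mono[of 1 "(norm (freq k))\<^sup>2" "(norm (Y t k))\<^sup>2"] by simp
  qed (simp add: Y_zero)
qed

lemma Dn_le_R:
  assumes "H1_field L (u t)" "H1_field L (v t)"
  shows "Dn n t \<le> R t"
proof -
  let ?K = "(2 * pi / L)\<^sup>2 * L ^ 3"
  have K: "0 < ?K" using L by simp
  have H: "grad_norm_sq L g \<le> (H1_norm L g)\<^sup>2" for g
    unfolding H1_norm_def by (simp add: grad_norm_sq_def sum_nonneg)
  have "Dn n t \<le> (\<Sum>k\<in>fbox n. 2 * ((norm (freq k))\<^sup>2 * (norm (fourier_coeff L (u t) k))\<^sup>2) + 2 * ((norm (freq k))\<^sup>2 * (norm (fourier_coeff L (v t) k))\<^sup>2))"
    unfolding Dn_def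
  proof (rule sum_mono)
    fix k
    let ?a = "norm (fourier_coeff L (u t) k)" and ?b = "norm (fourier_coeff L (v t) k)"
    have "(norm (Y t k))\<^sup>2 \<le> (?a + ?b)\<^sup>2" unfolding Y_def by (intro power_mono norm_triangle_ineq4) auto
    also have "\<dots> \<le> 2 * ?a\<^sup>2 + 2 * ?b\<^sup>2" using sum_squares_bound[of ?a ?b] by (simp add: power2_sum)
    finally have "(norm (freq k))\<^sup>2 * (norm (Y t k))\<^sup>2 \<le> (norm (freq k))\<^sup>2 * (2 * ?a\<^sup>2 + 2 * ?b\<^sup>2)"
      by (rule mult_left_mono) simp
    then show "(norm (freq k))\<^sup>2 * (norm (Y t k))\<^sup>2 \<le> 2 * ((norm (freq k))\<^sup>2 * ?a\<^sup>2) + 2 * ((norm (freq k))\<^sup>2 * ?b\<^sup>2)"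
      by (simp add: algebra_simps)
  qed
  then have "?K * Dn n t \<le> ?K * (2 * (\<Sum>k\<in>fbox n. (norm (freq k))\<^sup>2 * (norm (fourier_coeff L (u t) k))\<^sup>2)
      + 2 * (\<Sum>k\<in>fbox n. (norm (freq k))\<^sup>2 * (norm (fourier_coeff L (v t) k))\<^sup>2))"
    using K by (intro mult_left_mono) (simp_all add: sum.distrib sum_distrib_left)
  also have "\<dots> \<le> 2 * ((H1_norm L (u t))\<^sup>2 + (H1_norm L (v t))\<^sup>2)"
    using order_trans[OF dissipation_bound[OF L assms(1), of n] H] order_trans[OF dissipation_bound[OF L assms(2), of n] H]
    by (simp add: distrib_left)
  finally show ?thesis using K by (simp add: R_def pos_le_divide_eq mult.commute)
qed

lemma En_bounded: "\<exists>B\<ge>0. \<forall>n t. En n t \<le> B"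
proof -
  obtain B where B: "0 \<le> B" "\<And>t. L2_norm L (u t) \<le> B" "\<And>t. L2_norm L (v t) \<le> B"
    using bounded_uv by blast
  have "En n t \<le> 3 * (2 * B)\<^sup>2 / L ^ 3" for n t
  proof -
    have "L ^ 3 * (\<Sum>k\<in>fbox n. (norm (Y t k $ j))\<^sup>2) \<le> (2 * B)\<^sup>2" for j
    proof -
      let ?w = "\<lambda>x. cof (u t) j x - cof (v t) j x"
      have "L ^ 3 * (\<Sum>k\<in>fbox n. (norm (fc L ?w k))\<^sup>2) \<le> (l2 (torus L) ?w)\<^sup>2"
        by (intro bessel L finite_fbox sqint_diff sqint_cof L2_uv)
      also have "l2 (torus L) ?w \<le> 2 * B"
        using l2_triangle_diff[OF sqint_cof[OF L2_uv(1)] sqint_cof[OF L2_uv(2)], of t j t j]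
          l2_cof_le[OF L2_uv(1), of t j] l2_cof_le[OF L2_uv(2), of t j] B(2,3)[of t] by linarith
      then have "(l2 (torus L) ?w)\<^sup>2 \<le> (2 * B)\<^sup>2" by (intro power_mono) auto
      finally show ?thesis by (simp add: Y_def fc_diff sqint_cof L2_uv fourier_coeff_cof)
    qed
    then have "(\<Sum>j\<in>UNIV. L ^ 3 * (\<Sum>k\<in>fbox n. (norm (Y t k $ j))\<^sup>2)) \<le> (\<Sum>j\<in>(UNIV::3 set). (2 * B)\<^sup>2)"
      by (intro sum_mono)
    also have "(\<Sum>j\<in>UNIV. L ^ 3 * (\<Sum>k\<in>fbox n. (norm (Y t k $ j))\<^sup>2)) = L ^ 3 * En n t"
      unfolding En_def norm_vec_squared by (simp only: sum_distrib_left[symmetric] sum.swap[of _ UNIV])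
    finally show ?thesis using L by (simp add: pos_le_divide_eq mult.commute)
  qed
  then show ?thesis using L by (intro exI[of _ "3 * (2 * B)\<^sup>2 / L ^ 3"]) auto
qed

lemma AE_H1: "AE t in lebesgue_on {a..b}. H1_field L (u t) \<and> H1_field L (v t)"
  if "a < b"
  using leray_hopf_H1[OF leray_hopf_uv(1)[OF that]] leray_hopf_H1[OF leray_hopf_uv(2)[OF that]] by eventually_elim auto

lemma R_integrable: "a < b \<Longrightarrow> integrable (lebesgue_on {a..b}) R"
  unfolding R_def[abs_def]
  by (intro integrable_mult_right Bochner_Integration.integrable_add
      leray_hopf_H1_integrable[OF leray_hopf_uv(1)] leray_hopf_H1_integrable[OF leray_hopf_uv(2)])

lemma Dn_measurable: "Dn n \<in> borel_measurable (lebesgue_on {a..b})"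
  unfolding Dn_def[abs_def]
  by (intro borel_measurable_sum borel_measurable_times borel_measurable_const borel_measurable_power
      measurable_compose[OF Y_measurable borel_measurable_norm])

lemma Dn_le_D: assumes "H1_field L (u t)" "H1_field L (v t)" shows "Dn n t \<le> D t"
  unfolding D_def using Dn_le_R[OF assms] by (intro cSUP_upper) (auto intro!: bdd_aboveI)

lemma Dn_tendsto: assumes "H1_field L (u t)" "H1_field L (v t)" shows "(\<lambda>n. Dn n t) \<longlonglongrightarrow> D t"
  unfolding D_def using Dn_le_R[OF assms]
  by (intro LIMSEQ_incseq_SUP) (auto intro!: bdd_aboveI incseq_SucI Dn_mono)

lemma D_measurable: assumes "a < b" shows "D \<in> borel_measurable (lebesgue_on {a..b})"
proof -
  define lim' where "lim' t = lim (\<lambda>n. Dn n t)" for t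
  have m: "lim' \<in> borel_measurable (lebesgue_on {a..b})"
    unfolding lim'_def[abs_def] by (intro borel_measurable_lim_metric Dn_measurable)
  show ?thesis
  proof (rule borel_measurable_lebesgue_on_AE[OF _ m])
    show "AE t in lebesgue_on {a..b}. D t = lim' t"
      by (rule eventually_mono[OF AE_H1[OF assms]]) (auto simp: lim'_def dest: limI[OF Dn_tendsto])
  qed auto
qed

end

context solution_pair
begin

lemma D_integrable: assumes "a < b" shows "integrable (lebesgue_on {a..b}) D"
proof (rule Bochner_Integration.integrable_bound[OF R_integrable[OF assms] D_measurable[OF assms]])
  show "AE t in lebesgue_on {a..b}. norm (D t) \<le> norm (R t)"
  proof (rule eventually_mono[OF AE_H1[OF assms]])
    fix t assume t: "H1_field L (u t) \<and> H1_field L (v t)"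
    have "0 \<le> D t" using order_trans[OF Dn_nonneg Dn_le_D[of t 0]] t by blast
    moreover have "D t \<le> R t" unfolding D_def using t by (intro cSUP_least Dn_le_R) auto
    ultimately show "norm (D t) \<le> norm (R t)" by simp
  qed
qed

lemma Dn_integral_tendsto:
  assumes ab: "a < b"
  shows "integrable (lebesgue_on {a..b}) (Dn n)"
    and "(\<lambda>n. LINT t|lebesgue_on {a..b}. Dn n t) \<longlonglongrightarrow> (LINT t|lebesgue_on {a..b}. D t)"
proof -
  have dom: "AE t in lebesgue_on {a..b}. norm (Dn n t) \<le> R t" for n
    by (rule eventually_mono[OF AE_H1[OF ab]]) (simp add: Dn_nonneg Dn_le_R)
  show "integrable (lebesgue_on {a..b}) (Dn n)"
    by (rule Bochner_Integration.integrable_bound[OF R_integrable[OF ab] Dn_measurable])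
       (use dom[of n] in \<open>auto elim!: eventually_mono\<close>)
  show "(\<lambda>n. LINT t|lebesgue_on {a..b}. Dn n t) \<longlonglongrightarrow> (LINT t|lebesgue_on {a..b}. D t)"
    by (rule integral_dominated_convergence[OF D_measurable[OF ab] Dn_measurable R_integrable[OF ab] _ dom])
       (rule eventually_mono[OF AE_H1[OF ab]], simp add: Dn_tendsto)
qed

text \<open>With \<open>K = \<nu> * (2 * pi / L)^2\<close>, the truncated energy loses
  \<open>2 * K * Dn\<close> and gains at most \<open>K * D\<close> per unit time. As the integral of
  \<open>Dn\<close> tends to that of \<open>D\<close>, a loss of \<open>K * D\<close>
  remains.\<close>

lemma energy_decay:
  assumes ab: "a < b" "b \<le> 0"
    and bound: "\<And>t n. t < 0 \<Longrightarrow> H1_field L (u t) \<Longrightarrow> H1_field L (v t) \<Longrightarrow>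
      \<bar>\<Sum>k\<in>fbox n. NLp L (u t) k (Y t k) - NLp L (v t) k (Y t k)\<bar> \<le> \<nu> * (2 * pi / L)\<^sup>2 * L ^ 3 * D t / 2"
  shows "En n b \<le> (SUP n. En n a) - \<nu> * (2 * pi / L)\<^sup>2 * (LINT t|lebesgue_on {a..b}. D t)"
proof -
  let ?K = "\<nu> * (2 * pi / L)\<^sup>2"
  have K0: "0 \<le> ?K" using nu by simp
  have L3: "0 < L ^ 3" using L by simp
  obtain B where B: "\<And>n t. En n t \<le> B" using En_bounded by blast
  have bdd: "bdd_above (range (\<lambda>n. En n a))" using B by (auto intro!: bdd_aboveI)
  have step: "En m b \<le> (SUP n. En n a) - 2 * ?K * (LINT t|lebesgue_on {a..b}. Dn m t) + ?K * (LINT t|lebesgue_on {a..b}. D t)" for m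
  proof -
    have "L ^ 3 * En m b - L ^ 3 * En m a = (\<Sum>k\<in>fbox m. L ^ 3 * (norm (Y b k))\<^sup>2 - L ^ 3 * (norm (Y a k))\<^sup>2)"
      by (simp add: En_def sum_subtractf sum_distrib_left)
    also have "\<dots> = (\<Sum>k\<in>fbox m. LINT s|lebesgue_on {a..b}. 2 * G k s (Y s k))"
      using ab(1) by (intro sum.cong refl Y_energy(2)) simp
    also have "\<dots> = (LINT s|lebesgue_on {a..b}. (\<Sum>k\<in>fbox m. 2 * G k s (Y s k)))"
      using ab(1) by (intro Bochner_Integration.integral_sum[symmetric] Y_energy(1)) simp
    also have "\<dots> \<le> (LINT s|lebesgue_on {a..b}. - (2 * ?K * L ^ 3) * Dn m s + (?K * L ^ 3) * D s)"
    proof (rule integral_mono_AE)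
      show "integrable (lebesgue_on {a..b}) (\<lambda>s. \<Sum>k\<in>fbox m. 2 * G k s (Y s k))"
        using ab(1) by (intro Bochner_Integration.integrable_sum Y_energy(1)) simp
      show "integrable (lebesgue_on {a..b}) (\<lambda>s. - (2 * ?K * L ^ 3) * Dn m s + (?K * L ^ 3) * D s)"
        by (intro Bochner_Integration.integrable_add integrable_mult_right Dn_integral_tendsto(1) D_integrable ab)
      \<comment> \<open>The bound is known at negative times only, and \<open>b\<close> may be
        \<open>0\<close>.\<close>
      have "AE s in lebesgue_on {a..b}. s \<noteq> b"
      proof -
        have "AE s in lebesgue. s \<noteq> b"
          using AE_not_in[of "{b}" lebesgue] negligible_sing[of b] by (simp add: negligible_iff_null_sets)
        then show ?thesis by (simp add: AE_restrict_space_iff) (auto elim: eventually_mono)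
      qed
      then have "AE s in lebesgue_on {a..b}. s < 0 \<and> H1_field L (u s) \<and> H1_field L (v s)"
        using AE_H1[OF ab(1)] AE_space[of "lebesgue_on {a..b}"] by eventually_elim (use ab in auto)
      then show "AE s in lebesgue_on {a..b}. (\<Sum>k\<in>fbox m. 2 * G k s (Y s k)) \<le> - (2 * ?K * L ^ 3) * Dn m s + (?K * L ^ 3) * D s"
      proof (rule eventually_mono)
        fix s assume s: "s < 0 \<and> H1_field L (u s) \<and> H1_field L (v s)"
        let ?N = "\<Sum>k\<in>fbox m. NLp L (u s) k (Y s k) - NLp L (v s) k (Y s k)"
        have "(\<Sum>k\<in>fbox m. 2 * G k s (Y s k)) = (\<Sum>k\<in>fbox m. - (2 * ?K * L ^ 3) * ((norm (freq k))\<^sup>2 * (norm (Y s k))\<^sup>2)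
            + 2 * (NLp L (u s) k (Y s k) - NLp L (v s) k (Y s k)))"
          by (intro sum.cong refl) (simp add: G_def power2_norm_eq_inner[of "Y s _"] mult_ac)
        also have "\<dots> = - (2 * ?K * L ^ 3) * Dn m s + 2 * ?N"
          by (simp only: sum.distrib sum_distrib_left[symmetric] Dn_def)
        also have "2 * ?N \<le> ?K * L ^ 3 * D s"
          using bound[of s m] s by (simp add: abs_le_iff)
        finally show "(\<Sum>k\<in>fbox m. 2 * G k s (Y s k)) \<le> - (2 * ?K * L ^ 3) * Dn m s + (?K * L ^ 3) * D s" by simp
      qed
    qed
    also have "\<dots> = L ^ 3 * (- (2 * ?K) * (LINT t|lebesgue_on {a..b}. Dn m t) + ?K * (LINT t|lebesgue_on {a..b}. D t))"
      using Dn_integral_tendsto(1)[OF ab(1), of m] D_integrable[OF ab(1)]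
      by (subst Bochner_Integration.integral_add) (simp_all add: algebra_simps)
    finally have "L ^ 3 * (En m b - En m a) \<le> L ^ 3 * (- (2 * ?K) * (LINT t|lebesgue_on {a..b}. Dn m t) + ?K * (LINT t|lebesgue_on {a..b}. D t))"
      by (simp only: right_diff_distrib)
    then have "En m b - En m a \<le> - (2 * ?K) * (LINT t|lebesgue_on {a..b}. Dn m t) + ?K * (LINT t|lebesgue_on {a..b}. D t)"
      using L3 by (simp only: mult_le_cancel_left_pos)
    moreover have "En m a \<le> (SUP n. En n a)" by (rule cSUP_upper[OF UNIV_I bdd])
    moreover have "x \<le> S - 2 * K * p + K * q" if "x - z \<le> - (2 * K) * p + K * q" "z \<le> S" for x z S K p q :: real
      using that by linarith
    ultimately show ?thesis by blast
  qed
  have "(\<lambda>m. (SUP n. En n a) - 2 * ?K * (LINT t|lebesgue_on {a..b}. Dn m t) + ?K * (LINT t|lebesgue_on {a..b}. D t))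
      \<longlonglongrightarrow> (SUP n. En n a) - 2 * ?K * (LINT t|lebesgue_on {a..b}. D t) + ?K * (LINT t|lebesgue_on {a..b}. D t)"
    by (intro tendsto_intros Dn_integral_tendsto(2) ab)
  \<comment> \<open>On the left the truncation stays at \<open>n\<close>, which
    \<open>En_mono\<close> permits for all \<open>m \<ge> n\<close>; only the right-hand side moves
    to the limit.\<close>
  moreover have "eventually (\<lambda>m. En n b \<le> (SUP n. En n a) - 2 * ?K * (LINT t|lebesgue_on {a..b}. Dn m t) + ?K * (LINT t|lebesgue_on {a..b}. D t)) sequentially"
    unfolding eventually_sequentially using order_trans[OF En_mono step] by blast
  ultimately have "En n b \<le> (SUP n. En n a) - 2 * ?K * (LINT t|lebesgue_on {a..b}. D t) + ?K * (LINT t|lebesgue_on {a..b}. D t)"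
    by (intro tendsto_lowerbound[of _ _ sequentially]) auto
  moreover have "x - 2 * K * q + K * q = x - K * q" for x K q :: real by simp
  ultimately show ?thesis by metis
qed

text \<open>
  The energy of the difference at time \<open>a\<close> is bounded uniformly in \<open>a\<close>, whereas the dissipation over
  \<open>{a..b}\<close> is at least a multiple of \<open>b - a\<close> times the energy at time \<open>b\<close>.
\<close>

lemma Y_vanishes:
  assumes bound: "\<And>t n. t < 0 \<Longrightarrow> H1_field L (u t) \<Longrightarrow> H1_field L (v t) \<Longrightarrow>
      \<bar>\<Sum>k\<in>fbox n. NLp L (u t) k (Y t k) - NLp L (v t) k (Y t k)\<bar> \<le> \<nu> * (2 * pi / L)\<^sup>2 * L ^ 3 * D t / 2"
    and b: "b \<le> 0"
  shows "Y b k = 0"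
proof -
  obtain B where B: "0 \<le> B" "\<And>n t. En n t \<le> B" using En_bounded by blast
  let ?K = "\<nu> * (2 * pi / L)\<^sup>2"
  have K: "0 < ?K" using nu L by simp
  have bdd: "bdd_above (range (\<lambda>n. En n a))" for a using B(2) by (auto intro!: bdd_aboveI)
  have En0: "En n b \<le> 0" for n
  proof (rule ccontr)
    assume "\<not> ?thesis"
    then have pos: "0 < En n b" by simp
    \<comment> \<open>\<open>N\<close> is so large that the dissipation over an interval of length
      \<open>N\<close> would exceed the energy bound \<open>B\<close>.\<close>
    obtain N :: nat where N: "B < real N * (?K * En n b)"
      using reals_Archimedean3[of "?K * En n b"] pos K by (metis mult_pos_pos)
    define a where "a = b - real N - 1"
    have ab: "a < b" by (simp add: a_def)
    have Dpos: "AE t in lebesgue_on {a..b}. 0 \<le> D t"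
      by (rule eventually_mono[OF AE_H1[OF ab]]) (use order_trans[OF Dn_nonneg Dn_le_D] in blast)
    \<comment> \<open>Energy decay on \<open>{t..b}\<close> with nonnegative dissipation. Combined
      with \<open>En_le_Dn\<close> it bounds \<open>D t\<close> from below for almost every
      \<open>t\<close> in \<open>{a..b}\<close>.\<close>
    have mono: "En n b \<le> (SUP n. En n t)" if t: "t \<le> b" for t
    proof (cases "t = b")
      case True
      then show ?thesis using cSUP_upper[OF UNIV_I bdd] by blast
    next
      case False
      then have tb: "t < b" using t by simp
      have "0 \<le> (LINT s|lebesgue_on {t..b}. D s)"
      proof (rule integral_nonneg_AE)
        show "AE s in lebesgue_on {t..b}. 0 \<le> D s"
          by (rule eventually_mono[OF AE_H1[OF tb]]) (use order_trans[OF Dn_nonneg Dn_le_D] in blast)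
      qed
      then have "0 \<le> ?K * (LINT s|lebesgue_on {t..b}. D s)" using K by simp
      then show ?thesis using energy_decay[OF tb b bound, of n] by simp
    qed
    have "(LINT t|lebesgue_on {a..b}. En n b) \<le> (LINT t|lebesgue_on {a..b}. D t)"
    proof (rule integral_mono_AE[OF _ D_integrable[OF ab]])
      show "integrable (lebesgue_on {a..b}) (\<lambda>t. En n b)"
        by (rule finite_measure.integrable_const[OF finite_measure_Icc])
      have "AE t in lebesgue_on {a..b}. t \<le> b \<and> H1_field L (u t) \<and> H1_field L (v t)"
        using AE_H1[OF ab] AE_space[of "lebesgue_on {a..b}"] by eventually_elim auto
      then show "AE t in lebesgue_on {a..b}. En n b \<le> D t"
      proof (rule eventually_mono)
        fix t assume t: "t \<le> b \<and> H1_field L (u t) \<and> H1_field L (v t)"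
        have "En n b \<le> (SUP n. En n t)" using t by (intro mono) simp
        also have "\<dots> \<le> D t"
          using t by (intro cSUP_least) (auto intro: order_trans[OF En_le_Dn Dn_le_D])
        finally show "En n b \<le> D t" .
      qed
    qed
    moreover have "(LINT t|lebesgue_on {a..b}. En n b) = En n b * (b - a)"
      using measure_Icc[of a b] ab by simp
    ultimately have "?K * (En n b * (b - a)) \<le> ?K * (LINT t|lebesgue_on {a..b}. D t)"
      using K by (intro mult_left_mono) (auto simp: mult.commute)
    then have "En n b + ?K * (En n b * (b - a)) \<le> (SUP n. En n a)"
      using energy_decay[OF ab b bound, of n] by simp
    also have "\<dots> \<le> B" using B(2) by (intro cSUP_least) auto
    finally have "En n b + ?K * (En n b * (b - a)) \<le> B" .
    moreover have "real N * (?K * En n b) \<le> ?K * (En n b * (b - a))"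
    proof -
      have "?K * En n b * real N \<le> ?K * En n b * (b - a)"
        using K pos by (intro mult_left_mono) (auto simp: a_def)
      then show ?thesis by (simp only: mult_ac)
    qed
    ultimately show False using N pos by linarith
  qed
  obtain n where "k \<in> fbox n" using in_some_fbox by blast
  then have "(norm (Y b k))\<^sup>2 \<le> En n b"
    unfolding En_def by (intro member_le_sum) auto
  then have "(norm (Y b k))\<^sup>2 \<le> 0" using En0[of n] by (rule order_trans)
  then show ?thesis by simp
qed

end

text \<open>The hypothesis at negative times serves to supply the bound required by
  \<open>Y_vanishes\<close>. The conclusion includes time \<open>0\<close> because the energy
  estimate up to \<open>b = 0\<close> needs that bound only almost everywhere.\<close>

theorem theorem1p2:
  fixes chi :: "real^3 \<Rightarrow> real" and r :: real
  assumes "lp_cutoff chi" and "2 < r" and "r < 3"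
  shows "\<exists>c>0. \<forall>(L::real) (\<nu>::real) (F :: vfield \<Rightarrow> real) (u :: real \<Rightarrow> vfield) (v :: real \<Rightarrow> vfield)
           (Q :: real \<Rightarrow> enat).
     L > 0 \<longrightarrow> \<nu> > 0 \<longrightarrow> Hminus1 L F \<longrightarrow> zero_mean_force F \<longrightarrow>
     complete_bounded_leray_hopf L \<nu> F u \<longrightarrow>
     complete_bounded_leray_hopf L \<nu> F v \<longrightarrow>
     (\<forall>t. max (det_wavenum L chi r c \<nu> (u t)) (det_wavenum L chi r c \<nu> (v t))
            = wavenum_ext L (Q t)) \<longrightarrow>
     (\<forall>t<0. AE x in torus L. lp_low_ext L chi (Q t) (u t) x = lp_low_ext L chi (Q t) (v t) x) \<longrightarrow>
     (\<forall>t\<le>0. AE x in torus L. u t x = v t x)"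
proof (intro exI[of _ "determining_const r"] conjI allI impI)
  show "0 < determining_const r" by (rule determining_const_pos[OF assms(2,3)])
  fix L \<nu> :: real and F u v and Q :: "real \<Rightarrow> enat" and t :: real
  assume L: "0 < L" and nu: "0 < \<nu>"
    and u: "complete_bounded_leray_hopf L \<nu> F u" and v: "complete_bounded_leray_hopf L \<nu> F v"
    and Q: "\<forall>t. max (det_wavenum L chi r (determining_const r) \<nu> (u t)) (det_wavenum L chi r (determining_const r) \<nu> (v t)) = wavenum_ext L (Q t)"
    and low: "\<forall>t<0. AE x in torus L. lp_low_ext L chi (Q t) (u t) x = lp_low_ext L chi (Q t) (v t) x"
    and t: "t \<le> 0"
  interpret solution_pair L \<nu> F u v by unfold_locales fact+
  have bound: "\<bar>\<Sum>k\<in>fbox n. NLp L (u s) k (Y s k) - NLp L (v s) k (Y s k)\<bar> \<le> \<nu> * (2 * pi / L)\<^sup>2 * L ^ 3 * D s / 2"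
    if s: "s < 0" and H: "H1_field L (u s)" "H1_field L (v s)" for s n
  proof (cases "Q s")
    \<comment> \<open>The low part is then the whole field, so the hypothesis itself says that the
      solutions agree at time \<open>s\<close>.\<close>
    case infinity
    then have "AE x in torus L. u s x = v s x"
      using low[rule_format, OF s] by simp
    then have "Y s k = 0" for k
      using fourier_coeff_cong_AE[OF L2_uv] by (simp add: Y_def)
    moreover have "NLp L g k 0 = 0" for g k by (simp add: NLp_def)
    moreover have "0 \<le> D s" using order_trans[OF Dn_nonneg Dn_le_D[OF H, of 0]] .
    ultimately show ?thesis using L nu by simp
  next
    case (enat q)
    let ?c = "determining_const r"
    have eq: "AE x in torus L. lp_low L chi (int q) (u s) x = lp_low L chi (int q) (v s) x"
      using low s enat by fastforce
    have mx: "max (det_wavenum L chi r ?c \<nu> (u s)) (det_wavenum L chi r ?c \<nu> (v s)) = ereal (wavenum L (int q))"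
      using Q enat by (metis wavenum_ext.simps(1))
    then have le: "det_wavenum L chi r ?c \<nu> (u s) \<le> ereal (wavenum L (int q))" "det_wavenum L chi r ?c \<nu> (v s) \<le> ereal (wavenum L (int q))"
      by (metis max.cobounded1, metis max.cobounded2)
    obtain qu where qu: "qu \<le> q" "det_wavenum L chi r ?c \<nu> (u s) = ereal (wavenum L (int qu))"
      "\<forall>p>int qu. wavenum L p powr (-1 + 3 / r) * Lr_norm L r (lp_proj L chi p (u s)) < ?c * \<nu>"
      "ereal (1 / wavenum L (int qu)) * Linf_norm L (lp_low L chi (int qu) (u s)) < ereal (?c * \<nu>)"
      by (rule det_wavenum_least[OF L le(1)])
    obtain qv where qv: "qv \<le> q" "det_wavenum L chi r ?c \<nu> (v s) = ereal (wavenum L (int qv))"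
      "\<forall>p>int qv. wavenum L p powr (-1 + 3 / r) * Lr_norm L r (lp_proj L chi p (v s)) < ?c * \<nu>"
      "ereal (1 / wavenum L (int qv)) * Linf_norm L (lp_low L chi (int qv) (v s)) < ereal (?c * \<nu>)"
      by (rule det_wavenum_least[OF L le(2)])
    have inj: "m = n" if "wavenum L (int m) = wavenum L (int n)" for m n
      using that L by (simp add: wavenum_nat)
    \<comment> \<open>The maximum is attained by one of the two levels, so at least one low part is
      bounded at level \<open>q\<close>.\<close>
    have "qu = q \<or> qv = q"
      using mx qu(2) qv(2) inj unfolding max_def by (auto split: if_splits)
    then have "(AE x in torus L. norm (lp_low L chi (int q) (u s) x) \<le> ?c * \<nu> * wavenum L (int q))
      \<or> (AE x in torus L. norm (lp_low L chi (int q) (v s) x) \<le> ?c * \<nu> * wavenum L (int q))"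
      using Linf_norm_AE[OF L qu(4)] Linf_norm_AE[OF L qv(4)] by blast
    \<comment> \<open>The low parts agree almost everywhere, so the bound passes to the other
      solution.\<close>
    then have lows: "AE x in torus L. norm (lp_low L chi (int q) (u s) x) \<le> ?c * \<nu> * wavenum L (int q)"
      "AE x in torus L. norm (lp_low L chi (int q) (v s) x) \<le> ?c * \<nu> * wavenum L (int q)"
    proof -
      assume or: "(AE x in torus L. norm (lp_low L chi (int q) (u s) x) \<le> ?c * \<nu> * wavenum L (int q))
        \<or> (AE x in torus L. norm (lp_low L chi (int q) (v s) x) \<le> ?c * \<nu> * wavenum L (int q))"
      show "AE x in torus L. norm (lp_low L chi (int q) (u s) x) \<le> ?c * \<nu> * wavenum L (int q)"
        using or
      proof
        assume "AE x in torus L. norm (lp_low L chi (int q) (v s) x) \<le> ?c * \<nu> * wavenum L (int q)"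
        with eq show ?thesis by eventually_elim simp
      qed
      show "AE x in torus L. norm (lp_low L chi (int q) (v s) x) \<le> ?c * \<nu> * wavenum L (int q)"
        using or
      proof
        assume "AE x in torus L. norm (lp_low L chi (int q) (u s) x) \<le> ?c * \<nu> * wavenum L (int q)"
        with eq show ?thesis by eventually_elim simp
      qed
    qed
    have ylow: "fourier_coeff L (u s) k - fourier_coeff L (v s) k = 0" if "norm (freq k) \<le> 3 / 2 * 2 ^ q" for k
      using low_modes_equal[OF L assms(1) eq that] by simp
    have cu: "lp_controlled L chi r (?c * \<nu>) (u s) q"
      unfolding lp_controlled_def using qu(1,3) lows(1) by auto
    have cv: "lp_controlled L chi r (?c * \<nu>) (v s) q"
      unfolding lp_controlled_def using qv(1,3) lows(2) by auto
    have Dle: "(\<Sum>k\<in>fbox m. (norm (freq k))\<^sup>2 * (norm (fourier_coeff L (u s) k - fourier_coeff L (v s) k))\<^sup>2) \<le> D s" for m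
      using Dn_le_D[OF H, of m] by (simp add: Dn_def Y_def)
    show ?thesis
      unfolding Y_def
      by (rule nonlinear_bound[OF L assms(2,3) nu assms(1) L2_uv(1) L2_uv(2) reflexive ylow cu cv Dle])
  qed
  have "Y t k = 0" for k by (rule Y_vanishes[OF bound t])
  then show "AE x in torus L. u t x = v t x"
    by (intro AE_eq_if_fourier_coeff_eq[OF L L2_uv]) (simp add: Y_def)
qed

end
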